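(* Let $K$ be the function field of a smooth hyperelliptic curve $X$ whose affine part is defined by $y^2-f(x)$ with $\deg f$ odd, and let $\mathfrak{p}\in X$ be a point of even degree. Then $\mathfrak{p}$ is $2$-divisible in $\operatorname{Pic} K$ if and only if $\operatorname{n}\mathfrak{p}$ is a norm from $K$, i.e. \[ \mathfrak{p}\in 2\operatorname{Pic} K\iff \exists_{\lambda\in K^*}\ \operatorname{n}\mathfrak{p}=\operatorname{n}\lambda . \]
   Context: $k$ is a finite field of characteristic $\neq 2$, $K=\operatorname{qf}\bigl(k[x,y]/(y^2-f(x))\bigr)$ is the function field of a smooth curve $X$ (here "hyperelliptic" includes the elliptic case $\deg f=3$), with $k$ the full field of constants, and $L=k(x)$ is the rational function field. The norm of divisors $\operatorname{N}\colon\operatorname{Div}K\to\operatorname{Div}L$ is given by $\operatorname{N}(\sum a_i\mathfrak{p}_i)=\sum a_i f(\mathfrak{p}_i/\pi(\mathfrak{p}_i))\,\pi(\mathfrak{p}_i)$, where $\pi\colon X\to\mathbb{P}^1_k$ is the covering map and $f(\cdot/\cdot)$ is the inertia degree. To each point of $\mathbb{P}^1_k$ one assigns the monic irreducible polynomial in $k[x]$ vanishing exactly there, or $1/x$ for the point at infinity; this gives a homomorphism $\operatorname{Div}L\to L^*$. The composition with $\operatorname{N}$ is denoted $\operatorname{n}\colon\operatorname{Div}K\to L^*$, and $\operatorname{n}$ also denotes the field norm $K^*\to L^*$. *)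

theory Defs
  imports
    "HOL-Algebra.QuotRing"
    "HOL-Algebra.Embedded_Algebras"
    "HOL-Algebra.Free_Abelian_Groups"
    "HOL-Computational_Algebra.Computational_Algebra"
begin

section \<open>Places, divisors and Picard group of a function field\<close>

text \<open>
  In this section a function field over the field of constants \<open>'k\<close> is a field \<open>'F\<close> together
  with an embedding \<open>c\<close> of \<open>'k\<close>.  The (closed) points of the smooth projective curve with function
  field \<open>'F\<close> are the places of \<open>'F\<close> over \<open>'k\<close>; a place is represented by its valuation ring.
\<close>

definition places :: "('k \<Rightarrow> 'F::field) \<Rightarrow> 'F set set" where
  "places c = {V. range c \<subseteq> V \<and> V \<noteq> UNIV \<and>
     (\<forall>a\<in>V. \<forall>b\<in>V. a - b \<in> V \<and> a * b \<in> V) \<and>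
     (\<forall>z. z \<in> V \<or> inverse z \<in> V)}"

definition max_ideal :: "'F::field set \<Rightarrow> 'F set" where
  "max_ideal V = {z \<in> V. z = 0 \<or> inverse z \<notin> V}"

definition ring_of :: "'F::field set \<Rightarrow> 'F ring" where
  "ring_of V = \<lparr>carrier = V, monoid.mult = (*), one = 1, ring.zero = 0, add = (+)\<rparr>"

definition residue_field :: "'F::field set \<Rightarrow> 'F set ring" where
  "residue_field V = ring_of V Quot max_ideal V"

definition residue_class :: "'F::field set \<Rightarrow> 'F \<Rightarrow> 'F set" where
  "residue_class V a = max_ideal V +>\<^bsub>ring_of V\<^esub> a"

text \<open>The dimension of the residue field over the image in it of a subring \<open>S\<close> of \<open>V\<close>
  (a field in the two uses below).\<close>

definition residue_dim :: "'F::field set \<Rightarrow> 'F set \<Rightarrow> nat" where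
  "residue_dim S V =
     ring.dim (residue_field V) (residue_class V ` S) (carrier (residue_field V))"

definition place_degree :: "('k \<Rightarrow> 'F::field) \<Rightarrow> 'F set \<Rightarrow> nat" where
  "place_degree c V = residue_dim (range c) V"

text \<open>The normalized valuation of \<open>z \<noteq> 0\<close>: \<open>t\<close> is a uniformizer and \<open>u\<close> a unit of \<open>V\<close>.\<close>

definition valuation :: "'F::field set \<Rightarrow> 'F \<Rightarrow> int" where
  "valuation V z = (THE n. \<exists>t u. max_ideal V = (*) t ` V \<and>
     u \<noteq> 0 \<and> u \<in> V \<and> inverse u \<in> V \<and> z = t powi n * u)"

definition Div :: "('k \<Rightarrow> 'F::field) \<Rightarrow> ('F set \<Rightarrow>\<^sub>0 int) monoid" where
  "Div c = free_Abelian_group (places c)"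

definition principal_divisor :: "('k \<Rightarrow> 'F::field) \<Rightarrow> 'F \<Rightarrow> ('F set \<Rightarrow>\<^sub>0 int)" where
  "principal_divisor c z =
     Abs_poly_mapping (\<lambda>V. if V \<in> places c then valuation V z else 0)"

definition principal_divisors :: "('k \<Rightarrow> 'F::field) \<Rightarrow> ('F set \<Rightarrow>\<^sub>0 int) set" where
  "principal_divisors c = principal_divisor c ` {z. z \<noteq> 0}"

definition Pic :: "('k \<Rightarrow> 'F::field) \<Rightarrow> ('F set \<Rightarrow>\<^sub>0 int) set monoid" where
  "Pic c = Div c Mod principal_divisors c"

definition divisor_class ::
  "('k \<Rightarrow> 'F::field) \<Rightarrow> ('F set \<Rightarrow>\<^sub>0 int) \<Rightarrow> ('F set \<Rightarrow>\<^sub>0 int) set" where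
  "divisor_class c D = principal_divisors c #>\<^bsub>Div c\<^esub> D"

definition two_Pic :: "('k \<Rightarrow> 'F::field) \<Rightarrow> ('F set \<Rightarrow>\<^sub>0 int) set set" where
  "two_Pic c = {C [^]\<^bsub>Pic c\<^esub> (2::nat) |C. C \<in> carrier (Pic c)}"


section \<open>The rational function field\<close>

text \<open>The rational function field \<open>L = k(x)\<close> is the type \<open>'k poly fract\<close>.\<close>

definition const_L :: "'k::field \<Rightarrow> 'k poly fract" where
  "const_L a = Fract [:a:] 1"

text \<open>The function attached to a point of the projective line, given as a place \<open>Q\<close> of \<open>L\<close>.
  The point at infinity is the only one at which \<open>x\<close> is not regular.\<close>

definition point_function :: "'k::field poly fract set \<Rightarrow> 'k poly fract" where
  "point_function Q =
     (if Fract [:0, 1:] 1 \<in> Q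
      then Fract (THE p. lead_coeff p = 1 \<and> comm_semiring_1_class.irreducible p \<and>
             (\<forall>Q' \<in> places const_L. Fract p 1 \<in> max_ideal Q' \<longleftrightarrow> Q' = Q)) 1
      else inverse (Fract [:0, 1:] 1))"

definition divisor_function :: "('k::field poly fract set \<Rightarrow>\<^sub>0 int) \<Rightarrow> 'k poly fract" where
  "divisor_function D = (\<Prod>Q\<in>Poly_Mapping.keys D. point_function Q powi Poly_Mapping.lookup D Q)"


section \<open>The function field of an affine plane curve\<close>

text \<open>
  The polynomial ring \<open>k[x,y]\<close> is \<open>'k poly poly\<close>, i.e. \<open>k[x][y]\<close>, so \<open>x\<close> is
  \<open>[:[:0, 1:]:]\<close> and \<open>y\<close> is \<open>[:0, 1:]\<close>.
\<close>

definition hyperelliptic_poly :: "'k::field poly \<Rightarrow> 'k poly poly" where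
  "hyperelliptic_poly f = [:0, 1:]\<^sup>2 - [:f:]"

text \<open>Jacobian criterion: \<open>F\<close> and its partial derivatives with respect to \<open>x\<close> and \<open>y\<close>
  generate the unit ideal of \<open>k[x,y]\<close>.\<close>

definition smooth_affine_curve :: "'k::field poly poly \<Rightarrow> bool" where
  "smooth_affine_curve F \<longleftrightarrow>
     (\<exists>A B C. A * F + B * map_poly pderiv F + C * pderiv F = 1)"

text \<open>The field \<open>'K\<close> is the quotient field of \<open>k[x,y]/(F)\<close>, where \<open>\<phi>\<close> is the resulting ring
  homomorphism \<open>k[x,y] \<rightarrow> K\<close>.\<close>

definition is_function_field_of :: "('k::field poly poly \<Rightarrow> 'K::field) \<Rightarrow> 'k poly poly \<Rightarrow> bool" where
  "is_function_field_of \<phi> F \<longleftrightarrow>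
     \<phi> 1 = 1 \<and> (\<forall>p q. \<phi> (p + q) = \<phi> p + \<phi> q) \<and> (\<forall>p q. \<phi> (p * q) = \<phi> p * \<phi> q) \<and>
     (\<forall>p. \<phi> p = 0 \<longleftrightarrow> F dvd p) \<and>
     (\<forall>z. \<exists>p q. \<phi> q \<noteq> 0 \<and> z = \<phi> p / \<phi> q)"

definition const_K :: "('k::field poly poly \<Rightarrow> 'K::field) \<Rightarrow> 'k \<Rightarrow> 'K" where
  "const_K \<phi> a = \<phi> [:[:a:]:]"


section \<open>The quadratic extension of the rational function field\<close>

definition embed_L :: "('k::field poly poly \<Rightarrow> 'K::field) \<Rightarrow> 'k poly fract \<Rightarrow> 'K" where
  "embed_L \<phi> a = (THE z. \<exists>p q. q \<noteq> 0 \<and> a = Fract p q \<and> z = \<phi> [:p:] / \<phi> [:q:])"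

text \<open>The covering of the projective line sends a place of \<open>K\<close> to its restriction to \<open>L\<close>.\<close>

definition covering :: "('k::field poly poly \<Rightarrow> 'K::field) \<Rightarrow> 'K set \<Rightarrow> 'k poly fract set" where
  "covering \<phi> V = embed_L \<phi> -` V"

definition inertia_degree :: "('k::field poly poly \<Rightarrow> 'K::field) \<Rightarrow> 'K set \<Rightarrow> nat" where
  "inertia_degree \<phi> V = residue_dim (embed_L \<phi> ` covering \<phi> V) V"

definition divisor_norm ::
  "('k::field poly poly \<Rightarrow> 'K::field) \<Rightarrow> ('K set \<Rightarrow>\<^sub>0 int) \<Rightarrow> ('k poly fract set \<Rightarrow>\<^sub>0 int)" where
  "divisor_norm \<phi> =
     frag_extend (\<lambda>V. frag_cmul (int (inertia_degree \<phi> V)) (frag_of (covering \<phi> V)))"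

definition n_divisor ::
  "('k::field poly poly \<Rightarrow> 'K::field) \<Rightarrow> ('K set \<Rightarrow>\<^sub>0 int) \<Rightarrow> 'k poly fract" where
  "n_divisor \<phi> D = divisor_function (divisor_norm \<phi> D)"

text \<open>The field norm: the determinant of multiplication by \<open>z\<close>, with respect to the
  basis \<open>1, y\<close> of \<open>K\<close> over \<open>L\<close>.\<close>

definition n_field :: "('k::field poly poly \<Rightarrow> 'K::field) \<Rightarrow> 'K \<Rightarrow> 'k poly fract" where
  "n_field \<phi> z = (THE d. \<exists>a b a' b'.
     z = embed_L \<phi> a + embed_L \<phi> b * \<phi> [:0, 1:] \<and>
     z * \<phi> [:0, 1:] = embed_L \<phi> a' + embed_L \<phi> b' * \<phi> [:0, 1:] \<and>
     d = a * b' - b * a')"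

end

theory Submission
  imports Defs
begin

text \<open>
  Write \<open>K = L(y)\<close> with \<open>L = k(x)\<close> and \<open>y\<^sup>2 = f\<close>.  A monic irreducible \<open>p\<close> is ramified in \<open>K\<close> if it divides
  \<open>f\<close> (exactly once, by smoothness), inert if \<open>f\<close> is not a square modulo \<open>p\<close>, and split otherwise;
  in all cases the valuation of a norm at \<open>p\<close> is the sum over the places \<open>V\<close> above \<open>p\<close> of the
  inertia degree times the valuation at \<open>V\<close>.  The point at infinity is ramified because \<open>deg f\<close>
  is odd.  A point \<open>P\<close> is 2-divisible iff some \<open>z\<close> has odd valuation at \<open>P\<close> and even valuation
  at all other places.

  For such a \<open>z\<close>, all finite valuations of \<open>n(P) n(z)\<close> are even, so \<open>n(P) n(z) = c h\<^sup>2\<close> with \<open>c\<close> constant.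
  As \<open>n(P)\<close> is monic of even degree, \<open>n(z) = a\<^sup>2 - b\<^sup>2 f\<close> has even degree and hence a square leading
  coefficient, so \<open>c\<close> is a square and \<open>n(P)\<close> is a norm.  Conversely, if \<open>n(P) = n(l)\<close>, then \<open>l\<close> has
  the desired parities except possibly at both places above some split primes; multiplying \<open>l\<close> by
  these primes corrects them, and the parity at infinity is that of \<open>deg n(P)\<close>.
\<close>

section \<open>Valuation rings\<close>

text \<open>A place is given only as a valuation ring, discreteness is not part of the definition,
  and nothing is known in advance about the places of \<open>K\<close> above a place of
  \<open>L\<close>. The obstacle is therefore to list all of them. It is overcome without integral
  closures or completions: above each monic irreducible p, and above infinity, explicit subrings of
  \<open>K\<close> are written down, proved to be discrete valuation rings by factoring every
  element into a power of a uniformizer and a unit, and then found inside any place above p. A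
  discrete valuation ring is contained in no other valuation ring except the whole field, which is
  not a place, so inclusion is equality. The explicit rings also give the valuations and residue
  fields.

  Evenness of deg P enters through the degree of n(P): an inert prime contributes p^2, and otherwise
  P has the same degree as p. It also keeps P away from infinity, a point of degree 1. The leading
  coefficient of a^2 - b^2 f is a square because for odd deg f the two terms have degrees of
  different parity, so an even degree is the degree of a^2.\<close>

definition valuation_ring :: "'F::field set \<Rightarrow> bool" where
  "valuation_ring V \<longleftrightarrow> V \<noteq> UNIV \<and> (\<forall>a\<in>V. \<forall>b\<in>V. a - b \<in> V \<and> a * b \<in> V) \<and>
     (\<forall>z. z \<in> V \<or> inverse z \<in> V)"

lemma places_iff: "V \<in> places c \<longleftrightarrow> range c \<subseteq> V \<and> valuation_ring V"
  by (auto simp: places_def valuation_ring_def)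

context
  fixes V :: "'F::field set"
  assumes V: "valuation_ring V"
begin

lemma valuation_ring_diff: "a \<in> V \<Longrightarrow> b \<in> V \<Longrightarrow> a - b \<in> V"
  and valuation_ring_mult: "a \<in> V \<Longrightarrow> b \<in> V \<Longrightarrow> a * b \<in> V"
  and valuation_ring_total: "z \<in> V \<or> inverse z \<in> V"
  using V by (auto simp: valuation_ring_def)

lemma valuation_ring_one: "1 \<in> V"
  using valuation_ring_total[of 1] by simp

lemma valuation_ring_zero: "0 \<in> V"
  using valuation_ring_total[of 0] by simp

lemma valuation_ring_uminus: "a \<in> V \<Longrightarrow> - a \<in> V"
  using valuation_ring_diff[OF valuation_ring_zero] by fastforce

lemma valuation_ring_add: "a \<in> V \<Longrightarrow> b \<in> V \<Longrightarrow> a + b \<in> V"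
  using valuation_ring_diff[of a "- b"] valuation_ring_uminus by fastforce

lemma valuation_ring_power: "a \<in> V \<Longrightarrow> a ^ n \<in> V"
  by (induction n) (auto intro: valuation_ring_one valuation_ring_mult)

text \<open>The case of integral closedness that is needed: y is a root of T^2 - F, so it lies in
  every valuation ring containing F.\<close>

lemma valuation_ring_square: "a ^ 2 \<in> V \<Longrightarrow> a \<in> V"
proof (rule ccontr)
  assume a: "a ^ 2 \<in> V" "a \<notin> V"
  then have "inverse a \<in> V" using valuation_ring_total by blast
  then have "a ^ 2 * inverse a \<in> V" using a valuation_ring_mult by blast
  moreover have "a ^ 2 * inverse a = a" by (cases "a = 0") (auto simp: power2_eq_square)
  ultimately show False using a by simp
qed

lemma max_ideal_mem: "a \<in> max_ideal V \<Longrightarrow> a \<in> V"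
  by (simp add: max_ideal_def)

lemma max_ideal_zero: "0 \<in> max_ideal V"
  using valuation_ring_zero by (simp add: max_ideal_def)

lemma max_ideal_one: "1 \<notin> max_ideal V"
  using valuation_ring_one by (simp add: max_ideal_def)

lemma not_max_ideal_inverse: "a \<in> V \<Longrightarrow> a \<notin> max_ideal V \<Longrightarrow> inverse a \<in> V \<and> a \<noteq> 0"
  by (simp add: max_ideal_def)

lemma not_mem_inverse: "a \<notin> V \<Longrightarrow> inverse a \<in> max_ideal V"
  using valuation_ring_total[of a] by (simp add: max_ideal_def)

lemma max_ideal_mult: "a \<in> V \<Longrightarrow> b \<in> max_ideal V \<Longrightarrow> a * b \<in> max_ideal V"
proof -
  assume a: "a \<in> V" and b: "b \<in> max_ideal V"
  show ?thesis
  proof (cases "a = 0 \<or> b = 0")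
    case False
    have "inverse (a * b) \<notin> V"
    proof
      assume "inverse (a * b) \<in> V"
      then have "inverse (a * b) * a \<in> V" using a valuation_ring_mult by blast
      moreover have "inverse (a * b) * a = inverse b" using False by (simp add: field_simps)
      ultimately have "inverse b \<in> V" by metis
      then show False using b False by (simp add: max_ideal_def)
    qed
    then show ?thesis using a b valuation_ring_mult by (auto simp: max_ideal_def)
  qed (auto intro: max_ideal_zero)
qed

lemma max_ideal_mult2: "a \<in> max_ideal V \<Longrightarrow> b \<in> V \<Longrightarrow> a * b \<in> max_ideal V"
  using max_ideal_mult[of b a] by (simp add: mult.commute)

text \<open>Of two nonzero elements one divides the other in \<open>V\<close>, so the sum is an
  element of \<open>V\<close> times one of them.\<close>

lemma max_ideal_add: "a \<in> max_ideal V \<Longrightarrow> b \<in> max_ideal V \<Longrightarrow> a + b \<in> max_ideal V"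
proof -
  have *: "a + b \<in> max_ideal V"
    if "a \<in> max_ideal V" "b \<in> max_ideal V" "a / b \<in> V" "b \<noteq> 0" for a b
  proof -
    have "(a / b + 1) * b \<in> max_ideal V"
      using that valuation_ring_add valuation_ring_one by (blast intro: max_ideal_mult)
    moreover have "(a / b + 1) * b = a + b" using that by (simp add: field_simps)
    ultimately show ?thesis by simp
  qed
  assume a: "a \<in> max_ideal V" and b: "b \<in> max_ideal V"
  consider "a = 0" | "b = 0" | "a \<noteq> 0" "b \<noteq> 0" "a / b \<in> V" | "a \<noteq> 0" "b \<noteq> 0" "b / a \<in> V"
    using valuation_ring_total[of "a / b"] by force
  then show ?thesis
    by cases (use a b *[of a b] *[of b a] in \<open>auto simp: add.commute\<close>)
qed

lemma max_ideal_uminus: "a \<in> max_ideal V \<Longrightarrow> - a \<in> max_ideal V"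
  using max_ideal_mult[of "-1" a] valuation_ring_uminus[OF valuation_ring_one] by simp

lemma max_ideal_diff: "a \<in> max_ideal V \<Longrightarrow> b \<in> max_ideal V \<Longrightarrow> a - b \<in> max_ideal V"
  using max_ideal_add[of a "- b"] max_ideal_uminus by fastforce

lemma max_ideal_prime:
  "a \<in> V \<Longrightarrow> b \<in> V \<Longrightarrow> a * b \<in> max_ideal V \<Longrightarrow> a \<in> max_ideal V \<or> b \<in> max_ideal V"
proof (rule ccontr)
  assume a: "a \<in> V" and b: "b \<in> V" and "a * b \<in> max_ideal V"
    and n: "\<not> (a \<in> max_ideal V \<or> b \<in> max_ideal V)"
  then have "inverse a * inverse b * (a * b) \<in> max_ideal V"
    using valuation_ring_mult by (intro max_ideal_mult) (auto simp: max_ideal_def)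
  moreover have "inverse a * inverse b * (a * b) = 1"
    using n a b by (auto simp: max_ideal_def field_simps)
  ultimately show False using max_ideal_one by simp
qed

lemma max_ideal_power: "a \<in> V \<Longrightarrow> a ^ n \<in> max_ideal V \<Longrightarrow> a \<in> max_ideal V"
  by (induction n) (use max_ideal_prime max_ideal_one valuation_ring_power in auto)

end

section \<open>Discrete valuation rings with a given uniformizer\<close>

definition dvr :: "'F::field set \<Rightarrow> 'F \<Rightarrow> bool" where
  "dvr V t \<longleftrightarrow> (\<forall>a\<in>V. \<forall>b\<in>V. a - b \<in> V \<and> a * b \<in> V) \<and> t \<in> V \<and> inverse t \<notin> V \<and>
     (\<forall>z. z \<noteq> 0 \<longrightarrow> (\<exists>n u. u \<noteq> 0 \<and> u \<in> V \<and> inverse u \<in> V \<and> z = t powi n * u))"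

context
  fixes V :: "'F::field set" and t
  assumes V: "dvr V t"
begin

lemma dvr_decompose:
  assumes "z \<noteq> 0" obtains n u where "u \<noteq> 0" "u \<in> V" "inverse u \<in> V" "z = t powi n * u"
  using V assms unfolding dvr_def by blast

lemma dvr_diff: "a \<in> V \<Longrightarrow> b \<in> V \<Longrightarrow> a - b \<in> V"
  and dvr_mult: "a \<in> V \<Longrightarrow> b \<in> V \<Longrightarrow> a * b \<in> V"
  and dvr_uniformizer: "t \<in> V" "inverse t \<notin> V"
  using V by (auto simp: dvr_def)

lemma dvr_zero_one: "0 \<in> V" "1 \<in> V"
proof -
  obtain u where u: "u \<noteq> 0" "u \<in> V" "inverse u \<in> V"
    by (rule dvr_decompose[of 1]) auto
  then show "1 \<in> V" using dvr_mult[of u "inverse u"] by simp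
  show "0 \<in> V" using dvr_diff[of u u] u by simp
qed

lemma dvr_uniformizer_nonzero: "t \<noteq> 0"
  using dvr_uniformizer dvr_zero_one by auto

lemma dvr_power: "a \<in> V \<Longrightarrow> a ^ n \<in> V"
  by (induction n) (auto intro: dvr_zero_one dvr_mult)

lemma dvr_powi: "n \<ge> 0 \<Longrightarrow> t powi n \<in> V"
  by (auto simp: power_int_def dvr_power dvr_uniformizer)

lemma dvr_powi_mem_iff: "t powi n \<in> V \<longleftrightarrow> n \<ge> 0"
proof (intro iffI dvr_powi)
  assume *: "t powi n \<in> V"
  show "n \<ge> 0"
  proof (rule ccontr)
    assume n: "\<not> n \<ge> 0"
    have "t powi n * t powi (- n - 1) \<in> V"
      using n by (intro dvr_mult * dvr_powi) simp
    moreover have "t powi n * t powi (- n - 1) = inverse t"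
      by (metis add.commute add_diff_cancel dvr_uniformizer_nonzero uminus_add_conv_diff power_int_add power_int_minus power_int_1_right diff_minus_eq_add minus_diff_commute)
    ultimately show False using dvr_uniformizer by simp
  qed
qed

lemma dvr_mem_iff:
  assumes "u \<noteq> 0" "u \<in> V" "inverse u \<in> V"
  shows "t powi n * u \<in> V \<longleftrightarrow> n \<ge> 0"
proof
  assume "t powi n * u \<in> V"
  then have "t powi n * u * inverse u \<in> V" using assms dvr_mult by blast
  then show "n \<ge> 0" using assms by (simp add: dvr_powi_mem_iff mult.assoc)
qed (use assms dvr_mult dvr_powi in blast)

text \<open>Totality is not part of \<open>dvr\<close>; it follows from the factorization, because
  t^n u or its inverse has a nonnegative exponent. Recognizing a concrete ring thus needs only
  closure and factorization.\<close>

lemma dvr_valuation_ring: "valuation_ring V"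
  unfolding valuation_ring_def
proof (intro conjI allI ballI)
  show "V \<noteq> UNIV" using dvr_uniformizer by auto
  fix z
  show "z \<in> V \<or> inverse z \<in> V"
  proof (cases "z = 0")
    case False
    then obtain n u where u: "u \<noteq> 0" "u \<in> V" "inverse u \<in> V" "z = t powi n * u"
      by (rule dvr_decompose)
    then have "inverse z = t powi (- n) * inverse u" by (simp add: power_int_minus)
    then show ?thesis using dvr_mem_iff[of u n] dvr_mem_iff[of "inverse u" "- n"] u by auto
  qed (simp add: dvr_zero_one)
qed (auto intro: dvr_diff dvr_mult)

lemma dvr_max_ideal: "max_ideal V = (*) t ` V"
proof (intro equalityI subsetI)
  note * = dvr_valuation_ring
  fix z assume z: "z \<in> (*) t ` V"
  have "t \<in> max_ideal V" using dvr_uniformizer by (simp add: max_ideal_def)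
  then show "z \<in> max_ideal V" using z max_ideal_mult2[OF *] by auto
next
  fix z assume z: "z \<in> max_ideal V"
  show "z \<in> (*) t ` V"
  proof (cases "z = 0")
    case False
    then obtain n u where u: "u \<noteq> 0" "u \<in> V" "inverse u \<in> V" "z = t powi n * u"
      by (rule dvr_decompose)
    have "inverse z = t powi (- n) * inverse u" using u by (simp add: power_int_minus)
    then have "n > 0" using dvr_mem_iff[of "inverse u" "- n"] u z False by (auto simp: max_ideal_def)
    then have "t powi (n - 1) * u \<in> V" using u by (auto simp: dvr_mem_iff)
    moreover have "z = t * (t powi (n - 1) * u)"
      by (subst u(4)) (simp add: power_int_diff dvr_uniformizer_nonzero)
    ultimately show ?thesis by blast
  qed (use dvr_zero_one in \<open>auto simp: image_iff\<close>)
qed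

text \<open>\<open>valuation\<close> quantifies over all uniformizers, so uniqueness has to compare
  two of them. Two generators t and s of the maximal ideal differ by a unit r, hence t^(n - m) and
  its inverse both lie in \<open>V\<close>, which forces n = m.\<close>

lemma dvr_valuation:
  assumes "u \<noteq> 0" "u \<in> V" "inverse u \<in> V"
  shows "valuation V (t powi n * u) = n"
  unfolding valuation_def
proof (rule the_equality)
  show "\<exists>t' u'. max_ideal V = (*) t' ` V \<and> u' \<noteq> 0 \<and> u' \<in> V \<and> inverse u' \<in> V \<and>
          t powi n * u = t' powi n * u'"
    using assms dvr_max_ideal by blast
next
  fix m assume "\<exists>s w. max_ideal V = (*) s ` V \<and> w \<noteq> 0 \<and> w \<in> V \<and> inverse w \<in> V \<and>
          t powi n * u = s powi m * w"
  then obtain s w where s: "max_ideal V = (*) s ` V" and w: "w \<noteq> 0" "w \<in> V" "inverse w \<in> V"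
    and e: "t powi n * u = s powi m * w" by blast
  have "s \<in> (*) t ` V" "t \<in> (*) s ` V"
    using s dvr_max_ideal dvr_zero_one by (metis image_eqI mult.right_neutral)+
  then obtain r r' where r: "s = t * r" "r \<in> V" "t = s * r'" "r' \<in> V" by blast
  have "t = t * r * r'" using r(3) unfolding r(1) .
  also have "\<dots> = t * (r * r')" by (rule mult.assoc)
  finally have "t = t * (r * r')" .
  then have r': "r * r' = 1" using dvr_uniformizer_nonzero by (metis mult_cancel_left1)
  then have r0: "r \<noteq> 0" by auto
  have "inverse r \<in> V" using r(4) inverse_unique[OF r'] by simp
  have rm: "r powi m \<in> V" for m
    unfolding power_int_def using dvr_power[OF \<open>inverse r \<in> V\<close>] dvr_power[OF r(2)] by presburger
  have "t powi (n - m) * u = r powi m * w"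
    using e dvr_uniformizer_nonzero unfolding r(1) power_int_mult_distrib
    by (simp add: power_int_diff field_simps)
  then have eq1: "t powi (n - m) = r powi m * w * inverse u"
    using assms by (simp add: field_simps)
  have "t powi (m - n) = inverse (t powi (n - m))"
    by (metis minus_diff_eq power_int_minus)
  also have "\<dots> = r powi (- m) * inverse w * u"
    unfolding eq1 by (simp add: power_int_minus)
  finally have eq2: "t powi (m - n) = r powi (- m) * inverse w * u" .
  have "t powi (n - m) \<in> V" "t powi (m - n) \<in> V"
    unfolding eq1 eq2 by (intro dvr_mult rm assms w)+
  then show "m = n" by (simp add: dvr_powi_mem_iff)
qed

lemma valuation_eqE:
  assumes "z \<noteq> 0"
  obtains u where "u \<noteq> 0" "u \<in> V" "inverse u \<in> V" "z = t powi valuation V z * u"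
  using dvr_decompose[OF assms] dvr_valuation by metis

lemma mem_iff_valuation: "z \<noteq> 0 \<Longrightarrow> z \<in> V \<longleftrightarrow> valuation V z \<ge> 0"
  by (metis valuation_eqE dvr_mem_iff)

lemma valuation_mult:
  assumes "a \<noteq> 0" "b \<noteq> 0" shows "valuation V (a * b) = valuation V a + valuation V b"
proof -
  obtain u w where u: "u \<noteq> 0" "u \<in> V" "inverse u \<in> V" "a = t powi valuation V a * u"
    and w: "w \<noteq> 0" "w \<in> V" "inverse w \<in> V" "b = t powi valuation V b * w"
    using valuation_eqE assms by metis
  have "a * b = t powi (valuation V a + valuation V b) * (u * w)"
    by (subst u(4), subst w(4)) (use dvr_uniformizer_nonzero in \<open>simp add: power_int_add\<close>)
  then show ?thesis using dvr_valuation[of "u * w"] u w by (simp add: dvr_mult)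
qed

lemma valuation_one: "valuation V 1 = 0"
  using dvr_valuation[of 1 0] dvr_zero_one by simp

lemma valuation_inverse: "a \<noteq> 0 \<Longrightarrow> valuation V (inverse a) = - valuation V a"
  using valuation_mult[of a "inverse a"] valuation_one by simp

lemma valuation_divide: "a \<noteq> 0 \<Longrightarrow> b \<noteq> 0 \<Longrightarrow> valuation V (a / b) = valuation V a - valuation V b"
  using valuation_mult[of a "inverse b"] valuation_inverse[of b] by (simp add: divide_inverse)

lemma valuation_power: "a \<noteq> 0 \<Longrightarrow> valuation V (a ^ n) = int n * valuation V a"
  by (induction n) (auto simp: valuation_one valuation_mult algebra_simps)

lemma valuation_powi: "a \<noteq> 0 \<Longrightarrow> valuation V (a powi n) = n * valuation V a"
  by (auto simp: power_int_def valuation_power valuation_inverse)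

lemma valuation_prod:
  "finite A \<Longrightarrow> (\<And>a. a \<in> A \<Longrightarrow> g a \<noteq> 0) \<Longrightarrow> valuation V (prod g A) = (\<Sum>a\<in>A. valuation V (g a))"
  by (induction A rule: finite_induct) (simp_all add: valuation_one valuation_mult)

lemma valuation_uniformizer: "valuation V t = 1"
  using dvr_valuation[of 1 1] dvr_zero_one by simp

lemma valuation_uminus: "valuation V (- a) = valuation V a"
proof (cases "a = 0")
  case False
  have "valuation V (- a * - a) = valuation V (a * a)" by simp
  then have "2 * valuation V (- a) = 2 * valuation V a"
    using valuation_mult[of "-a" "-a"] valuation_mult[of a a] False by simp
  then show ?thesis by simp
qed simp

lemma max_ideal_iff_valuation: "z \<noteq> 0 \<Longrightarrow> z \<in> max_ideal V \<longleftrightarrow> valuation V z > 0"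
  using mem_iff_valuation[of z] mem_iff_valuation[of "inverse z"]
  by (auto simp: max_ideal_def valuation_inverse)

lemma unit_iff_valuation:
  "z \<noteq> 0 \<Longrightarrow> valuation V z = 0 \<longleftrightarrow> z \<in> V \<and> inverse z \<in> V"
  using mem_iff_valuation[of z] mem_iff_valuation[of "inverse z"]
  by (auto simp: valuation_inverse)

lemma valuation_add_ge:
  assumes "a \<noteq> 0" "b \<noteq> 0" "a + b \<noteq> 0"
  shows "valuation V (a + b) \<ge> min (valuation V a) (valuation V b)"
proof -
  have *: "valuation V (a + b) \<ge> valuation V a"
    if "a \<noteq> 0" "b \<noteq> 0" "a + b \<noteq> 0" "valuation V a \<le> valuation V b" for a b
  proof -
    have "b / a \<in> V" using that by (subst mem_iff_valuation) (auto simp: valuation_divide)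
    then have "1 + b / a \<in> V" using valuation_ring_add[OF dvr_valuation_ring] dvr_zero_one by blast
    moreover have "1 + b / a = (a + b) / a" using that by (simp add: field_simps)
    ultimately show ?thesis using that mem_iff_valuation[of "(a + b) / a"]
      by (simp add: valuation_divide)
  qed
  show ?thesis
    using *[of a b] *[of b a] assms by (cases "valuation V a \<le> valuation V b") (auto simp: add.commute)
qed

text \<open>If a + b had larger valuation than a, then a = (a + b) - b would be a sum of two terms
  of larger valuation.\<close>

lemma valuation_add_eq:
  assumes "a \<noteq> 0" "b \<noteq> 0" "valuation V a < valuation V b"
  shows "a + b \<noteq> 0" "valuation V (a + b) = valuation V a"
proof -
  show n: "a + b \<noteq> 0"
    using assms valuation_uminus[of b] by (metis eq_neg_iff_add_eq_0 less_irrefl)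
  have "valuation V (a + b) \<ge> valuation V a" using valuation_add_ge[of a b] assms n by simp
  moreover have "valuation V (a + b + - b) \<ge> min (valuation V (a + b)) (valuation V b)"
    using valuation_add_ge[of "a + b" "- b"] assms n valuation_uminus[of b] by simp
  ultimately show "valuation V (a + b) = valuation V a" using assms by simp
qed

text \<open>An element outside \<open>V\<close> has negative valuation and produces the inverse of
  t, hence all powers of t and the whole field. This is how an abstract place is identified with an
  explicit ring: one inclusion suffices.\<close>

lemma dvr_maximal:
  assumes W: "valuation_ring W" and "V \<subseteq> W"
  shows "W = V"
proof (rule ccontr)
  assume "W \<noteq> V"
  then obtain z where z: "z \<in> W" "z \<notin> V" using assms by blast
  then have z0: "z \<noteq> 0" using dvr_zero_one by auto
  \<comment> \<open>Since z has negative valuation, z t has valuation at most 0, so 1/(z t) lies in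
    \<open>V\<close>; multiplying by z leaves 1/t.\<close>
  have "inverse t \<in> W"
  proof -
    have "valuation V (inverse (z * t)) \<ge> 0"
      using z z0 mem_iff_valuation dvr_uniformizer_nonzero valuation_uniformizer
      by (subst valuation_inverse) (auto simp: valuation_mult)
    then have "inverse (z * t) \<in> V" using z0 dvr_uniformizer_nonzero by (subst mem_iff_valuation) auto
    then have "z * inverse (z * t) \<in> W" using z assms valuation_ring_mult[OF W] by blast
    then show ?thesis using z0 by (simp add: field_simps)
  qed
  then have "(inverse t) ^ n \<in> W" for n
    by (rule valuation_ring_power[OF W])
  moreover have "t ^ n \<in> W" for n
    using dvr_power dvr_uniformizer assms by blast
  ultimately have *: "t powi n \<in> W" for n by (auto simp: power_int_def)
  have "z \<in> W" for z
  proof (cases "z = 0")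
    case False
    then show ?thesis using valuation_eqE[of z] * assms valuation_ring_mult[OF W] by (metis subsetD)
  qed (use assms dvr_zero_one in auto)
  then show False using W by (auto simp: valuation_ring_def)
qed

end

section \<open>Degrees of residue field extensions\<close>

context
  fixes V :: "'F::field set"
  assumes V: "valuation_ring V"
begin

lemma cring_ring_of: "cring (ring_of V)"
proof (rule cringI)
  show "abelian_group (ring_of V)"
  proof (rule abelian_groupI)
    fix a assume "a \<in> carrier (ring_of V)"
    then show "\<exists>b\<in>carrier (ring_of V). b \<oplus>\<^bsub>ring_of V\<^esub> a = \<zero>\<^bsub>ring_of V\<^esub>"
      using valuation_ring_uminus[OF V] by (intro bexI[of _ "- a"]) (auto simp: ring_of_def)
  qed (use valuation_ring_add[OF V] valuation_ring_zero[OF V] in \<open>auto simp: ring_of_def\<close>)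
  show "Group.comm_monoid (ring_of V)"
    by unfold_locales
      (use valuation_ring_mult[OF V] valuation_ring_one[OF V] in \<open>auto simp: ring_of_def\<close>)
qed (auto simp: ring_of_def algebra_simps)

lemma a_inv_ring_of: "a \<in> V \<Longrightarrow> \<ominus>\<^bsub>ring_of V\<^esub> a = - a"
proof -
  interpret cring "ring_of V" by (rule cring_ring_of)
  assume "a \<in> V"
  then show ?thesis using valuation_ring_uminus[OF V]
    by (intro minus_equality) (auto simp: ring_of_def)
qed

lemma ideal_max_ideal: "ideal (max_ideal V) (ring_of V)"
proof -
  interpret cring "ring_of V" by (rule cring_ring_of)
  show ?thesis
  proof (rule idealI)
    show "subgroup (max_ideal V) (add_monoid (ring_of V))"
    proof (rule add.subgroupI)
      fix a assume "a \<in> max_ideal V"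
      then show "\<ominus>\<^bsub>ring_of V\<^esub> a \<in> max_ideal V"
        using a_inv_ring_of max_ideal_uminus[OF V] max_ideal_mem[OF V] by auto
    qed (use max_ideal_add[OF V] max_ideal_zero[OF V] max_ideal_mem[OF V] in \<open>auto simp: ring_of_def\<close>)
  qed (use max_ideal_mult[OF V] max_ideal_mult2[OF V] cring_ring_of ring_axioms in \<open>auto simp: ring_of_def\<close>)
qed

lemma residue_class_hom: "residue_class V \<in> ring_hom (ring_of V) (residue_field V)"
  using ideal.rcos_ring_hom[OF ideal_max_ideal]
  by (simp add: residue_field_def residue_class_def[abs_def])

lemma residue_class_eq_iff:
  "residue_class V a = residue_class V b \<longleftrightarrow> a - b \<in> max_ideal V"
proof -
  have *: "residue_class V a = {h + a |h. h \<in> max_ideal V}" for a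
    by (auto simp: residue_class_def a_r_coset_def r_coset_def ring_of_def)
  show ?thesis
  proof
    assume "residue_class V a = residue_class V b"
    moreover have "a \<in> residue_class V a"
      using max_ideal_zero[OF V] by (auto simp: * intro: exI[of _ 0])
    ultimately have "a \<in> residue_class V b" by simp
    then show "a - b \<in> max_ideal V" by (auto simp: *)
  next
    assume ab: "a - b \<in> max_ideal V"
    have "h + a = (h + (a - b)) + b" "h + b = (h - (a - b)) + a" for h by auto
    then show "residue_class V a = residue_class V b"
      using max_ideal_add[OF V _ ab] max_ideal_diff[OF V _ ab] unfolding * by blast
  qed
qed

lemma carrier_residue_field: "carrier (residue_field V) = residue_class V ` V"
  by (auto simp: residue_field_def FactRing_def A_RCOSETS_def' residue_class_def ring_of_def)

lemma ring_residue_field: "ring (residue_field V)"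
  unfolding residue_field_def by (rule ideal.quotient_is_ring[OF ideal_max_ideal])

lemma residue_class_simps:
  "a \<in> V \<Longrightarrow> b \<in> V \<Longrightarrow> residue_class V a \<otimes>\<^bsub>residue_field V\<^esub> residue_class V b = residue_class V (a * b)"
  "a \<in> V \<Longrightarrow> b \<in> V \<Longrightarrow> residue_class V a \<oplus>\<^bsub>residue_field V\<^esub> residue_class V b = residue_class V (a + b)"
  "\<one>\<^bsub>residue_field V\<^esub> = residue_class V 1"
  "\<zero>\<^bsub>residue_field V\<^esub> = residue_class V 0"
proof -
  interpret ring_hom_ring "ring_of V" "residue_field V" "residue_class V"
    using cring_ring_of cring.axioms(1) ring_residue_field residue_class_hom by (blast intro: ring_hom_ringI2)
  show "a \<in> V \<Longrightarrow> b \<in> V \<Longrightarrow> residue_class V a \<otimes>\<^bsub>residue_field V\<^esub> residue_class V b = residue_class V (a * b)"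
    "a \<in> V \<Longrightarrow> b \<in> V \<Longrightarrow> residue_class V a \<oplus>\<^bsub>residue_field V\<^esub> residue_class V b = residue_class V (a + b)"
    "\<one>\<^bsub>residue_field V\<^esub> = residue_class V 1" "\<zero>\<^bsub>residue_field V\<^esub> = residue_class V 0"
    using hom_mult hom_add hom_one hom_zero by (simp_all add: ring_of_def)
qed

text \<open>\<open>combine\<close> and \<open>map2\<close> both stop at the end of the shorter list,
  so no condition on the lengths is needed.\<close>

lemma combine_residue_class:
  "set ss \<subseteq> V \<Longrightarrow> set bs \<subseteq> V \<Longrightarrow> sum_list (map2 (*) ss bs) \<in> V \<and>
    ring.combine (residue_field V) (map (residue_class V) ss) (map (residue_class V) bs) =
      residue_class V (sum_list (map2 (*) ss bs))"
proof (induction ss arbitrary: bs)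
  case Nil
  then show ?case
    by (simp add: ring.combine.simps[OF ring_residue_field] residue_class_simps valuation_ring_zero[OF V])
next
  case (Cons s ss)
  show ?case
  proof (cases bs)
    case Nil
    then show ?thesis
      by (simp add: ring.combine.simps[OF ring_residue_field] residue_class_simps valuation_ring_zero[OF V])
  next
    case (Cons b bs')
    then show ?thesis using Cons.IH[of bs'] Cons.prems
      by (simp add: ring.combine.simps[OF ring_residue_field] residue_class_simps
          valuation_ring_mult[OF V] valuation_ring_add[OF V])
  qed
qed

text \<open>Only elements outside the maximal ideal have to be invertible in \<open>S\<close>. This
  covers both uses: the field of constants, and the image of a valuation ring of \<open>L\<close>,
  which is not a field.\<close>

lemma subfield_residue_class:
  assumes S: "S \<subseteq> V" "1 \<in> S" "\<And>a b. a \<in> S \<Longrightarrow> b \<in> S \<Longrightarrow> a - b \<in> S"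
    "\<And>a b. a \<in> S \<Longrightarrow> b \<in> S \<Longrightarrow> a * b \<in> S"
    "\<And>a. a \<in> S \<Longrightarrow> a \<notin> max_ideal V \<Longrightarrow> inverse a \<in> S"
  shows "subfield (residue_class V ` S) (residue_field V)"
proof -
  let ?R = "residue_field V" and ?\<pi> = "residue_class V"
  interpret ring ?R by (rule ring_residue_field)
  have S0: "0 \<in> S" using S(3)[of 1 1] S(2) by simp
  have Sm: "- a \<in> S" if "a \<in> S" for a using S(3)[OF S0 that] by simp
  have Sa: "a + b \<in> S" if "a \<in> S" "b \<in> S" for a b using S(3)[OF that(1) Sm[OF that(2)]] by simp
  have "subring (?\<pi> ` S) ?R"
  proof (rule subringI)
    fix h assume "h \<in> ?\<pi> ` S"
    then obtain a where a: "a \<in> S" "h = ?\<pi> a" by auto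
    have "\<ominus>\<^bsub>?R\<^esub> h = ?\<pi> (- a)"
    proof (rule minus_equality)
      show "?\<pi> (- a) \<oplus>\<^bsub>?R\<^esub> h = \<zero>\<^bsub>?R\<^esub>"
        using a Sm[OF a(1)] S(1) by (simp add: residue_class_simps subset_iff)
    qed (use a Sm S(1) in \<open>auto simp: carrier_residue_field\<close>)
    then show "\<ominus>\<^bsub>?R\<^esub> h \<in> ?\<pi> ` S" using a Sm by auto
  qed (use S(1) S(2) Sa S(4) in \<open>auto simp: residue_class_simps carrier_residue_field subset_iff\<close>)
  then have sub: "subcring (?\<pi> ` S) ?R"
    by (rule subcringI) (use S(1) in \<open>auto simp: residue_class_simps mult.commute subset_iff\<close>)
  have one: "\<one>\<^bsub>?R\<^esub> \<noteq> \<zero>\<^bsub>?R\<^esub>"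
    using max_ideal_one[OF V] by (simp add: residue_class_simps residue_class_eq_iff)
  show ?thesis
  proof (rule subfieldI[OF sub], intro equalityI subsetI)
    fix h assume h: "h \<in> Units (?R\<lparr>carrier := ?\<pi> ` S\<rparr>)"
    then obtain g where "g \<in> ?\<pi> ` S" "g \<otimes>\<^bsub>?R\<^esub> h = \<one>\<^bsub>?R\<^esub>" "h \<in> ?\<pi> ` S" by (auto simp: Units_def)
    then show "h \<in> ?\<pi> ` S - {\<zero>\<^bsub>?R\<^esub>}"
      using one S(1) by (auto simp: carrier_residue_field)
  next
    fix h assume "h \<in> ?\<pi> ` S - {\<zero>\<^bsub>?R\<^esub>}"
    then obtain a where a: "a \<in> S" "h = ?\<pi> a" "?\<pi> a \<noteq> ?\<pi> 0"
      by (auto simp: residue_class_simps)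
    then have "a \<notin> max_ideal V" by (simp add: residue_class_eq_iff)
    then have "inverse a \<in> S" "a \<noteq> 0" using S(5) max_ideal_zero[OF V] a(1) by auto
    with a S(1) show "h \<in> Units (?R\<lparr>carrier := ?\<pi> ` S\<rparr>)"
      unfolding Units_def by (force simp: residue_class_simps subset_iff)
  qed
qed

text \<open>A basis criterion stated upstairs in \<open>V\<close>, with congruences modulo the
  maximal ideal instead of cosets. The \<open>take\<close> in the independence condition discards
  coefficients beyond the end of \<open>bs\<close>, which do not enter the sum.\<close>

lemma residue_dim_eq_length:
  assumes S: "S \<subseteq> V" "1 \<in> S" "\<And>a b. a \<in> S \<Longrightarrow> b \<in> S \<Longrightarrow> a - b \<in> S"
    "\<And>a b. a \<in> S \<Longrightarrow> b \<in> S \<Longrightarrow> a * b \<in> S"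
    "\<And>a. a \<in> S \<Longrightarrow> a \<notin> max_ideal V \<Longrightarrow> inverse a \<in> S"
    and bs: "set bs \<subseteq> V"
    and span: "\<And>z. z \<in> V \<Longrightarrow> \<exists>ss. set ss \<subseteq> S \<and> z - sum_list (map2 (*) ss bs) \<in> max_ideal V"
    and indep: "\<And>ss. set ss \<subseteq> S \<Longrightarrow> sum_list (map2 (*) ss bs) \<in> max_ideal V \<Longrightarrow>
      set (take (length bs) ss) \<subseteq> max_ideal V"
  shows "residue_dim S V = length bs"
proof -
  let ?R = "residue_field V" and ?\<pi> = "residue_class V"
  let ?K = "?\<pi> ` S"
  interpret ring ?R by (rule ring_residue_field)
  have sf: "subfield ?K ?R" by (rule subfield_residue_class) (use S in auto)
  have car: "set (map ?\<pi> bs) \<subseteq> carrier ?R" using bs by (auto simp: carrier_residue_field)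
  have lift: "\<exists>ss. set ss \<subseteq> S \<and> Ks = map ?\<pi> ss" if "set Ks \<subseteq> ?K" for Ks
    using that
  proof (induction Ks)
    case (Cons k Ks)
    then obtain ss s where "set ss \<subseteq> S" "Ks = map ?\<pi> ss" "s \<in> S" "k = ?\<pi> s" by auto
    then show ?case by (intro exI[of _ "s # ss"]) auto
  qed simp
  have ind: "independent ?K (map ?\<pi> bs)"
  proof (rule trivial_combine_imp_independent[OF sf car])
    fix Ks assume Ks: "set Ks \<subseteq> ?K" "combine Ks (map ?\<pi> bs) = \<zero>\<^bsub>?R\<^esub>"
    then obtain ss where ss: "set ss \<subseteq> S" "Ks = map ?\<pi> ss" using lift by blast
    then have "set ss \<subseteq> V" using S(1) by blast
    then have "sum_list (map2 (*) ss bs) \<in> max_ideal V"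
      using Ks(2) combine_residue_class[OF _ bs, of ss]
      by (simp add: ss(2) residue_class_simps residue_class_eq_iff)
    then have "set (take (length bs) ss) \<subseteq> max_ideal V" using indep ss by blast
    then have "?\<pi> s = ?\<pi> 0" if "s \<in> set (take (length bs) ss)" for s
      using that by (auto simp: residue_class_eq_iff)
    then show "set (take (length (map ?\<pi> bs)) Ks) \<subseteq> {\<zero>\<^bsub>?R\<^esub>}"
      by (simp add: ss(2) take_map residue_class_simps image_subset_iff)
  qed
  have "Span ?K (map ?\<pi> bs) = carrier ?R"
  proof (intro equalityI)
    show "Span ?K (map ?\<pi> bs) \<subseteq> carrier ?R" using Span_in_carrier[OF _ car, of ?K] sf
      by (simp add: subfieldE(3))
    show "carrier ?R \<subseteq> Span ?K (map ?\<pi> bs)"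
    proof
      fix w assume "w \<in> carrier ?R"
      then obtain z where z: "z \<in> V" "w = ?\<pi> z" by (auto simp: carrier_residue_field)
      then obtain ss where ss: "set ss \<subseteq> S" "z - sum_list (map2 (*) ss bs) \<in> max_ideal V"
        using span by blast
      then have "w = combine (map ?\<pi> ss) (map ?\<pi> bs)"
        using combine_residue_class[OF _ bs, of ss] S(1) z by (auto simp: residue_class_eq_iff)
      then show "w \<in> Span ?K (map ?\<pi> bs)"
        unfolding Span_eq_combine_set[OF sf car] using ss(1)
        by (intro CollectI exI[of _ "map ?\<pi> ss"]) auto
    qed
  qed
  then have "dimension (length bs) ?K (carrier ?R)"
    using dimension_independent[OF ind] by simp
  from dimI[OF sf this] show ?thesis by (simp add: residue_dim_def over_def)
qed

lemma residue_dim_eq_1: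
  assumes S: "S \<subseteq> V" "1 \<in> S" "\<And>a b. a \<in> S \<Longrightarrow> b \<in> S \<Longrightarrow> a - b \<in> S"
    "\<And>a b. a \<in> S \<Longrightarrow> b \<in> S \<Longrightarrow> a * b \<in> S"
    "\<And>a. a \<in> S \<Longrightarrow> a \<notin> max_ideal V \<Longrightarrow> inverse a \<in> S"
    and span: "\<And>z. z \<in> V \<Longrightarrow> \<exists>s\<in>S. z - s \<in> max_ideal V"
  shows "residue_dim S V = 1"
proof -
  have "residue_dim S V = length [1 :: 'F]"
  proof (rule residue_dim_eq_length[OF S])
    show "set [1] \<subseteq> V" using valuation_ring_one[OF V] by simp
    fix z assume "z \<in> V"
    then obtain s where "s \<in> S" "z - s \<in> max_ideal V" using span by blast
    then show "\<exists>ss. set ss \<subseteq> S \<and> z - sum_list (map2 (*) ss [1]) \<in> max_ideal V"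
      by (intro exI[of _ "[s]"]) auto
  next
    fix ss assume "set ss \<subseteq> S" "sum_list (map2 (*) ss [1]) \<in> max_ideal V"
    then show "set (take (length [1 :: 'F]) ss) \<subseteq> max_ideal V" by (cases ss) auto
  qed auto
  then show ?thesis by simp
qed

lemma residue_dim_eq_2:
  assumes S: "S \<subseteq> V" "1 \<in> S" "\<And>a b. a \<in> S \<Longrightarrow> b \<in> S \<Longrightarrow> a - b \<in> S"
    "\<And>a b. a \<in> S \<Longrightarrow> b \<in> S \<Longrightarrow> a * b \<in> S"
    "\<And>a. a \<in> S \<Longrightarrow> a \<notin> max_ideal V \<Longrightarrow> inverse a \<in> S"
    and b: "b \<in> V"
    and span: "\<And>z. z \<in> V \<Longrightarrow> \<exists>s\<in>S. \<exists>s'\<in>S. z - (s + s' * b) \<in> max_ideal V"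
    and indep: "\<And>s s'. s \<in> S \<Longrightarrow> s' \<in> S \<Longrightarrow> s + s' * b \<in> max_ideal V \<Longrightarrow>
      s \<in> max_ideal V \<and> s' \<in> max_ideal V"
  shows "residue_dim S V = 2"
proof -
  have "residue_dim S V = length [1, b]"
  proof (rule residue_dim_eq_length[OF S])
    show "set [1, b] \<subseteq> V" using valuation_ring_one[OF V] b by simp
    fix z assume "z \<in> V"
    then obtain s s' where "s \<in> S" "s' \<in> S" "z - (s + s' * b) \<in> max_ideal V" using span by blast
    then show "\<exists>ss. set ss \<subseteq> S \<and> z - sum_list (map2 (*) ss [1, b]) \<in> max_ideal V"
      by (intro exI[of _ "[s, s']"]) auto
  next
    have S0: "0 \<in> S" using S(3)[of 1 1] S(2) by simp
    fix ss assume ss: "set ss \<subseteq> S" "sum_list (map2 (*) ss [1, b]) \<in> max_ideal V"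
    consider "ss = []" | s where "ss = [s]" | s s' r where "ss = s # s' # r"
      by (cases ss) (auto, metis list.exhaust)
    then show "set (take (length [1, b]) ss) \<subseteq> max_ideal V"
    proof cases
      case (3 s s' r)
      then show ?thesis using indep[of s s'] ss by auto
    qed (use ss in auto)
  qed auto
  then show ?thesis by simp
qed

end

section \<open>Places of the rational function field\<close>

abbreviation monic_irreducible :: "'k::field poly \<Rightarrow> bool" where
  "monic_irreducible p \<equiv> lead_coeff p = 1 \<and> comm_semiring_1_class.irreducible p"

text \<open>Division with remainder by an element of least degree. The ideal is given by closure
  properties only, so that the lemma applies to the polynomials in a maximal ideal as well as to the
  ideal (p, b) in the Bezout identity.\<close>

lemma poly_ideal_principal:
  fixes I :: "'k::field poly set"
  assumes diff: "\<And>a b. a \<in> I \<Longrightarrow> b \<in> I \<Longrightarrow> a - b \<in> I" and mult: "\<And>a b. b \<in> I \<Longrightarrow> a * b \<in> I"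
    and "g \<in> I" "g \<noteq> 0"
  obtains p where "p \<in> I" "lead_coeff p = 1" "\<And>a. a \<in> I \<Longrightarrow> p dvd a"
proof -
  define d where "d = (LEAST d. \<exists>q\<in>I. q \<noteq> 0 \<and> degree q = d)"
  have "\<exists>q\<in>I. q \<noteq> 0 \<and> degree q = d"
    unfolding d_def by (rule LeastI_ex) (use assms in auto)
  then obtain q where q: "q \<in> I" "q \<noteq> 0" "degree q = d" by blast
  have min: "d \<le> degree r" if "r \<in> I" "r \<noteq> 0" for r
    unfolding d_def by (rule Least_le) (use that in auto)
  define p where "p = [:inverse (lead_coeff q):] * q"
  have p: "p \<in> I" unfolding p_def by (rule mult[OF q(1)])
  have "lead_coeff p = inverse (lead_coeff q) * lead_coeff q" unfolding p_def lead_coeff_mult by simp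
  then have lc: "lead_coeff p = 1" "degree p = d" using q(2,3) by (auto simp: p_def)
  have "p dvd a" if "a \<in> I" for a
  proof (rule ccontr)
    assume n: "\<not> p dvd a"
    have "a mod p = a - (a div p) * p" by (simp add: minus_div_mult_eq_mod)
    then have "a mod p \<in> I" using diff[OF that mult[OF p]] by simp
    moreover have "degree (a mod p) < d" using degree_mod_less_degree[of p a] n lc by fastforce
    moreover have "a mod p \<noteq> 0" using n by auto
    ultimately show False using min[of "a mod p"] by simp
  qed
  then show thesis using that[of p] p lc by blast
qed

lemma monic_irreducible_factor:
  fixes a :: "'k::field poly"
  assumes "degree a > 0"
  obtains p where "monic_irreducible p" "p dvd a"
  using assms
proof (induction "degree a" arbitrary: a thesis rule: less_induct)
  case less
  have a0: "a \<noteq> 0" using less.prems by auto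
  show ?case
  proof (cases "comm_semiring_1_class.irreducible a")
    case True
    let ?c = "inverse (lead_coeff a)"
    have c: "?c \<noteq> 0" using a0 by simp
    have "comm_semiring_1_class.irreducible ([:?c:] * a)"
      using True c by (subst irreducible_mult_unit_left) (auto simp: is_unit_const_poly_iff dvd_field_iff)
    moreover have "[:?c:] * a dvd a" using c by (simp add: smult_dvd)
    ultimately show ?thesis using less.prems(1)[of "[:?c:] * a"] a0 by simp
  next
    case False
    have "\<not> is_unit a" using less.prems(2) by (auto simp: is_unit_poly_iff)
    then obtain b c where bc: "a = b * c" "\<not> is_unit b" "\<not> is_unit c"
      using False a0 by (auto simp: comm_semiring_1_class.irreducible_def)
    then have nz: "b \<noteq> 0" "c \<noteq> 0" using a0 by auto
    then have "degree b > 0" "degree c > 0" using bc by (auto simp: is_unit_iff_degree)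
    moreover then have "degree b < degree a" using bc nz by (simp add: degree_mult_eq)
    ultimately obtain p where "monic_irreducible p" "p dvd b" using less.hyps by blast
    then show ?thesis using less.prems(1) bc by auto
  qed
qed

lemma monic_irreducible_dvd_eq:
  assumes "monic_irreducible p" "monic_irreducible q" "p dvd q"
  shows "p = q"
proof -
  obtain r where r: "q = p * r" using assms by blast
  have "\<not> is_unit p" using assms by (simp add: comm_semiring_1_class.irreducible_def)
  then have "is_unit r" using assms r by (auto simp: comm_semiring_1_class.irreducible_def)
  then obtain c where c: "r = [:c:]" by (auto simp: is_unit_poly_iff)
  then have "lead_coeff q = c * lead_coeff p" using r by (simp add: lead_coeff_mult)
  then have "c = 1" using assms by simp
  then show ?thesis using r c by simp
qed

text \<open>Serves to bound the support of a principal divisor.\<close>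

lemma finite_monic_irreducible_factors:
  assumes "(a :: 'k::field poly) \<noteq> 0"
  shows "finite {p. monic_irreducible p \<and> p dvd a}"
  using assms
proof (induction "degree a" arbitrary: a rule: less_induct)
  case less
  show ?case
  proof (cases "degree a = 0")
    case True
    then have "is_unit a" using less.prems is_unit_iff_degree by blast
    then have "{p. monic_irreducible p \<and> p dvd a} = {}"
      by (auto simp: comm_semiring_1_class.irreducible_def dest: dvd_unit_imp_unit)
    then show ?thesis by (metis finite.emptyI)
  next
    case False
    then obtain q where q: "monic_irreducible q" "q dvd a" using monic_irreducible_factor by blast
    then obtain b where b: "a = q * b" by blast
    have q0: "q \<noteq> 0" "b \<noteq> 0" using b less.prems by auto
    have "\<not> is_unit q" using q by (simp add: comm_semiring_1_class.irreducible_def)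
    then have "degree q > 0" using q0 is_unit_iff_degree by blast
    then have fin: "finite {p. monic_irreducible p \<and> p dvd b}"
      using less.hyps[of b] b q0 by (simp add: degree_mult_eq)
    have "{p. monic_irreducible p \<and> p dvd a} \<subseteq> insert q {p. monic_irreducible p \<and> p dvd b}"
    proof
      fix p assume "p \<in> {p. monic_irreducible p \<and> p dvd a}"
      then have p: "monic_irreducible p" "p dvd q * b" using b by auto
      then have "p dvd q \<or> p dvd b"
        using field_poly_irreducible_imp_prime prime_elem_dvd_mult_iff by blast
      then show "p \<in> insert q {p. monic_irreducible p \<and> p dvd b}"
        using p(1) q(1) monic_irreducible_dvd_eq by blast
    qed
    then show ?thesis using fin by (meson finite_insert finite_subset)
  qed
qed

lemma poly_decompose:
  assumes "\<not> is_unit p" "(a :: 'k::field poly) \<noteq> 0"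
  obtains n b where "a = p ^ n * b" "\<not> p dvd b"
  using assms(2)
proof (induction "degree a" arbitrary: a thesis rule: less_induct)
  case less
  show ?case
  proof (cases "p dvd a")
    case True
    then obtain b where b: "a = p * b" by blast
    then have nz: "p \<noteq> 0" "b \<noteq> 0" using less.prems(2) by auto
    then have "degree b < degree a"
      using assms(1) is_unit_iff_degree[of p] by (simp add: b degree_mult_eq)
    then obtain n c where "b = p ^ n * c" "\<not> p dvd c" using less.hyps[of b] nz by blast
    then show ?thesis using less.prems(1)[of "Suc n" c] b by (simp add: mult.assoc)
  qed (use less.prems(1)[of 0 a] in simp)
qed

section \<open>Fractions, the localizations of k[x] and the ring at infinity\<close>

lemma Fract_mult_1: "Fract (a * b) 1 = Fract a 1 * Fract b 1"
  and Fract_diff_1: "Fract (a - b) 1 = Fract a 1 - Fract b 1"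
  and Fract_add_1: "Fract (a + b) 1 = Fract a 1 + Fract b 1"
  and Fract_zero_iff: "Fract a 1 = 0 \<longleftrightarrow> a = 0"
  by (simp_all add: Zero_fract_def eq_fract)

lemma Fract_divide: "b \<noteq> 0 \<Longrightarrow> Fract a b = Fract a 1 / Fract b 1"
  by simp

lemma Fract_power: "Fract (a ^ n) 1 = Fract a 1 ^ n"
  by (induction n) (simp_all add: One_fract_def Fract_mult_1 del: mult_fract)

lemma fract_cases_nonzero:
  assumes "z \<noteq> (0 :: 'a::idom fract)"
  obtains a b where "z = Fract a b" "a \<noteq> 0" "b \<noteq> 0"
  using assms by (cases z) (metis Fract_zero_iff div_0 Fract_divide)

text \<open>The localization of k[x] at (p). Denominators are automatically nonzero because p
  divides 0.\<close>

definition place_at :: "'k::field poly \<Rightarrow> 'k poly fract set" where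
  "place_at p = {Fract a b |a b. \<not> p dvd b}"

lemma place_atI: "\<not> p dvd b \<Longrightarrow> Fract a b \<in> place_at p"
  by (auto simp: place_at_def)

text \<open>The functions without a pole at infinity. Zero is included because the zero polynomial
  has degree 0 here.\<close>

definition place_at_infinity :: "'k::field poly fract set" where
  "place_at_infinity = {Fract a b |a b. b \<noteq> 0 \<and> degree a \<le> degree b}"

context
  fixes p :: "'k::field poly"
  assumes p: "monic_irreducible p"
begin

lemma prime_elem_p: "prime_elem p"
  using p field_poly_irreducible_imp_prime by blast

lemma inverse_p_notin_place_at: "inverse (Fract p 1) \<notin> place_at p"
proof
  assume "inverse (Fract p 1) \<in> place_at p"
  then obtain a b where ab: "\<not> p dvd b" "Fract 1 p = Fract a b" by (auto simp: place_at_def)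
  then have "b = a * p" using prime_elem_p by (subst (asm) eq_fract) auto
  then show False using ab by simp
qed

text \<open>Splitting the powers of p off numerator and denominator leaves a quotient of two
  polynomials not divisible by p, which is a unit.\<close>

lemma dvr_place_at: "dvr (place_at p) (Fract p 1)"
  unfolding dvr_def
proof (intro conjI ballI allI impI)
  have np: "\<not> p dvd b * d" if "\<not> p dvd b" "\<not> p dvd d" for b d
    using that prime_elem_p by (simp add: prime_elem_dvd_mult_iff)
  fix w z assume "w \<in> place_at p" "z \<in> place_at p"
  then obtain a b c d where *: "w = Fract a b" "\<not> p dvd b" "z = Fract c d" "\<not> p dvd d"
    by (auto simp: place_at_def)
  then have "b \<noteq> 0" "d \<noteq> 0" by auto
  then show "w - z \<in> place_at p" "w * z \<in> place_at p" using * np[of b d] by (auto intro: place_atI)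
next
  show "Fract p 1 \<in> place_at p" using prime_elem_p by (intro place_atI) auto
  show "inverse (Fract p 1) \<notin> place_at p" by (rule inverse_p_notin_place_at)
  fix z :: "'k poly fract" assume "z \<noteq> 0"
  then obtain a b where z: "z = Fract a b" "a \<noteq> 0" "b \<noteq> 0" by (rule fract_cases_nonzero)
  have nu: "\<not> is_unit p" "p \<noteq> 0" using prime_elem_p by auto
  obtain n a' where a: "a = p ^ n * a'" "\<not> p dvd a'" using poly_decompose nu z by metis
  obtain m b' where b: "b = p ^ m * b'" "\<not> p dvd b'" using poly_decompose nu z by metis
  have nz: "a' \<noteq> 0" "b' \<noteq> 0" using z a b by auto
  show "\<exists>n u. u \<noteq> 0 \<and> u \<in> place_at p \<and> inverse u \<in> place_at p \<and> z = Fract p 1 powi n * u"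
  proof (intro exI conjI)
    show "Fract a' b' \<noteq> 0" using nz by (simp add: Zero_fract_def eq_fract)
    show "Fract a' b' \<in> place_at p" "inverse (Fract a' b') \<in> place_at p"
      using a b by (auto intro: place_atI)
    have "z = (Fract p 1 ^ n * Fract a' 1) / (Fract p 1 ^ m * Fract b' 1)"
      unfolding z(1) Fract_divide[OF z(3)] unfolding a(1) b(1) by (simp only: Fract_mult_1 Fract_power)
    also have "\<dots> = Fract p 1 powi (int n - int m) * (Fract a' 1 / Fract b' 1)"
      using nu by (subst power_int_diff) (auto simp: Fract_zero_iff simp del: divide_fract)
    finally show "z = Fract p 1 powi (int n - int m) * Fract a' b'" using nz by simp
  qed
qed

lemma Fract_mem_max_ideal_place_at: "Fract a 1 \<in> max_ideal (place_at p) \<longleftrightarrow> p dvd a"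
proof
  assume "p dvd a"
  then obtain r where "a = p * r" by blast
  moreover have "Fract r 1 \<in> place_at p" using prime_elem_p by (intro place_atI) auto
  ultimately show "Fract a 1 \<in> max_ideal (place_at p)"
    unfolding dvr_max_ideal[OF dvr_place_at] by (metis Fract_mult_1 image_eqI)
next
  assume a: "Fract a 1 \<in> max_ideal (place_at p)"
  show "p dvd a"
  proof (rule ccontr)
    assume "\<not> p dvd a"
    then have "inverse (Fract a 1) \<in> place_at p" "a \<noteq> 0" by (auto intro: place_atI)
    then show False using a by (auto simp: max_ideal_def Fract_zero_iff)
  qed
qed

lemma Fract_mem_place_at: "Fract a 1 \<in> place_at p"
  using prime_elem_p by (intro place_atI) auto

lemma place_at_places: "place_at p \<in> places const_L"
  using dvr_valuation_ring[OF dvr_place_at] Fract_mem_place_at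
  by (auto simp: places_iff const_L_def)

lemma valuation_place_at_other:
  assumes q: "monic_irreducible q" shows "valuation (place_at p) (Fract q 1) = (if p = q then 1 else 0)"
proof (cases "p = q")
  case True
  then show ?thesis using valuation_uniformizer[OF dvr_place_at] by simp
next
  case False
  have "Fract q 1 \<noteq> 0" using q by (auto simp: Fract_zero_iff)
  moreover have "\<not> p dvd q" using monic_irreducible_dvd_eq[OF p q] False by auto
  ultimately show ?thesis
    using False max_ideal_iff_valuation[OF dvr_place_at, of "Fract q 1"] Fract_mem_place_at[of q]
      mem_iff_valuation[OF dvr_place_at, of "Fract q 1"] Fract_mem_max_ideal_place_at[of q] by auto
qed

lemma valuation_place_at_const: "c \<noteq> 0 \<Longrightarrow> valuation (place_at p) (const_L c) = 0"
proof -
  assume c: "c \<noteq> 0"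
  have "\<not> p dvd [:c:]"
  proof
    assume "p dvd [:c:]"
    moreover have "is_unit [:c:]" using c by (simp add: is_unit_const_poly_iff dvd_field_iff)
    ultimately have "is_unit p" by (rule dvd_unit_imp_unit)
    then show False using prime_elem_p by auto
  qed
  then show ?thesis
    using c max_ideal_iff_valuation[OF dvr_place_at, of "Fract [:c:] 1"] Fract_mem_place_at[of "[:c:]"]
      mem_iff_valuation[OF dvr_place_at, of "Fract [:c:] 1"] Fract_mem_max_ideal_place_at[of "[:c:]"]
    by (auto simp: const_L_def Fract_zero_iff)
qed

end

lemma place_at_inj:
  assumes "monic_irreducible p" "monic_irreducible q" "place_at p = place_at q" shows "p = q"
  using assms Fract_mem_max_ideal_place_at[of p p] Fract_mem_max_ideal_place_at[of q p]
    monic_irreducible_dvd_eq[of q p] by simp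

text \<open>\<open>Q\<close> contains k[x], and its maximal ideal meets k[x] in a nonzero prime
  ideal with a monic generator p. Polynomials outside (p) become units, so the localization at p
  lies in \<open>Q\<close>, and maximality gives equality.\<close>

lemma place_of_rational_function_field_affine:
  fixes Q :: "'k::field poly fract set"
  assumes Q: "Q \<in> places const_L" and x: "Fract [:0, 1:] 1 \<in> Q"
  obtains p where "monic_irreducible p" "Q = place_at p"
proof -
  have V: "valuation_ring Q" and c: "\<And>a. const_L a \<in> Q" using Q by (auto simp: places_iff)
  have poly: "Fract a 1 \<in> Q" for a
  proof (induction a)
    case 0
    then show ?case using valuation_ring_zero[OF V] by (simp add: Zero_fract_def)
  next
    case (pCons b a)
    have "Fract (pCons b a) 1 = const_L b + Fract [:0, 1:] 1 * Fract a 1"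
      by (simp add: const_L_def)
    then show ?case using valuation_ring_add[OF V] valuation_ring_mult[OF V] x c pCons by metis
  qed
  define I where "I = {a. Fract a 1 \<in> max_ideal Q}"
  have diff: "a - b \<in> I" if "a \<in> I" "b \<in> I" for a b
    using that max_ideal_diff[OF V] unfolding I_def mem_Collect_eq Fract_diff_1 by blast
  have mult: "a * b \<in> I" if "b \<in> I" for a b
    using that max_ideal_mult[OF V poly] unfolding I_def mem_Collect_eq Fract_mult_1 by blast
  have inv: "inverse (Fract b 1) \<in> Q" if "b \<notin> I" for b
    using that not_max_ideal_inverse[OF V poly[of b]] unfolding I_def by blast
  \<comment> \<open>Otherwise all nonzero polynomials would be invertible in \<open>Q\<close>, and
    \<open>Q\<close> would be the whole field.\<close>
  have "\<exists>g\<in>I. g \<noteq> 0"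
  proof (rule ccontr)
    assume n: "\<not> (\<exists>g\<in>I. g \<noteq> 0)"
    have "z \<in> Q" for z
    proof (cases z)
      case (Fract a b)
      then have "inverse (Fract b 1) \<in> Q" using n inv by auto
      then have "Fract a 1 * inverse (Fract b 1) \<in> Q" using poly valuation_ring_mult[OF V] by blast
      then show ?thesis using Fract by simp
    qed
    then show False using V by (auto simp: valuation_ring_def)
  qed
  then obtain g where g: "g \<in> I" "g \<noteq> 0" by blast
  obtain p where p: "p \<in> I" "lead_coeff p = 1" "\<And>a. a \<in> I \<Longrightarrow> p dvd a"
    using poly_ideal_principal[OF diff mult g] by blast
  have one: "1 \<notin> I" using max_ideal_one[OF V] by (simp add: I_def One_fract_def)
  have "prime_elem p"
  proof (rule prime_elemI)
    show "p \<noteq> 0" using p by auto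
    show "\<not> is_unit p"
    proof
      assume "is_unit p"
      then obtain r where "1 = r * p" by (auto elim!: dvdE simp: mult.commute)
      then show False using mult[OF p(1), of r] one by simp
    qed
    fix a b assume "p dvd a * b"
    then obtain r where "a * b = r * p" by (metis dvdE mult.commute)
    then have "a * b \<in> I" using mult[OF p(1), of r] by simp
    then have "a \<in> I \<or> b \<in> I"
      using max_ideal_prime[OF V poly poly, of a b] by (simp add: I_def)
    then show "p dvd a \<or> p dvd b" using p by blast
  qed
  then have irr: "monic_irreducible p" using p by (simp add: prime_elem_imp_irreducible)
  have "place_at p \<subseteq> Q"
  proof
    fix z assume "z \<in> place_at p"
    then obtain a b where z: "z = Fract a b" "\<not> p dvd b" by (auto simp: place_at_def)
    have "b \<notin> I" using z p by auto
    then have "Fract a 1 * inverse (Fract b 1) \<in> Q"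
      using inv poly valuation_ring_mult[OF V] by blast
    then show "z \<in> Q" using z by simp
  qed
  from dvr_maximal[OF dvr_place_at[OF irr] V this] show thesis using that irr by blast
qed

lemma dvr_place_at_infinity: "dvr place_at_infinity (inverse (Fract [:0, 1 :: 'k::field:] 1))"
  unfolding dvr_def
proof (intro conjI ballI allI impI)
  fix w z :: "'k poly fract" assume "w \<in> place_at_infinity" "z \<in> place_at_infinity"
  then obtain a b c d where *: "w = Fract a b" "b \<noteq> 0" "degree a \<le> degree b"
    "z = Fract c d" "d \<noteq> 0" "degree c \<le> degree d"
    by (auto simp: place_at_infinity_def)
  have "degree (a * d) \<le> degree (b * d)" "degree (c * b) \<le> degree (b * d)" "degree (a * c) \<le> degree (b * d)"
    using * degree_mult_le[of a d] degree_mult_le[of c b] degree_mult_le[of a c]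
    by (auto simp: degree_mult_eq)
  moreover from this have "degree (a * d - c * b) \<le> degree (b * d)"
    by (intro degree_diff_le)
  ultimately show "w - z \<in> place_at_infinity" "w * z \<in> place_at_infinity"
    using * unfolding place_at_infinity_def by (fastforce simp: mult.commute)+
next
  show "inverse (Fract [:0, 1:] 1) \<in> place_at_infinity"
    unfolding place_at_infinity_def by (intro CollectI exI[of _ 1] exI[of _ "[:0, 1:]"]) simp
  show "inverse (inverse (Fract [:0, 1 :: 'k:] 1)) \<notin> place_at_infinity"
  proof
    assume "inverse (inverse (Fract [:0, 1 :: 'k:] 1)) \<in> place_at_infinity"
    then obtain a b :: "'k poly" where ab: "Fract [:0, 1:] 1 = Fract a b" "b \<noteq> 0" "degree a \<le> degree b"
      by (auto simp: place_at_infinity_def)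
    then have "[:0, 1:] * b = a" by (simp add: eq_fract)
    then have "degree a = 1 + degree b" using ab(2) by (metis degree_mult_eq degree_pCons_eq_if degree_1 one_pCons pCons_eq_0_iff One_nat_def zero_neq_one)
    then show False using ab by simp
  qed
  fix z :: "'k poly fract" assume "z \<noteq> 0"
  then obtain a b where z: "z = Fract a b" "a \<noteq> 0" "b \<noteq> 0" by (rule fract_cases_nonzero)
  let ?x = "[:0, 1 :: 'k:]"
  \<comment> \<open>Both polynomials are padded to degree deg a + deg b, so their quotient is a unit
    at infinity.\<close>
  let ?a = "a * ?x ^ degree b" and ?b = "b * ?x ^ degree a"
  have deg: "degree ?a = degree ?b" and nz: "?a \<noteq> 0" "?b \<noteq> 0"
    using z by (auto simp: degree_mult_eq degree_power_eq)
  show "\<exists>n u. u \<noteq> 0 \<and> u \<in> place_at_infinity \<and> inverse u \<in> place_at_infinity \<and>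
    z = inverse (Fract ?x 1) powi n * u"
  proof (intro exI conjI)
    show "Fract ?a ?b \<noteq> 0" using nz by (simp add: Zero_fract_def eq_fract)
    show "Fract ?a ?b \<in> place_at_infinity" "inverse (Fract ?a ?b) \<in> place_at_infinity"
      using nz deg unfolding place_at_infinity_def inverse_fract by fastforce+
    have x0: "Fract ?x 1 \<noteq> 0" by (simp add: Fract_zero_iff)
    have "inverse (Fract ?x 1) powi (int (degree b) - int (degree a)) =
            Fract ?x 1 ^ degree a / Fract ?x 1 ^ degree b"
      using x0 by (simp add: power_int_diff field_simps del: inverse_fract)
    also have "\<dots> * Fract ?a ?b = Fract a 1 / Fract b 1"
    proof -
      have "Fract ?a ?b = (Fract a 1 * Fract ?x 1 ^ degree b) / (Fract b 1 * Fract ?x 1 ^ degree a)"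
        unfolding Fract_divide[OF nz(2)] by (simp only: Fract_mult_1 Fract_power)
      then show ?thesis using x0 by (simp del: divide_fract mult_fract)
    qed
    finally show "z = inverse (Fract ?x 1) powi (int (degree b) - int (degree a)) * Fract ?a ?b"
      using z by simp
  qed
qed

lemma valuation_place_at_infinity:
  assumes "(a :: 'k::field poly) \<noteq> 0"
  shows "valuation place_at_infinity (Fract a 1) = - int (degree a)"
proof -
  let ?x = "[:0, 1 :: 'k:]"
  have d: "dvr place_at_infinity (inverse (Fract ?x 1))" by (rule dvr_place_at_infinity)
  have x0: "Fract ?x 1 \<noteq> 0" by (simp add: Fract_zero_iff)
  have x: "valuation place_at_infinity (Fract ?x 1) = -1"
    using valuation_uniformizer[OF d] valuation_inverse[OF d x0] by linarith
  have deg: "degree (?x ^ degree a) = degree a" by (simp add: degree_power_eq)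
  have "Fract a (?x ^ degree a) \<in> place_at_infinity" "inverse (Fract a (?x ^ degree a)) \<in> place_at_infinity"
    using assms deg unfolding place_at_infinity_def inverse_fract by force+
  moreover have "Fract a (?x ^ degree a) \<noteq> 0" using assms by (simp add: Zero_fract_def eq_fract)
  ultimately have "valuation place_at_infinity (Fract a (?x ^ degree a)) = 0"
    using unit_iff_valuation[OF d] by blast
  moreover have "Fract a (?x ^ degree a) = Fract a 1 / Fract ?x 1 ^ degree a"
    by (simp add: Fract_power[symmetric])
  moreover have "Fract a 1 \<noteq> 0" "Fract ?x 1 \<noteq> 0" using assms by (simp_all add: Fract_zero_iff)
  ultimately show ?thesis
    using x by (simp add: valuation_divide[OF d] valuation_power[OF d] del: divide_fract)
qed

text \<open>When 1/x lies in the maximal ideal, a / x^n is congruent to the coefficient of x^n in a.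
  Hence a / x^(deg a) is a unit, and quotients of such units give every function regular at
  infinity. The second claim says that a nonzero polynomial never vanishes at infinity, so that it
  can characterize its finite zeros.\<close>

lemma place_of_rational_function_field_infinity:
  fixes Q :: "'k::field poly fract set"
  assumes Q: "Q \<in> places const_L" and x: "Fract [:0, 1:] 1 \<notin> Q"
  shows "Q = place_at_infinity" and "Fract a 1 \<in> max_ideal Q \<Longrightarrow> a = 0"
proof -
  have V: "valuation_ring Q" and c: "\<And>a. const_L a \<in> Q" using Q by (auto simp: places_iff)
  define x where "x = Fract [:0, 1 :: 'k:] 1"
  have x0: "x \<noteq> 0" by (simp add: x_def Fract_zero_iff)
  have xm: "inverse x \<in> max_ideal Q" using not_mem_inverse[OF V x] by (simp add: x_def del: inverse_fract)
  \<comment> \<open>Induction along a = b + x a': the contribution of the constant b carries the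
    positive power n + 1 of 1/x and is negligible.\<close>
  have *: "Fract a 1 / x ^ n - const_L (coeff a n) \<in> max_ideal Q" if "degree a \<le> n" for a n
    using that
  proof (induction n arbitrary: a)
    case 0
    then obtain b where "a = [:b:]" using degree_0_id[of a] by (metis le_zero_eq)
    then show ?case using max_ideal_zero[OF V] by (simp add: const_L_def)
  next
    case (Suc n)
    obtain b a' where a: "a = pCons b a'" by (cases a)
    then have deg: "degree a' \<le> n" using Suc.prems by (cases "a' = 0") auto
    have "Fract a 1 = const_L b + x * Fract a' 1"
      by (simp add: a const_L_def x_def)
    then have "Fract a 1 / x ^ Suc n - const_L (coeff a (Suc n)) =
       const_L b * inverse x ^ n * inverse x + (Fract a' 1 / x ^ n - const_L (coeff a' n))"
      using x0 by (simp add: a field_simps)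
    moreover have "const_L b * inverse x ^ n * inverse x \<in> max_ideal Q"
      using xm c max_ideal_mem[OF V]
      by (intro max_ideal_mult[OF V] valuation_ring_mult[OF V] valuation_ring_power[OF V]) auto
    ultimately show ?case using Suc.IH[OF deg] max_ideal_add[OF V] by metis
  qed
  have mem: "Fract a 1 / x ^ n \<in> Q" if "degree a \<le> n" for a n
  proof -
    have "(Fract a 1 / x ^ n - const_L (coeff a n)) + const_L (coeff a n) \<in> Q"
      using *[OF that] c max_ideal_mem[OF V] by (intro valuation_ring_add[OF V]) auto
    then show ?thesis by simp
  qed
  have unit: "Fract a 1 / x ^ degree a \<notin> max_ideal Q" if "a \<noteq> 0" for a
  proof
    assume "Fract a 1 / x ^ degree a \<in> max_ideal Q"
    from max_ideal_diff[OF V this *[OF order.refl, of a]] have "const_L (lead_coeff a) \<in> max_ideal Q" by simp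
    then have "const_L (inverse (lead_coeff a)) * const_L (lead_coeff a) \<in> max_ideal Q"
      by (rule max_ideal_mult[OF V c])
    moreover have "const_L (inverse (lead_coeff a)) * const_L (lead_coeff a) = 1"
      using that by (simp add: const_L_def One_fract_def one_pCons)
    ultimately show False using max_ideal_one[OF V] by simp
  qed
  have "place_at_infinity \<subseteq> Q"
  proof
    fix z :: "'k poly fract" assume "z \<in> place_at_infinity"
    then obtain a b where z: "z = Fract a b" "b \<noteq> 0" "degree a \<le> degree b"
      by (auto simp: place_at_infinity_def)
    have "inverse (Fract b 1 / x ^ degree b) \<in> Q"
      using not_max_ideal_inverse[OF V mem unit] z by blast
    then have "(Fract a 1 / x ^ degree b) * inverse (Fract b 1 / x ^ degree b) \<in> Q"
      using mem[OF z(3)] valuation_ring_mult[OF V] by blast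
    moreover have "(Fract a 1 / x ^ degree b) * inverse (Fract b 1 / x ^ degree b) = Fract a 1 / Fract b 1"
      using x0 by (simp add: field_simps del: inverse_fract divide_fract mult_fract)
    ultimately show "z \<in> Q" using z by simp
  qed
  from dvr_maximal[OF dvr_place_at_infinity V this] show "Q = place_at_infinity" .
  show "a = 0" if "Fract a 1 \<in> max_ideal Q"
  proof (rule ccontr)
    assume "a \<noteq> 0"
    then have "Fract a 1 * inverse x ^ degree a \<notin> max_ideal Q" using unit by (simp add: field_simps)
    moreover have "inverse x ^ degree a \<in> Q"
      using xm max_ideal_mem[OF V] by (intro valuation_ring_power[OF V]) auto
    ultimately show False using max_ideal_mult2[OF V that] by blast
  qed
qed

text \<open>The description by zeros determines p: a place containing x in which p vanishes comes
  from an irreducible q dividing p, and p has no zero at infinity.\<close>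

lemma point_function_place_at:
  assumes "monic_irreducible p" shows "point_function (place_at p) = Fract p 1"
proof -
  have "(THE q. lead_coeff q = 1 \<and> comm_semiring_1_class.irreducible q \<and>
             (\<forall>Q' \<in> places const_L. Fract q 1 \<in> max_ideal Q' \<longleftrightarrow> Q' = place_at p)) = p"
  proof (rule the_equality)
    have "Fract p 1 \<in> max_ideal Q' \<longleftrightarrow> Q' = place_at p" if Q': "Q' \<in> places const_L" for Q'
    proof
      assume m: "Fract p 1 \<in> max_ideal Q'"
      have V: "valuation_ring Q'" and c: "\<And>a. const_L a \<in> Q'" using Q' by (auto simp: places_iff)
      have "Fract [:0, 1:] 1 \<in> Q'"
      proof (rule ccontr)
        assume "Fract [:0, 1:] 1 \<notin> Q'"
        then have "p = 0" using place_of_rational_function_field_infinity(2)[OF Q' _ m] by blast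
        then show False using assms by simp
      qed
      then obtain q where q: "monic_irreducible q" "Q' = place_at q"
        using place_of_rational_function_field_affine[OF Q'] by blast
      then have "q dvd p" using m Fract_mem_max_ideal_place_at by blast
      then show "Q' = place_at p" using monic_irreducible_dvd_eq[OF q(1) assms] q by simp
    qed (use Fract_mem_max_ideal_place_at[OF assms] in auto)
    then show "lead_coeff p = 1 \<and> comm_semiring_1_class.irreducible p \<and>
             (\<forall>Q' \<in> places const_L. Fract p 1 \<in> max_ideal Q' \<longleftrightarrow> Q' = place_at p)"
      using assms by blast
  next
    fix q assume q: "lead_coeff q = 1 \<and> comm_semiring_1_class.irreducible q \<and>
             (\<forall>Q' \<in> places const_L. Fract q 1 \<in> max_ideal Q' \<longleftrightarrow> Q' = place_at p)"
    then have "Fract q 1 \<in> max_ideal (place_at p)" using place_at_places[OF assms] by blast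
    then have "p dvd q" using Fract_mem_max_ideal_place_at[OF assms] by blast
    then show "q = p" using monic_irreducible_dvd_eq[OF assms, of q] q by blast
  qed
  then show ?thesis using Fract_mem_place_at[OF assms] by (simp add: point_function_def)
qed

section \<open>Places of a quadratic extension\<close>

text \<open>Kept free of polynomials because it is instantiated twice for the same field: with y
  itself at the finite primes, and with a rescaled generator at infinity.\<close>

locale quadratic_extension =
  fixes i :: "'L::field \<Rightarrow> 'K::field" and y :: 'K and F :: 'L
  assumes i_add: "i (a + b) = i a + i b" and i_mult: "i (a * b) = i a * i b" and i_one: "i 1 = 1"
    and y_square: "y\<^sup>2 = i F" and generated: "\<exists>a b. z = i a + i b * y"
    and nonsquare: "a\<^sup>2 \<noteq> F"
begin

lemma i_zero: "i 0 = 0"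
  using i_add[of 0 0] by (metis add.right_neutral add_left_cancel)

lemma i_uminus: "i (- a) = - i a"
  using i_add[of a "- a"] i_zero by (simp add: add_eq_0_iff)

lemma i_diff: "i (a - b) = i a - i b"
  using i_add[of a "- b"] i_uminus by simp

lemma i_eq_0_iff: "i a = 0 \<longleftrightarrow> a = 0"
  using i_mult[of a "inverse a"] i_zero i_one by (cases "a = 0") auto

lemma i_eq_iff: "i a = i b \<longleftrightarrow> a = b"
  using i_eq_0_iff[of "a - b"] by (simp add: i_diff)

lemma i_inverse: "i (inverse a) = inverse (i a)"
proof (cases "a = 0")
  case False
  then have "i a * i (inverse a) = 1" using i_mult[of a "inverse a"] i_one by simp
  then show ?thesis by (metis inverse_unique)
qed (simp add: i_zero)

lemma i_divide: "i (a / b) = i a / i b"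
  by (simp add: divide_inverse i_mult i_inverse)

lemma i_power: "i (a ^ n) = i a ^ n"
  by (induction n) (simp_all add: i_one i_mult)

lemma i_powi: "i (a powi n) = i a powi n"
  by (simp add: power_int_def i_power i_inverse)

section \<open>Coordinates with respect to 1, y; norm and conjugation\<close>

definition el :: "'L \<Rightarrow> 'L \<Rightarrow> 'K" where
  "el a b = i a + i b * y"

lemma el_cases: obtains a b where "z = el a b"
  using generated unfolding el_def by blast

lemma el_0: "el a 0 = i a"
  by (simp add: el_def i_zero)

lemma el_0_1: "el 0 1 = y"
  by (simp add: el_def i_zero i_one)

lemma el_diff: "el a b - el c d = el (a - c) (b - d)"
  by (simp add: el_def i_diff algebra_simps)

lemma el_mult: "el a b * el c d = el (a * c + b * d * F) (a * d + b * c)"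
proof -
  have "el a b * el c d = i a * i c + i b * i d * y\<^sup>2 + (i a * i d + i b * i c) * y"
    by (simp add: el_def algebra_simps power2_eq_square)
  then show ?thesis unfolding y_square by (simp add: el_def i_add i_mult)
qed

lemma i_mult_el: "i c * el a b = el (c * a) (c * b)"
  by (simp add: el_def i_mult algebra_simps)

lemma el_eq_0_iff: "el a b = 0 \<longleftrightarrow> a = 0 \<and> b = 0"
proof
  assume e: "el a b = 0"
  show "a = 0 \<and> b = 0"
  proof (cases "b = 0")
    case False
    then have "i b \<noteq> 0" by (simp add: i_eq_0_iff)
    then have "y = i (- a / b)" using e by (simp add: el_def i_divide i_uminus field_simps add_eq_0_iff)
    then have "i ((- a / b)\<^sup>2) = i F" using y_square by (simp only: i_power)
    then show ?thesis using nonsquare unfolding i_eq_iff by blast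
  qed (use e in \<open>simp add: el_0 i_eq_0_iff\<close>)
qed (simp add: el_def i_zero)

lemma el_eq_iff: "el a b = el c d \<longleftrightarrow> a = c \<and> b = d"
  by (metis el_diff el_eq_0_iff eq_iff_diff_eq_0)

definition nrm :: "'K \<Rightarrow> 'L" where
  "nrm z = (THE d. \<exists>a b. z = el a b \<and> d = a\<^sup>2 - b\<^sup>2 * F)"

definition conj :: "'K \<Rightarrow> 'K" where
  "conj z = (THE w. \<exists>a b. z = el a b \<and> w = el a (- b))"

lemma nrm_el: "nrm (el a b) = a\<^sup>2 - b\<^sup>2 * F"
  unfolding nrm_def by (rule the_equality) (auto simp: el_eq_iff)

lemma conj_el: "conj (el a b) = el a (- b)"
  unfolding conj_def by (rule the_equality) (auto simp: el_eq_iff)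

lemma nrm_i: "nrm (i a) = a\<^sup>2"
  using nrm_el[of a 0] by (simp add: el_0)

lemma nrm_y: "nrm y = - F"
  using nrm_el[of 0 1] by (simp add: el_0_1)

lemma nrm_mult: "nrm (z * w) = nrm z * nrm w"
  by (cases z rule: el_cases; cases w rule: el_cases)
    (simp add: el_mult nrm_el power2_eq_square algebra_simps)

text \<open>A vanishing norm with b nonzero would make F the square of a / b.\<close>

lemma nrm_eq_0_iff: "nrm z = 0 \<longleftrightarrow> z = 0"
proof (cases z rule: el_cases)
  case (1 a b)
  have "a = 0 \<and> b = 0" if "a\<^sup>2 = b\<^sup>2 * F"
  proof (cases "b = 0")
    case False
    then have "(a / b)\<^sup>2 = F" using that by (simp add: power_divide)
    then show ?thesis using nonsquare by blast
  qed (use that in simp)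
  then show ?thesis by (auto simp: 1 nrm_el el_eq_0_iff)
qed

lemma nrm_one: "nrm 1 = 1"
  using nrm_i[of 1] by (simp add: i_one)

lemma nrm_inverse: "nrm (inverse z) = inverse (nrm z)"
proof (cases "z = 0")
  case False
  then have "nrm z * nrm (inverse z) = 1" using nrm_mult[of z "inverse z"] nrm_one by simp
  then show ?thesis by (metis inverse_unique)
qed (use nrm_eq_0_iff[of 0] in simp)

lemma nrm_power: "nrm (z ^ n) = nrm z ^ n"
  by (induction n) (simp_all add: nrm_one nrm_mult)

lemma nrm_powi: "nrm (z powi n) = nrm z powi n"
  by (simp add: power_int_def nrm_power nrm_inverse)

lemma mult_conj: "z * conj z = i (nrm z)"
proof (cases z rule: el_cases)
  case (1 a b)
  then show ?thesis
    by (simp add: conj_el el_mult nrm_el power2_eq_square flip: el_0)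
qed

lemma conj_mult: "conj (z * w) = conj z * conj w"
  by (cases z rule: el_cases; cases w rule: el_cases) (simp add: el_mult conj_el el_eq_iff)

lemma conj_i: "conj (i a) = i a"
  using conj_el[of a 0] by (simp add: el_0)

lemma conj_conj: "conj (conj z) = z"
  by (cases z rule: el_cases) (simp add: conj_el)

lemma conj_inverse: "conj (inverse z) = inverse (conj z)"
proof (cases "z = 0")
  case False
  then have "conj z * conj (inverse z) = 1" using conj_mult[of z "inverse z"] conj_i[of 1] i_one by simp
  then show ?thesis by (metis inverse_unique)
qed (use conj_i[of 0] i_zero in simp)

lemma conj_eq_0_iff: "conj z = 0 \<longleftrightarrow> z = 0"
  using conj_conj[of z] conj_i[of 0] i_zero by metis

section \<open>Places of the extension above a given place\<close>

definition lies_over :: "'K set \<Rightarrow> 'L set \<Rightarrow> bool" where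
  "lies_over W Q \<longleftrightarrow> valuation_ring W \<and> i -` W = Q"

lemma lies_overD: "lies_over W Q \<Longrightarrow> i a \<in> W \<longleftrightarrow> a \<in> Q"
  by (auto simp: lies_over_def)

lemma lies_over_max_ideal: "lies_over W Q \<Longrightarrow> i a \<in> max_ideal W \<longleftrightarrow> a \<in> max_ideal Q"
  by (auto simp: max_ideal_def i_eq_0_iff lies_overD simp flip: i_inverse)

text \<open>Only properness is at stake: if all of \<open>L\<close> were mapped into
  \<open>W\<close>, then y would be in \<open>W\<close> as a square root of an element of
  \<open>W\<close>, and \<open>W\<close> would be everything.\<close>

lemma valuation_ring_restrict:
  assumes W: "valuation_ring W" shows "valuation_ring (i -` W)"
  unfolding valuation_ring_def
proof (intro conjI ballI allI)
  show "i -` W \<noteq> UNIV"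
  proof
    assume *: "i -` W = UNIV"
    then have i: "i a \<in> W" for a by auto
    have "y \<in> W" using valuation_ring_square[OF W, of y] i y_square by simp
    have "z \<in> W" for z
      by (cases z rule: el_cases)
        (use i \<open>y \<in> W\<close> valuation_ring_add[OF W] valuation_ring_mult[OF W] in \<open>auto simp: el_def\<close>)
    then show False using W by (auto simp: valuation_ring_def)
  qed
  fix a b assume "a \<in> i -` W" "b \<in> i -` W"
  then show "a - b \<in> i -` W" "a * b \<in> i -` W"
    using valuation_ring_diff[OF W] valuation_ring_mult[OF W] by (auto simp: i_diff i_mult)
next
  fix z show "z \<in> i -` W \<or> inverse z \<in> i -` W"
    using valuation_ring_total[OF W, of "i z"] by (auto simp: i_inverse)
qed

lemma y_mem:
  assumes "lies_over W Q" "F \<in> Q" shows "y \<in> W"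
  using valuation_ring_square[of W y] assms y_square by (auto simp: lies_over_def)

lemma el_mem:
  assumes W: "lies_over W Q" and "F \<in> Q" "a \<in> Q" "b \<in> Q" shows "el a b \<in> W"
proof -
  have V: "valuation_ring W" using W by (simp add: lies_over_def)
  show ?thesis unfolding el_def
    using assms y_mem[OF W] by (intro valuation_ring_add[OF V] valuation_ring_mult[OF V])
      (auto simp: lies_overD)
qed

text \<open>The closure conditions under which the residue dimension over the image of
  \<open>Q\<close> can be computed.\<close>

lemma residue_subfield_conditions:
  assumes W: "lies_over W Q"
  shows "i ` Q \<subseteq> W" "1 \<in> i ` Q" "\<And>a b. a \<in> i ` Q \<Longrightarrow> b \<in> i ` Q \<Longrightarrow> a - b \<in> i ` Q"
    "\<And>a b. a \<in> i ` Q \<Longrightarrow> b \<in> i ` Q \<Longrightarrow> a * b \<in> i ` Q"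
    "\<And>a. a \<in> i ` Q \<Longrightarrow> a \<notin> max_ideal W \<Longrightarrow> inverse a \<in> i ` Q"
proof -
  have V: "valuation_ring W" using W by (simp add: lies_over_def)
  have Q: "valuation_ring Q" using valuation_ring_restrict[OF V] W by (simp add: lies_over_def)
  show "i ` Q \<subseteq> W" using W by (auto simp: lies_over_def)
  show "1 \<in> i ` Q" using valuation_ring_one[OF Q] i_one by force
  show "a - b \<in> i ` Q" if "a \<in> i ` Q" "b \<in> i ` Q" for a b
    using that valuation_ring_diff[OF Q] by (auto simp flip: i_diff)
  show "a * b \<in> i ` Q" if "a \<in> i ` Q" "b \<in> i ` Q" for a b
    using that valuation_ring_mult[OF Q] by (auto simp flip: i_mult)
  show "inverse a \<in> i ` Q" if "a \<in> i ` Q" "a \<notin> max_ideal W" for a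
    using that not_max_ideal_inverse[OF Q] lies_over_max_ideal[OF W]
    by (auto simp flip: i_inverse)
qed

lemma inertia_eq_1:
  assumes W: "lies_over W Q" and "\<And>z. z \<in> W \<Longrightarrow> \<exists>q\<in>Q. z - i q \<in> max_ideal W"
  shows "residue_dim (i ` Q) W = 1"
proof -
  have V: "valuation_ring W" using W by (simp add: lies_over_def)
  show ?thesis
    by (rule residue_dim_eq_1[OF V]) (use residue_subfield_conditions[OF W] assms in auto)
qed

text \<open>Used when \<open>W\<close> is \<open>Q[y]\<close>: the residues of 1 and y are then a
  basis.\<close>

lemma inertia_eq_2:
  assumes W: "lies_over W Q" and F: "F \<in> Q"
    and span: "\<And>z. z \<in> W \<Longrightarrow> \<exists>a\<in>Q. \<exists>b\<in>Q. z = el a b"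
    and indep: "\<And>a b. a \<in> Q \<Longrightarrow> b \<in> Q \<Longrightarrow> el a b \<in> max_ideal W \<Longrightarrow> a \<in> max_ideal Q \<and> b \<in> max_ideal Q"
  shows "residue_dim (i ` Q) W = 2"
proof -
  have V: "valuation_ring W" using W by (simp add: lies_over_def)
  show ?thesis
  proof (rule residue_dim_eq_2[OF V, where b = y])
    show "y \<in> W" by (rule y_mem[OF W F])
    fix z assume "z \<in> W"
    then obtain a b where "a \<in> Q" "b \<in> Q" "z = el a b" using span by blast
    then show "\<exists>s\<in>i ` Q. \<exists>s'\<in>i ` Q. z - (s + s' * y) \<in> max_ideal W"
      using max_ideal_zero[OF V]
      by (intro bexI[of _ "i a"] bexI[of _ "i b"]) (auto simp: el_def)
  next
    fix s s' assume "s \<in> i ` Q" "s' \<in> i ` Q" "s + s' * y \<in> max_ideal W"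
    then show "s \<in> max_ideal W \<and> s' \<in> max_ideal W"
      using indep lies_over_max_ideal[OF W] by (auto simp: el_def)
  qed (use residue_subfield_conditions[OF W] in auto)
qed

end

locale quadratic_extension_dvr = quadratic_extension i y F
  for i :: "'L::field \<Rightarrow> 'K::field" and y F +
  fixes Q t
  assumes Q: "dvr Q t" and F_mem: "F \<in> Q"
begin

lemmas Q_ring = dvr_valuation_ring[OF Q]
lemmas t_nz = dvr_uniformizer_nonzero[OF Q]

text \<open>If the valuation of \<open>F\<close> is 1, or \<open>F\<close> is not a square in the residue field, then \<open>Q[y]\<close> is
  already a valuation ring and equals the following set.\<close>

definition norm_ring :: "'K set" where "norm_ring = {z. nrm z \<in> Q}"

section \<open>A single place above: common treatment of the ramified and inert cases\<close>

context
  fixes T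
  assumes integral: "\<And>a b. a\<^sup>2 - b\<^sup>2 * F \<in> Q \<Longrightarrow> a \<in> Q \<and> b \<in> Q"
    and T: "valuation Q (nrm T) > 0" "T \<noteq> 0"
    and T_val: "\<And>z. z \<noteq> 0 \<Longrightarrow> \<exists>n. valuation Q (nrm z) = n * valuation Q (nrm T)"
begin

lemma el_mem_norm_ring: "el a b \<in> norm_ring \<longleftrightarrow> a \<in> Q \<and> b \<in> Q"
proof
  assume "a \<in> Q \<and> b \<in> Q"
  then show "el a b \<in> norm_ring"
    unfolding norm_ring_def mem_Collect_eq nrm_el
    using F_mem valuation_ring_diff[OF Q_ring] valuation_ring_mult[OF Q_ring] valuation_ring_power[OF Q_ring]
    by simp
qed (use integral[of a b] in \<open>simp add: norm_ring_def nrm_el\<close>)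

text \<open>The norm is not additive, so closure under subtraction uses \<open>integral\<close>,
  which identifies the ring with \<open>Q[y]\<close>. For the factorization, \<open>T_val\<close>
  supplies n such that z T^(-n) has a norm of valuation 0; such an element and its inverse lie in
  \<open>norm_ring\<close> by definition.\<close>

lemma norm_ring_dvr: "dvr norm_ring T"
  unfolding dvr_def
proof (intro conjI ballI allI impI)
  fix z w assume "z \<in> norm_ring" "w \<in> norm_ring"
  moreover obtain a b where z: "z = el a b" by (rule el_cases)
  moreover obtain c d where w: "w = el c d" by (rule el_cases)
  ultimately have "a \<in> Q" "b \<in> Q" "c \<in> Q" "d \<in> Q" by (auto simp: el_mem_norm_ring)
  then show "z - w \<in> norm_ring" "z * w \<in> norm_ring" unfolding z w el_mult el_diff el_mem_norm_ring
    using F_mem valuation_ring_diff[OF Q_ring] valuation_ring_mult[OF Q_ring] valuation_ring_add[OF Q_ring]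
    by auto
next
  have nT: "nrm T \<noteq> 0" using T by (simp add: nrm_eq_0_iff)
  show "T \<in> norm_ring" "inverse T \<notin> norm_ring"
    using nT T mem_iff_valuation[OF Q, of "nrm T"] mem_iff_valuation[OF Q, of "inverse (nrm T)"]
    by (auto simp: norm_ring_def nrm_inverse valuation_inverse[OF Q])
  fix z :: 'K assume z: "z \<noteq> 0"
  then obtain n where n: "valuation Q (nrm z) = n * valuation Q (nrm T)" using T_val by blast
  define u where "u = z * T powi (- n)"
  have u: "u \<noteq> 0" using z T by (simp add: u_def)
  have nu: "nrm u \<noteq> 0" using u by (simp add: nrm_eq_0_iff)
  have "valuation Q (nrm u) = 0"
    using z T n nT by (simp add: u_def nrm_mult nrm_powi valuation_mult[OF Q] valuation_powi[OF Q]
      nrm_eq_0_iff)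
  then have "u \<in> norm_ring" "inverse u \<in> norm_ring"
    using unit_iff_valuation[OF Q nu] by (auto simp: norm_ring_def nrm_inverse)
  moreover have "z = T powi n * u" using T by (simp add: u_def power_int_minus)
  ultimately show "\<exists>n u. u \<noteq> 0 \<and> u \<in> norm_ring \<and> inverse u \<in> norm_ring \<and> z = T powi n * u"
    using u by blast
qed

text \<open>Any \<open>W\<close> above \<open>Q\<close> contains \<open>Q\<close> and y, hence
  \<open>Q[y]\<close>; maximality leaves one possibility.\<close>

lemma lies_over_norm_ring_iff: "lies_over W Q \<longleftrightarrow> W = norm_ring"
proof
  assume W: "lies_over W Q"
  have "norm_ring \<subseteq> W"
  proof
    fix z assume "z \<in> norm_ring"
    then show "z \<in> W"
      by (cases z rule: el_cases) (use el_mem[OF W F_mem] el_mem_norm_ring in auto)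
  qed
  then show "W = norm_ring"
    using dvr_maximal[OF norm_ring_dvr] W by (auto simp: lies_over_def)
next
  assume "W = norm_ring"
  then show "lies_over W Q"
    using dvr_valuation_ring[OF norm_ring_dvr] el_mem_norm_ring[of _ 0] dvr_zero_one[OF Q]
    by (auto simp: lies_over_def el_0)
qed

lemma valuation_norm_ring:
  assumes z: "z \<noteq> 0"
  shows "valuation Q (nrm z) = valuation norm_ring z * valuation Q (nrm T)"
proof -
  obtain u where u: "u \<noteq> 0" "u \<in> norm_ring" "inverse u \<in> norm_ring" "z = T powi valuation norm_ring z * u"
    by (rule valuation_eqE[OF norm_ring_dvr z])
  have "valuation Q (nrm u) = 0"
    using u(1-3) unit_iff_valuation[OF Q, of "nrm u"] by (auto simp: norm_ring_def nrm_inverse nrm_eq_0_iff)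
  moreover have "nrm z = nrm T powi valuation norm_ring z * nrm u"
    by (subst u(4)) (simp add: nrm_mult nrm_powi)
  ultimately show ?thesis
    using u(1) T by (simp add: valuation_mult[OF Q] valuation_powi[OF Q] nrm_eq_0_iff)
qed

lemma max_ideal_norm_ring: "z \<in> max_ideal norm_ring \<longleftrightarrow> nrm z \<in> max_ideal Q"
  by (auto simp: max_ideal_def norm_ring_def nrm_eq_0_iff nrm_inverse)

end

text \<open>The valuations of a^2 and b^2 F have different parity, so they cannot cancel and the
  valuation of the norm is their minimum. This yields integrality of both coordinates, and y is a
  uniformizer because its norm -F has valuation 1. Modulo y only the first coordinate remains, so
  the residue field does not grow.\<close>

lemma ramified:
  assumes F: "valuation Q F = 1" "F \<noteq> 0"
  shows "dvr norm_ring y" "lies_over W Q \<longleftrightarrow> W = norm_ring"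
    "z \<noteq> 0 \<Longrightarrow> valuation Q (nrm z) = valuation norm_ring z"
    "z \<in> norm_ring \<Longrightarrow> \<exists>q\<in>Q. z - i q \<in> max_ideal norm_ring"
proof -
  have val: "valuation Q (a\<^sup>2 - b\<^sup>2 * F) = min (2 * valuation Q a) (2 * valuation Q b + 1)"
    if "a \<noteq> 0" "b \<noteq> 0" for a b
  proof -
    let ?A = "a\<^sup>2" and ?B = "- (b\<^sup>2 * F)"
    have AB: "?A \<noteq> 0" "?B \<noteq> 0" using that F by auto
    have "valuation Q ?A = 2 * valuation Q a" "valuation Q ?B = 2 * valuation Q b + 1"
      using that F by (simp_all add: valuation_power[OF Q] valuation_uminus[OF Q] valuation_mult[OF Q])
    moreover from this have "valuation Q ?A \<noteq> valuation Q ?B" by presburger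
    ultimately show ?thesis
      using valuation_add_eq(2)[OF Q AB] valuation_add_eq(2)[OF Q AB(2,1)]
      by (cases "valuation Q ?A < valuation Q ?B") (auto simp: add.commute)
  qed
  have integral: "a \<in> Q \<and> b \<in> Q" if m: "a\<^sup>2 - b\<^sup>2 * F \<in> Q" for a b
  proof -
    consider "b = 0" | "a = 0" "b \<noteq> 0" | "a \<noteq> 0" "b \<noteq> 0" by blast
    then show ?thesis
    proof cases
      case 1
      then show ?thesis using m valuation_ring_square[OF Q_ring] valuation_ring_zero[OF Q_ring] by simp
    next
      case 2
      then have "b\<^sup>2 * F \<in> Q" using m valuation_ring_uminus[OF Q_ring] by fastforce
      then have "2 * valuation Q b + 1 \<ge> 0"
        using 2 F mem_iff_valuation[OF Q, of "b\<^sup>2 * F"]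
        by (simp add: valuation_power[OF Q] valuation_mult[OF Q])
      then show ?thesis using 2 mem_iff_valuation[OF Q, of b] valuation_ring_zero[OF Q_ring] by simp
    next
      case 3
      then have "a\<^sup>2 - b\<^sup>2 * F \<noteq> 0" using nrm_eq_0_iff[of "el a b"] by (simp add: nrm_el el_eq_0_iff)
      from mem_iff_valuation[OF Q this] have "min (2 * valuation Q a) (2 * valuation Q b + 1) \<ge> 0"
        using m val[OF 3] by simp
      then show ?thesis using 3 mem_iff_valuation[OF Q, of b] mem_iff_valuation[OF Q, of a] by simp
    qed
  qed
  have vy: "valuation Q (nrm y) = 1" using F by (simp add: nrm_y valuation_uminus[OF Q])
  have y0: "y \<noteq> 0" using F(2) y_square i_eq_0_iff[of F] by (metis zero_power2)
  have T: "valuation Q (nrm y) > 0" using vy by simp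
  have Tv: "\<exists>n. valuation Q (nrm z) = n * valuation Q (nrm y)" for z using vy by simp
  show dvr: "dvr norm_ring y" by (rule norm_ring_dvr[OF integral T y0 Tv])
  show lies: "lies_over W Q \<longleftrightarrow> W = norm_ring" for W by (rule lies_over_norm_ring_iff[OF integral T y0 Tv])
  show "z \<noteq> 0 \<Longrightarrow> valuation Q (nrm z) = valuation norm_ring z"
    using valuation_norm_ring[OF integral T y0 Tv] vy by simp
  assume z: "z \<in> norm_ring"
  obtain a b where ab: "z = el a b" by (rule el_cases)
  then have m: "a \<in> Q" "b \<in> Q" using z el_mem_norm_ring[OF integral T y0 Tv] by auto
  have "i b * y \<in> max_ideal norm_ring"
  proof (intro max_ideal_mult dvr_valuation_ring[OF dvr])
    show "i b \<in> norm_ring" using m lies lies_overD by blast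
    show "y \<in> max_ideal norm_ring"
      using dvr_uniformizer[OF dvr] by (simp add: max_ideal_def)
  qed
  then show "\<exists>q\<in>Q. z - i q \<in> max_ideal norm_ring"
    using m ab by (intro bexI[of _ a]) (auto simp: el_def)
qed

text \<open>The exponent is the smaller of the two coordinate valuations. The auxiliary statement is
  symmetric in the coordinates, so it may assume that the first one has it.\<close>

lemma primitive_part:
  assumes "z \<noteq> 0"
  obtains n a b where "a \<in> Q" "b \<in> Q" "a \<notin> max_ideal Q \<or> b \<notin> max_ideal Q" "z = i t powi n * el a b"
proof -
  note res = that
  obtain a b where z: "z = el a b" by (rule el_cases)
  have *: thesis if "z = el a b \<or> z = el b a" "a \<noteq> 0" "b = 0 \<or> valuation Q a \<le> valuation Q b" for a b
  proof -
    define n where "n = valuation Q a"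
    define c where "c = t powi (- n)"
    have c: "c \<noteq> 0" "valuation Q c = - n"
      using t_nz valuation_powi[OF Q t_nz, of "- n"] valuation_uniformizer[OF Q] by (auto simp: c_def)
    have "valuation Q (c * a) = 0" using c that(2) by (simp add: valuation_mult[OF Q] n_def)
    then have a: "c * a \<in> Q" "c * a \<notin> max_ideal Q"
      using mem_iff_valuation[OF Q, of "c * a"] max_ideal_iff_valuation[OF Q, of "c * a"] that(2) c by auto
    have b: "c * b \<in> Q"
    proof (cases "b = 0")
      case False
      then show ?thesis using c that(3)
        by (subst mem_iff_valuation[OF Q]) (auto simp: valuation_mult[OF Q] n_def)
    qed (simp add: dvr_zero_one[OF Q])
    have "i t powi n * i c = 1"
      using t_nz by (simp add: c_def power_int_minus i_inverse i_powi i_eq_0_iff)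
    then have e: "i t powi n * el (c * r) (c * s) = el r s" for r s
      by (metis i_mult_el mult.assoc mult_1)
    show thesis
      using that(1) res[of "c * a" "c * b" n] res[of "c * b" "c * a" n] a b e by metis
  qed
  show thesis
    using *[of a b] *[of b a] z assms el_eq_0_iff by (metis linear)
qed

text \<open>A primitive element has unit norm: otherwise F would be a square in the residue field.
  Since t has norm t^2, all valuations of norms are even, and t remains a uniformizer. The same fact
  shows that 1 and y are independent modulo the maximal ideal.\<close>

lemma inert:
  assumes F: "\<And>s. s \<in> Q \<Longrightarrow> F - s\<^sup>2 \<notin> max_ideal Q"
  shows "dvr norm_ring (i t)" "lies_over W Q \<longleftrightarrow> W = norm_ring"
    "z \<noteq> 0 \<Longrightarrow> valuation Q (nrm z) = 2 * valuation norm_ring z"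
    "residue_dim (i ` Q) norm_ring = 2"
proof -
  have prim: "a\<^sup>2 - b\<^sup>2 * F \<notin> max_ideal Q" if ab: "a \<in> Q" "b \<in> Q" "a \<notin> max_ideal Q \<or> b \<notin> max_ideal Q" for a b
  proof
    assume m: "a\<^sup>2 - b\<^sup>2 * F \<in> max_ideal Q"
    have "b \<notin> max_ideal Q"
    proof
      assume b: "b \<in> max_ideal Q"
      then have "b\<^sup>2 * F \<in> max_ideal Q" using F_mem ab(2)
        by (auto simp: power2_eq_square intro: max_ideal_mult[OF Q_ring] max_ideal_mult2[OF Q_ring])
      from max_ideal_add[OF Q_ring m this] have "a\<^sup>2 \<in> max_ideal Q" by simp
      then have "a \<in> max_ideal Q" by (rule max_ideal_power[OF Q_ring ab(1)])
      then show False using b ab by blast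
    qed
    then have ib: "inverse b \<in> Q" "b \<noteq> 0" using not_max_ideal_inverse[OF Q_ring ab(2)] by auto
    \<comment> \<open>Dividing by -b^2, with b a unit, exhibits F as congruent to the square of a /
      b.\<close>
    have "- ((inverse b)\<^sup>2) * (a\<^sup>2 - b\<^sup>2 * F) \<in> max_ideal Q"
      using ib by (intro max_ideal_mult[OF Q_ring] m valuation_ring_uminus[OF Q_ring] valuation_ring_power[OF Q_ring])
    moreover have "- ((inverse b)\<^sup>2) * (a\<^sup>2 - b\<^sup>2 * F) = F - (a * inverse b)\<^sup>2"
      using ib(2) by (simp add: field_simps)
    ultimately show False using F[of "a * inverse b"] valuation_ring_mult[OF Q_ring ab(1) ib(1)] by simp
  qed
  have nrm_mem: "a\<^sup>2 - b\<^sup>2 * F \<in> Q" if "a \<in> Q" "b \<in> Q" for a b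
    using that F_mem by (intro valuation_ring_diff[OF Q_ring] valuation_ring_mult[OF Q_ring] valuation_ring_power[OF Q_ring])
  have it: "i t \<noteq> 0" using t_nz by (simp add: i_eq_0_iff)
  have vt: "valuation Q (nrm (i t)) = 2"
    using valuation_uniformizer[OF Q] t_nz by (simp add: nrm_i valuation_power[OF Q])
  have val: "valuation Q (nrm (i t powi n * el a b)) = 2 * n"
    if "a \<in> Q" "b \<in> Q" "a \<notin> max_ideal Q \<or> b \<notin> max_ideal Q" for n a b
  proof -
    have nz: "el a b \<noteq> 0" using that max_ideal_zero[OF Q_ring] by (auto simp: el_eq_0_iff)
    have "valuation Q (nrm (el a b)) = 0"
    proof -
      have "nrm (el a b) \<noteq> 0" using nz by (simp add: nrm_eq_0_iff)
      note mem_iff_valuation[OF Q this] max_ideal_iff_valuation[OF Q this]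
      then show ?thesis using prim[OF that] nrm_mem[OF that(1,2)] by (simp add: nrm_el)
    qed
    then show ?thesis using nz it vt
      by (simp add: nrm_mult nrm_powi valuation_mult[OF Q] valuation_powi[OF Q] nrm_eq_0_iff)
  qed
  have integral: "a \<in> Q \<and> b \<in> Q" if m: "a\<^sup>2 - b\<^sup>2 * F \<in> Q" for a b
  proof (cases "el a b = 0")
    case False
    then obtain n c d where *: "c \<in> Q" "d \<in> Q" "c \<notin> max_ideal Q \<or> d \<notin> max_ideal Q"
      "el a b = i t powi n * el c d" by (rule primitive_part)
    have "valuation Q (nrm (el a b)) \<ge> 0"
      using m False mem_iff_valuation[OF Q, of "nrm (el a b)"] nrm_eq_0_iff[of "el a b"]
      by (auto simp: nrm_el)
    then have "n \<ge> 0" using val[OF *(1-3)] *(4) by simp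
    then have "t powi n \<in> Q" by (rule dvr_powi[OF Q])
    moreover have "a = t powi n * c" "b = t powi n * d"
      using *(4) el_eq_iff by (simp_all add: i_mult_el flip: i_powi)
    ultimately show ?thesis using * valuation_ring_mult[OF Q_ring] by simp
  qed (simp add: el_eq_0_iff dvr_zero_one[OF Q])
  have T: "valuation Q (nrm (i t)) > 0" using vt by simp
  have Tv: "\<exists>n. valuation Q (nrm z) = n * valuation Q (nrm (i t))" if nz: "z \<noteq> 0" for z
  proof -
    obtain n c d where *: "c \<in> Q" "d \<in> Q" "c \<notin> max_ideal Q \<or> d \<notin> max_ideal Q"
      "z = i t powi n * el c d" using nz by (rule primitive_part)
    then show ?thesis using val[OF *(1-3)] vt by auto
  qed
  show dvr: "dvr norm_ring (i t)" by (rule norm_ring_dvr[OF integral T it Tv])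
  show lies: "lies_over W Q \<longleftrightarrow> W = norm_ring" for W by (rule lies_over_norm_ring_iff[OF integral T it Tv])
  show "z \<noteq> 0 \<Longrightarrow> valuation Q (nrm z) = 2 * valuation norm_ring z"
    using valuation_norm_ring[OF integral T it Tv] vt by simp
  show "residue_dim (i ` Q) norm_ring = 2"
  proof (rule inertia_eq_2[OF _ F_mem])
    show "lies_over norm_ring Q" using lies by blast
    show "\<exists>a\<in>Q. \<exists>b\<in>Q. z = el a b" if "z \<in> norm_ring" for z
      using that el_mem_norm_ring[OF integral T it Tv] by (metis el_cases)
    show "a \<in> max_ideal Q \<and> b \<in> max_ideal Q" if "a \<in> Q" "b \<in> Q" "el a b \<in> max_ideal norm_ring" for a b
      using that prim[of a b] max_ideal_norm_ring[OF integral T it Tv] by (auto simp: nrm_el)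
  qed
qed

text \<open>When \<open>F\<close> is congruent to \<open>s\<^sup>2\<close>, the ring \<open>split_ring s\<close> is the localization of \<open>Q[y]\<close> at the prime
  ideal generated by \<open>t\<close> and \<open>y - s\<close>.\<close>

definition split_ideal :: "'L \<Rightarrow> 'K set" where
  "split_ideal s = {el a b |a b. a \<in> Q \<and> b \<in> Q \<and> a + b * s \<in> max_ideal Q}"

definition split_units :: "'L \<Rightarrow> 'K set" where
  "split_units s = {el a b |a b. a \<in> Q \<and> b \<in> Q \<and> a + b * s \<notin> max_ideal Q}"

definition split_ring :: "'L \<Rightarrow> 'K set" where
  "split_ring s = {u / w |u w. u \<in> split_ideal s \<union> split_units s \<and> w \<in> split_units s}"

lemma split_Un: "split_ideal s \<union> split_units s = {el a b |a b. a \<in> Q \<and> b \<in> Q}"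
  by (auto simp: split_ideal_def split_units_def)

lemma el_mem_split_ideal: "el a b \<in> split_ideal s \<longleftrightarrow> a \<in> Q \<and> b \<in> Q \<and> a + b * s \<in> max_ideal Q"
  and el_mem_split_units: "el a b \<in> split_units s \<longleftrightarrow> a \<in> Q \<and> b \<in> Q \<and> a + b * s \<notin> max_ideal Q"
  by (auto simp: split_ideal_def split_units_def el_eq_iff)

lemma conj_split: "z \<in> split_ideal s \<Longrightarrow> conj z \<in> split_ideal (- s)"
  "z \<in> split_units s \<Longrightarrow> conj z \<in> split_units (- s)"
  using valuation_ring_uminus[OF Q_ring]
  by (auto simp: split_ideal_def split_units_def conj_el el_eq_iff)

text \<open>Conjugation sends y to -y and so interchanges the places at which y has residue s and
  -s; valuations at one are thereby read off at the other.\<close>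

lemma conj_split_ring: "z \<in> split_ring s \<Longrightarrow> conj z \<in> split_ring (- s)"
proof -
  assume "z \<in> split_ring s"
  then obtain u w where *: "z = u / w" "u \<in> split_ideal s \<union> split_units s" "w \<in> split_units s"
    unfolding split_ring_def by blast
  then have "conj z = conj u / conj w" by (simp add: divide_inverse conj_mult conj_inverse)
  then show ?thesis using * conj_split[of _ s] unfolding split_ring_def by blast
qed

section \<open>The split case: the place at which y has residue s, with s and -s distinct\<close>

context
  fixes s
  assumes s: "s \<in> Q" "F - s\<^sup>2 \<in> max_ideal Q" "s \<notin> max_ideal Q" and two: "2 \<in> Q" "2 \<notin> max_ideal Q"
begin

text \<open>Substituting s for y is multiplicative modulo the maximal ideal, because the error is a
  multiple of F - s^2. So \<open>split_ideal\<close> behaves as a prime ideal of \<open>Q[y]\<close>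
  with complement \<open>split_units\<close>.\<close>

lemma el_mult_residue:
  assumes "a \<in> Q" "b \<in> Q" "c \<in> Q" "d \<in> Q"
  shows "(a * c + b * d * F) + (a * d + b * c) * s \<in> max_ideal Q \<longleftrightarrow>
    (a + b * s) \<in> max_ideal Q \<or> (c + d * s) \<in> max_ideal Q"
proof -
  have e: "(a * c + b * d * F) + (a * d + b * c) * s = (a + b * s) * (c + d * s) + b * d * (F - s\<^sup>2)"
    by (simp add: algebra_simps power2_eq_square)
  have m: "b * d * (F - s\<^sup>2) \<in> max_ideal Q"
    using assms by (intro max_ideal_mult[OF Q_ring] s valuation_ring_mult[OF Q_ring])
  have q: "a + b * s \<in> Q" "c + d * s \<in> Q"
    using assms s by (auto intro!: valuation_ring_add[OF Q_ring] valuation_ring_mult[OF Q_ring])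
  have "(a + b * s) * (c + d * s) + b * d * (F - s\<^sup>2) \<in> max_ideal Q \<longleftrightarrow> (a + b * s) * (c + d * s) \<in> max_ideal Q"
    using max_ideal_add[OF Q_ring _ m] max_ideal_diff[OF Q_ring _ m] by (metis add_diff_cancel_right')
  also have "\<dots> \<longleftrightarrow> a + b * s \<in> max_ideal Q \<or> c + d * s \<in> max_ideal Q"
    using max_ideal_prime[OF Q_ring q] max_ideal_mult[OF Q_ring q(1)] max_ideal_mult2[OF Q_ring _ q(2)] by blast
  finally show ?thesis unfolding e .
qed

lemma el_mult_mem:
  assumes "a \<in> Q" "b \<in> Q" "c \<in> Q" "d \<in> Q"
  shows "a * c + b * d * F \<in> Q" "a * d + b * c \<in> Q"
  using assms F_mem by (auto intro!: valuation_ring_add[OF Q_ring] valuation_ring_mult[OF Q_ring])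

lemma split_ideal_mult: "z \<in> split_ideal s \<Longrightarrow> w \<in> split_ideal s \<union> split_units s \<Longrightarrow> z * w \<in> split_ideal s"
  using el_mult_residue el_mult_mem
  by (cases z rule: el_cases; cases w rule: el_cases)
    (auto simp: el_mem_split_ideal el_mem_split_units el_mult)

lemma split_units_mult: "z \<in> split_units s \<Longrightarrow> w \<in> split_units s \<Longrightarrow> z * w \<in> split_units s"
  using el_mult_residue el_mult_mem
  by (cases z rule: el_cases; cases w rule: el_cases)
    (auto simp: el_mem_split_units el_mult)

lemma split_Un_mult: "z \<in> split_ideal s \<union> split_units s \<Longrightarrow> w \<in> split_ideal s \<union> split_units s \<Longrightarrow>
    z * w \<in> split_ideal s \<union> split_units s"
  using el_mult_mem by (auto simp: split_Un el_mult) metis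

lemma split_Un_diff: "z \<in> split_ideal s \<union> split_units s \<Longrightarrow> w \<in> split_ideal s \<union> split_units s \<Longrightarrow>
    z - w \<in> split_ideal s \<union> split_units s"
  using valuation_ring_diff[OF Q_ring] by (auto simp: split_Un el_diff) metis

lemma split_units_nonzero: "z \<in> split_units s \<Longrightarrow> z \<noteq> 0"
  using max_ideal_zero[OF Q_ring] by (auto simp: split_units_def el_eq_0_iff)

lemma i_mem_split: "a \<in> Q \<Longrightarrow> i a \<in> split_ideal s \<union> split_units s"
  "a \<in> Q \<Longrightarrow> a \<notin> max_ideal Q \<Longrightarrow> i a \<in> split_units s"
  using el_mem_split_ideal[of a 0 s] el_mem_split_units[of a 0 s] valuation_ring_zero[OF Q_ring]
  by (auto simp: el_0)

lemma one_mem_split_units: "1 \<in> split_units s"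
  using i_mem_split(2)[of 1] valuation_ring_one[OF Q_ring] max_ideal_one[OF Q_ring] by (simp add: i_one)

lemma split_ringI: "u \<in> split_ideal s \<union> split_units s \<Longrightarrow> w \<in> split_units s \<Longrightarrow> u / w \<in> split_ring s"
  by (auto simp: split_ring_def)

lemma split_Un_mem: "u \<in> split_ideal s \<union> split_units s \<Longrightarrow> u \<in> split_ring s"
  using split_ringI[OF _ one_mem_split_units, of u] by simp

lemma split_units_unit: "u \<in> split_units s \<Longrightarrow> w \<in> split_units s \<Longrightarrow>
    u / w \<noteq> 0 \<and> u / w \<in> split_ring s \<and> inverse (u / w) \<in> split_ring s"
  using split_ringI[of u w] split_ringI[of w u] split_units_nonzero by auto

text \<open>If 1/u = v / w, then w = u v would belong to the ideal, although denominators lie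
  outside it.\<close>

lemma split_ideal_notin: "u \<in> split_ideal s \<Longrightarrow> u = 0 \<or> inverse u \<notin> split_ring s"
proof (rule ccontr)
  assume u: "u \<in> split_ideal s" and n: "\<not> (u = 0 \<or> inverse u \<notin> split_ring s)"
  then obtain v w where *: "inverse u = v / w" "v \<in> split_ideal s \<union> split_units s" "w \<in> split_units s"
    unfolding split_ring_def by blast
  then have "w = u * v" using n split_units_nonzero[of w] by (simp add: field_simps)
  then have "w \<in> split_ideal s" using split_ideal_mult u * by blast
  then show False using *(3) by (cases w rule: el_cases) (simp add: el_mem_split_ideal el_mem_split_units)
qed

lemma dvr_split_ring: "dvr (split_ring s) (i t)"
  unfolding dvr_def
proof (intro conjI ballI allI impI)
  fix z z' assume "z \<in> split_ring s" "z' \<in> split_ring s"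
  then obtain u w u' w' where *: "z = u / w" "u \<in> split_ideal s \<union> split_units s" "w \<in> split_units s"
     "z' = u' / w'" "u' \<in> split_ideal s \<union> split_units s" "w' \<in> split_units s"
    unfolding split_ring_def by blast
  have "z - z' = (u * w' - u' * w) / (w * w')" "z * z' = (u * u') / (w * w')"
    using * split_units_nonzero by (auto simp: field_simps)
  moreover have "(u * w' - u' * w) / (w * w') \<in> split_ring s" "(u * u') / (w * w') \<in> split_ring s"
    by (intro split_ringI split_Un_diff split_Un_mult split_units_mult * UnI2[OF *(3)] UnI2[OF *(6)])+
  ultimately show "z - z' \<in> split_ring s" "z * z' \<in> split_ring s" by auto
next
  have tm: "t \<in> max_ideal Q" using dvr_uniformizer[OF Q] by (simp add: max_ideal_def)
  then have it: "i t \<in> split_ideal s"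
    using el_mem_split_ideal[of t 0 s] max_ideal_mem[OF Q_ring] valuation_ring_zero[OF Q_ring] by (simp add: el_0)
  show "i t \<in> split_ring s" using it split_Un_mem by blast
  show "inverse (i t) \<notin> split_ring s" using split_ideal_notin[OF it] t_nz by (simp add: i_eq_0_iff)
  fix z :: 'K assume "z \<noteq> 0"
  then obtain n a b where ab: "a \<in> Q" "b \<in> Q" "a \<notin> max_ideal Q \<or> b \<notin> max_ideal Q" "z = i t powi n * el a b"
    by (rule primitive_part)
  show "\<exists>n u. u \<noteq> 0 \<and> u \<in> split_ring s \<and> inverse u \<in> split_ring s \<and> z = i t powi n * u"
  proof (cases "a + b * s \<in> max_ideal Q")
    case False
    then have "el a b \<in> split_units s" using ab by (simp add: el_mem_split_units)
    from split_units_unit[OF this one_mem_split_units] show ?thesis using ab(4) by auto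
  next
    case True
    \<comment> \<open>Otherwise a would lie in the maximal ideal too, against primitivity.\<close>
    have b: "b \<notin> max_ideal Q"
    proof
      assume b: "b \<in> max_ideal Q"
      then have "a + b * s - b * s \<in> max_ideal Q"
        by (intro max_ideal_diff[OF Q_ring True] max_ideal_mult2[OF Q_ring] s)
      then show False using ab b by simp
    qed
    \<comment> \<open>The conjugate of a primitive element of the prime ideal lies outside of it, so the element is
      associated to its norm, which is a power of the uniformizer times a unit.\<close>
    have u: "conj (el a b) \<in> split_units s"
      unfolding conj_el el_mem_split_units
    proof (intro conjI)
      show "a + - b * s \<notin> max_ideal Q"
      proof
        assume "a + - b * s \<in> max_ideal Q"
        from max_ideal_diff[OF Q_ring True this] have "2 * (b * s) \<in> max_ideal Q" by (simp add: algebra_simps)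
        then show False
          using max_ideal_prime[OF Q_ring] valuation_ring_mult[OF Q_ring] ab s two b by blast
      qed
    qed (use ab valuation_ring_uminus[OF Q_ring] in auto)
    have nz: "nrm (el a b) \<noteq> 0" using ab max_ideal_zero[OF Q_ring] by (auto simp: nrm_eq_0_iff el_eq_0_iff)
    obtain e where e: "e \<noteq> 0" "e \<in> Q" "inverse e \<in> Q" "nrm (el a b) = t powi valuation Q (nrm (el a b)) * e"
      by (rule valuation_eqE[OF Q nz])
    then have "i e \<in> split_units s" by (intro i_mem_split) (auto simp: max_ideal_def)
    note un = split_units_unit[OF this u]
    have "el a b = i (nrm (el a b)) / conj (el a b)"
      using mult_conj[of "el a b"] split_units_nonzero[OF u] by (simp add: field_simps)
    also have "\<dots> = i t powi valuation Q (nrm (el a b)) * (i e / conj (el a b))"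
      by (subst e(4)) (simp add: i_mult i_powi)
    finally have el: "el a b = i t powi valuation Q (nrm (el a b)) * (i e / conj (el a b))" .
    have "i t \<noteq> 0" using t_nz by (simp add: i_eq_0_iff)
    then have "i t powi (n + valuation Q (nrm (el a b))) * (i e / conj (el a b)) =
      i t powi n * (i t powi valuation Q (nrm (el a b)) * (i e / conj (el a b)))"
      by (simp add: power_int_add)
    also have "\<dots> = z" unfolding el[symmetric] ab(4) ..
    finally have "z = i t powi (n + valuation Q (nrm (el a b))) * (i e / conj (el a b))" ..
    then show ?thesis using un by blast
  qed
qed

lemma lies_over_split_ring: "lies_over (split_ring s) Q"
  unfolding lies_over_def
proof
  note V = dvr_valuation_ring[OF dvr_split_ring]
  show "valuation_ring (split_ring s)" by (rule V)
  have "Q \<subseteq> i -` split_ring s" using i_mem_split(1) split_Un_mem by blast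
  from dvr_maximal[OF Q valuation_ring_restrict[OF V] this] show "i -` split_ring s = Q" .
qed

text \<open>A denominator w = a + b y is congruent in \<open>W\<close> to the unit a + b s, hence
  invertible there. So the localization lies in \<open>W\<close>, and maximality applies.\<close>

lemma split_ring_minimal:
  assumes W: "lies_over W Q" and y: "y - i s \<in> max_ideal W"
  shows "W = split_ring s"
proof -
  have V: "valuation_ring W" using W by (simp add: lies_over_def)
  have "split_ring s \<subseteq> W"
  proof
    fix z assume "z \<in> split_ring s"
    then obtain u w where *: "z = u / w" "u \<in> split_ideal s \<union> split_units s" "w \<in> split_units s"
      unfolding split_ring_def by blast
    have u: "u \<in> W" using *(2) el_mem[OF W F_mem] by (auto simp: split_Un)
    obtain a b where w: "w = el a b" "a \<in> Q" "b \<in> Q" "a + b * s \<notin> max_ideal Q"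
      using *(3) by (auto simp: split_units_def)
    have "w - i (a + b * s) = i b * (y - i s)" by (simp add: w(1) el_def i_add i_mult algebra_simps)
    moreover have "i b * (y - i s) \<in> max_ideal W"
      using w(3) by (intro max_ideal_mult[OF V _ y]) (simp add: lies_overD[OF W])
    ultimately have wm: "w - i (a + b * s) \<in> max_ideal W" by simp
    have "w \<notin> max_ideal W"
    proof
      assume "w \<in> max_ideal W"
      from max_ideal_diff[OF V this wm] show False
        using w(4) lies_over_max_ideal[OF W] by simp
    qed
    moreover have "w \<in> W" using el_mem[OF W F_mem] w by simp
    ultimately have "inverse w \<in> W" using not_max_ideal_inverse[OF V] by blast
    then show "z \<in> W" using u valuation_ring_mult[OF V] by (simp add: *(1) divide_inverse)
  qed
  from dvr_maximal[OF dvr_split_ring V this] show ?thesis .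
qed

lemma split_ideal_max: "split_ideal s \<subseteq> max_ideal (split_ring s)"
  using split_ideal_notin split_Un_mem by (auto simp: max_ideal_def)

lemma y_minus_s: "y - i s \<in> max_ideal (split_ring s)"
proof -
  have "y - i s = el (- s) 1" by (simp add: el_def i_uminus i_one)
  then have "y - i s \<in> split_ideal s"
    using s valuation_ring_uminus[OF Q_ring] valuation_ring_one[OF Q_ring] max_ideal_zero[OF Q_ring]
    by (simp add: el_mem_split_ideal)
  then show ?thesis using split_ideal_max by blast
qed

lemma valuation_split_ring_i: "a \<noteq> 0 \<Longrightarrow> valuation (split_ring s) (i a) = valuation Q a"
proof -
  assume "a \<noteq> 0"
  then obtain u where u: "u \<noteq> 0" "u \<in> Q" "inverse u \<in> Q" "a = t powi valuation Q a * u"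
    by (rule valuation_eqE[OF Q])
  have "i a = i t powi valuation Q a * i u" by (subst u(4)) (simp add: i_mult i_powi)
  then show ?thesis using dvr_valuation[OF dvr_split_ring, of "i u"] u lies_overD[OF lies_over_split_ring]
    by (simp add: i_eq_0_iff flip: i_inverse)
qed

text \<open>The residue of u / w is the quotient e of the values at y = s; the difference u - e w
  then takes the value 0 at y = s and lies in the ideal.\<close>

lemma split_ring_residue: "z \<in> split_ring s \<Longrightarrow> \<exists>q\<in>Q. z - i q \<in> max_ideal (split_ring s)"
proof -
  assume "z \<in> split_ring s"
  then obtain u w where *: "z = u / w" "u \<in> split_ideal s \<union> split_units s" "w \<in> split_units s"
    unfolding split_ring_def by blast
  obtain a b where u: "u = el a b" "a \<in> Q" "b \<in> Q" using *(2) by (auto simp: split_Un)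
  obtain c d where w: "w = el c d" "c \<in> Q" "d \<in> Q" "c + d * s \<notin> max_ideal Q"
    using *(3) by (auto simp: split_units_def)
  note V = dvr_valuation_ring[OF dvr_split_ring]
  have cd: "c + d * s \<in> Q"
    using w s by (auto intro!: valuation_ring_add[OF Q_ring] valuation_ring_mult[OF Q_ring])
  define e where "e = (a + b * s) * inverse (c + d * s)"
  have e: "e \<in> Q"
    using u s not_max_ideal_inverse[OF Q_ring cd w(4)] unfolding e_def
    by (auto intro!: valuation_ring_add[OF Q_ring] valuation_ring_mult[OF Q_ring])
  have "c + d * s \<noteq> 0" using not_max_ideal_inverse[OF Q_ring cd w(4)] by blast
  then have "e * (c + d * s) = a + b * s" by (simp add: e_def)
  then have "(a - e * c) + (b - e * d) * s = 0" by (simp add: algebra_simps)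
  then have "u - i e * w \<in> split_ideal s"
    unfolding u(1) w(1) i_mult_el el_diff el_mem_split_ideal
    using u w e max_ideal_zero[OF Q_ring]
    by (auto intro!: valuation_ring_diff[OF Q_ring] valuation_ring_mult[OF Q_ring])
  then have "u - i e * w \<in> max_ideal (split_ring s)" using split_ideal_max by blast
  moreover have "inverse w \<in> split_ring s" using split_units_unit[OF one_mem_split_units *(3)]
    by (simp add: divide_inverse)
  ultimately have "(u - i e * w) * inverse w \<in> max_ideal (split_ring s)" by (rule max_ideal_mult2[OF V])
  moreover have "(u - i e * w) * inverse w = z - i e"
    using split_units_nonzero[OF *(3)] by (simp add: *(1) field_simps)
  ultimately show ?thesis using e by metis
qed

end

text \<open>In any place above \<open>Q\<close> the product (y - s)(y + s) = F - s^2 lies in the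
  maximal ideal, so y has residue s or -s. Both at once would put 2 s into the maximal ideal. The
  valuation formula comes from z times its conjugate being the norm, with conjugation exchanging the
  two places.\<close>

lemma split:
  assumes s: "s \<in> Q" "F - s\<^sup>2 \<in> max_ideal Q" "s \<notin> max_ideal Q" and two: "2 \<in> Q" "2 \<notin> max_ideal Q"
  obtains W W' where "W \<noteq> W'" "\<And>U. lies_over U Q \<longleftrightarrow> U = W \<or> U = W'" "dvr W (i t)" "dvr W' (i t)"
    "\<And>z. z \<noteq> 0 \<Longrightarrow> valuation Q (nrm z) = valuation W z + valuation W' z"
    "\<And>a. a \<noteq> 0 \<Longrightarrow> valuation W (i a) = valuation Q a" "\<And>a. a \<noteq> 0 \<Longrightarrow> valuation W' (i a) = valuation Q a"
    "\<And>z. z \<in> W \<Longrightarrow> \<exists>q\<in>Q. z - i q \<in> max_ideal W" "\<And>z. z \<in> W' \<Longrightarrow> \<exists>q\<in>Q. z - i q \<in> max_ideal W'"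
proof -
  have s': "- s \<in> Q" "F - (- s)\<^sup>2 \<in> max_ideal Q" "- s \<notin> max_ideal Q"
    using s valuation_ring_uminus[OF Q_ring] max_ideal_uminus[OF Q_ring, of "- s"] by auto
  note A = s two and B = s' two
  let ?W = "split_ring s" and ?W' = "split_ring (- s)"
  have V: "valuation_ring ?W" and V': "valuation_ring ?W'"
    using dvr_valuation_ring dvr_split_ring[OF A] dvr_split_ring[OF B] by blast+
  have neq: "?W \<noteq> ?W'"
  proof
    assume e: "?W = ?W'"
    have "y - i (- s) \<in> max_ideal ?W" unfolding e by (rule y_minus_s[OF B])
    from max_ideal_diff[OF V this y_minus_s[OF A]]
    have m: "(y - i (- s)) - (y - i s) \<in> max_ideal ?W" .
    have "(y - i (- s)) - (y - i s) = i (2 * s)"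
      unfolding i_uminus mult_2 i_add by (simp only: diff_diff_eq2 diff_minus_eq_add add_diff_cancel_left' add.assoc)
    from m[unfolded this] have "i (2 * s) \<in> max_ideal ?W" .
    then have "2 * s \<in> max_ideal Q" unfolding lies_over_max_ideal[OF lies_over_split_ring[OF A]] .
    from max_ideal_prime[OF Q_ring two(1) s(1) this] show False using s(3) two(2) by simp
  qed
  have lies: "lies_over U Q \<longleftrightarrow> U = ?W \<or> U = ?W'" for U
  proof
    assume U: "lies_over U Q"
    have VU: "valuation_ring U" using U by (simp add: lies_over_def)
    have "(y - i s) * (y - i (- s)) = i (F - s\<^sup>2)"
      by (simp add: i_diff i_power i_uminus algebra_simps flip: y_square) (simp add: power2_eq_square)
    then have "(y - i s) * (y - i (- s)) \<in> max_ideal U"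
      using lies_over_max_ideal[OF U] s(2) by simp
    moreover have "y - i s \<in> U" "y - i (- s) \<in> U"
      using y_mem[OF U F_mem] lies_overD[OF U] s(1) s'(1) by (auto intro!: valuation_ring_diff[OF VU])
    ultimately have "y - i s \<in> max_ideal U \<or> y - i (- s) \<in> max_ideal U"
      using max_ideal_prime[OF VU] by blast
    then show "U = ?W \<or> U = ?W'" using split_ring_minimal[OF A U] split_ring_minimal[OF B U] by blast
  qed (use lies_over_split_ring[OF A] lies_over_split_ring[OF B] in auto)
  have conj_val: "valuation ?W (conj z) = valuation ?W' z" if z: "z \<noteq> 0" for z
  proof -
    obtain u where u: "u \<noteq> 0" "u \<in> ?W'" "inverse u \<in> ?W'" "z = i t powi valuation ?W' z * u"
      by (rule valuation_eqE[OF dvr_split_ring[OF B] z])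
    have "conj z = i t powi valuation ?W' z * conj u"
      by (subst u(4)) (simp add: conj_mult conj_i flip: i_powi)
    moreover have "conj u \<noteq> 0" "conj u \<in> ?W" "inverse (conj u) \<in> ?W"
      using u conj_split_ring[of _ "- s"] by (auto simp: conj_eq_0_iff simp flip: conj_inverse)
    ultimately show ?thesis using dvr_valuation[OF dvr_split_ring[OF A]] by metis
  qed
  have val: "valuation Q (nrm z) = valuation ?W z + valuation ?W' z" if z: "z \<noteq> 0" for z
  proof -
    have "valuation Q (nrm z) = valuation ?W (z * conj z)"
      using valuation_split_ring_i[OF A, of "nrm z"] z by (simp add: mult_conj nrm_eq_0_iff)
    also have "\<dots> = valuation ?W z + valuation ?W (conj z)"
      using z by (simp add: valuation_mult[OF dvr_split_ring[OF A]] conj_eq_0_iff)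
    finally show ?thesis using conj_val[OF z] by simp
  qed
  show thesis
    by (rule that[OF neq lies dvr_split_ring[OF A] dvr_split_ring[OF B] val valuation_split_ring_i[OF A]
        valuation_split_ring_i[OF B] split_ring_residue[OF A] split_ring_residue[OF B]])
qed

end

section \<open>The function field of a hyperelliptic curve\<close>

text \<open>The generator of (p, b) divides p; were it associated to p, then p would divide b. The
  identity is used to invert denominators modulo p.\<close>

lemma poly_bezout:
  fixes p b :: "'k::field poly"
  assumes p: "monic_irreducible p" and b: "\<not> p dvd b"
  obtains u v where "u * p + v * b = 1"
proof -
  define I where "I = {u * p + v * b |u v. True}"
  have diff: "x - z \<in> I" if xz: "x \<in> I" "z \<in> I" for x z
  proof -
    obtain u v u' v' where "x = u * p + v * b" "z = u' * p + v' * b" using xz unfolding I_def by blast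
    then have "x - z = (u - u') * p + (v - v') * b" by (simp add: algebra_simps)
    then show ?thesis unfolding I_def by blast
  qed
  have mult: "x * z \<in> I" if z: "z \<in> I" for x z
  proof -
    obtain u v where "z = u * p + v * b" using z unfolding I_def by blast
    then have "x * z = (x * u) * p + (x * v) * b" by (simp add: algebra_simps)
    then show ?thesis unfolding I_def by blast
  qed
  have "p = 1 * p + 0 * b" "b = 0 * p + 1 * b" by simp_all
  then have pb: "p \<in> I" "b \<in> I" unfolding I_def by blast+
  have "p \<noteq> 0" using p by auto
  then obtain g where g: "g \<in> I" "lead_coeff g = 1" "\<And>a. a \<in> I \<Longrightarrow> g dvd a"
    using poly_ideal_principal[OF diff mult pb(1)] by blast
  obtain r where r: "p = g * r" using g(3)[OF pb(1)] by blast
  have "is_unit g \<or> is_unit r" using r p by (auto simp: comm_semiring_1_class.irreducible_def)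
  moreover have "\<not> is_unit r"
  proof
    assume "is_unit r"
    then have "p dvd g" unfolding r by (simp add: mult_unit_dvd_iff)
    then show False using g(3)[OF pb(2)] b dvd_trans by blast
  qed
  ultimately have "is_unit g" by blast
  then obtain c where "g = [:c:]" by (auto simp: is_unit_poly_iff)
  then have "g = 1" using g(2) by (simp add: one_pCons)
  then show thesis using g(1) that by (auto simp: I_def)
qed

locale hyperelliptic_function_field =
  fixes f :: "'k::field poly" and \<phi> :: "'k poly poly \<Rightarrow> 'K::field"
  assumes char: "CHAR('k) \<noteq> 2" and odd_degree: "odd (degree f)"
    and smooth: "smooth_affine_curve (hyperelliptic_poly f)"
    and function_field: "is_function_field_of \<phi> (hyperelliptic_poly f)"
begin

abbreviation "i \<equiv> embed_L \<phi>"
abbreviation "Y \<equiv> \<phi> [:0, 1:]"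

lemma phi_one: "\<phi> 1 = 1" and phi_add: "\<phi> (p + q) = \<phi> p + \<phi> q" and phi_mult: "\<phi> (p * q) = \<phi> p * \<phi> q"
  and phi_eq_0_iff: "\<phi> p = 0 \<longleftrightarrow> hyperelliptic_poly f dvd p"
  and phi_surj: "\<exists>p q. \<phi> q \<noteq> 0 \<and> z = \<phi> p / \<phi> q"
  using function_field unfolding is_function_field_of_def by auto

lemma phi_zero: "\<phi> 0 = 0"
  by (simp add: phi_eq_0_iff)

text \<open>The defining polynomial has degree 2 in y and cannot divide a nonzero polynomial in x
  alone; this is why k(x) embeds into K.\<close>

lemma phi_const_eq_0_iff: "\<phi> [:p:] = 0 \<longleftrightarrow> p = 0"
proof
  assume "\<phi> [:p:] = 0"
  then have d: "hyperelliptic_poly f dvd [:p:]" by (simp add: phi_eq_0_iff)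
  have "degree (hyperelliptic_poly f) = 2"
    by (simp add: hyperelliptic_poly_def power2_eq_square)
  then show "p = 0" using dvd_imp_degree_le[OF d] by (cases "p = 0") auto
qed (simp add: phi_zero)

lemma i_Fract:
  assumes "q \<noteq> 0" shows "i (Fract p q) = \<phi> [:p:] / \<phi> [:q:]"
  unfolding embed_L_def
proof (rule the_equality)
  fix z assume "\<exists>p' q'. q' \<noteq> 0 \<and> Fract p q = Fract p' q' \<and> z = \<phi> [:p':] / \<phi> [:q':]"
  then obtain p' q' where *: "q' \<noteq> 0" "Fract p q = Fract p' q'" "z = \<phi> [:p':] / \<phi> [:q':]" by blast
  then have "p * q' = p' * q" using assms by (simp add: eq_fract)
  then have "[:p:] * [:q':] = [:p':] * [:q:]" by (simp add: mult.commute)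
  then have "\<phi> [:p:] * \<phi> [:q':] = \<phi> [:p':] * \<phi> [:q:]" by (metis phi_mult)
  then show "z = \<phi> [:p:] / \<phi> [:q:]"
    using * assms by (simp add: phi_const_eq_0_iff frac_eq_eq)
qed (use assms in blast)

lemma i_poly: "i (Fract p 1) = \<phi> [:p:]"
  using i_Fract[of 1 p] phi_one by (simp add: one_pCons)

lemma i_hom: "i (a + b) = i a + i b" "i (a * b) = i a * i b" "i 1 = 1"
proof -
  obtain p q where a: "a = Fract p q" "q \<noteq> 0" by (cases a)
  obtain r s where b: "b = Fract r s" "s \<noteq> 0" by (cases b)
  have c: "[:u + v:] = [:u:] + [:v:]" "[:u * v:] = [:u:] * [:v:]" for u v :: "'k poly" by simp_all
  have nz: "\<phi> [:q:] \<noteq> 0" "\<phi> [:s:] \<noteq> 0" "q * s \<noteq> 0" using a b by (auto simp: phi_const_eq_0_iff)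
  show "i (a + b) = i a + i b" "i (a * b) = i a * i b"
    unfolding a(1) b(1) add_fract[OF a(2) b(2)] mult_fract
      i_Fract[OF a(2)] i_Fract[OF b(2)] i_Fract[OF nz(3)] c phi_add phi_mult
    using nz by (simp_all add: field_simps)
  show "i 1 = 1" using i_poly[of 1] phi_one by (simp add: One_fract_def one_pCons)
qed

lemma Y_square: "Y\<^sup>2 = i (Fract f 1)"
proof -
  have "\<phi> (hyperelliptic_poly f) = 0" by (simp add: phi_eq_0_iff)
  moreover have "\<phi> ([:0, 1:]\<^sup>2) = \<phi> (hyperelliptic_poly f + [:f:])" by (simp add: hyperelliptic_poly_def)
  moreover have "\<phi> ([:0, 1:]\<^sup>2) = Y\<^sup>2" by (simp only: power2_eq_square phi_mult)
  ultimately show ?thesis by (simp only: phi_add i_poly add_0)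
qed

lemma f_nonzero: "f \<noteq> 0"
  using odd_degree by auto

text \<open>The valuation of f at infinity is -deg f, an odd number.\<close>

lemma f_nonsquare: "a\<^sup>2 \<noteq> Fract f 1"
proof
  assume a: "a\<^sup>2 = Fract f 1"
  then have "a \<noteq> 0" using f_nonzero Fract_zero_iff[of f] by auto
  then have "2 * valuation place_at_infinity a = - int (degree f)"
    using valuation_power[OF dvr_place_at_infinity, of a 2] valuation_place_at_infinity[OF f_nonzero] a
    by simp
  then show False using odd_degree by presburger
qed

lemma f_norm_nonzero: "a\<^sup>2 - b\<^sup>2 * Fract f 1 = 0 \<Longrightarrow> a = 0 \<and> b = 0"
proof (cases "b = 0")
  case False
  assume "a\<^sup>2 - b\<^sup>2 * Fract f 1 = 0"
  then have "(a / b)\<^sup>2 = Fract f 1" using False by (simp add: power_divide field_simps)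
  then show ?thesis using f_nonsquare by blast
qed simp

text \<open>The set L + L y contains x, y and the constants and is closed under sums, products and
  inverses, hence contains every quotient of values of \<open>\<phi>\<close>.\<close>

lemma Y_generates: "\<exists>a b. z = i a + i b * Y"
proof -
  let ?G = "{i a + i b * Y |a b. True}"
  have mult: "w * z \<in> ?G" if wz: "w \<in> ?G" "z \<in> ?G" for w z
  proof -
    obtain a b where w: "w = i a + i b * Y" using wz(1) by blast
    moreover obtain c d where z: "z = i c + i d * Y" using wz(2) by blast
    ultimately have "w * z = i a * i c + i b * i d * Y\<^sup>2 + (i a * i d + i b * i c) * Y"
      by (simp add: algebra_simps power2_eq_square)
    also have "\<dots> = i (a * c + b * d * Fract f 1) + i (a * d + b * c) * Y"
      unfolding Y_square by (simp only: i_hom)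
    finally show ?thesis by blast
  qed
  have i0: "i 0 = 0" using i_poly[of 0] phi_zero by (simp add: Zero_fract_def)
  have "i a = i a + i 0 * Y" "Y = i 0 + i 1 * Y" for a using i0 i_hom(3) by simp_all
  then have iG: "i a \<in> ?G" and YG: "Y \<in> ?G" for a by blast+
  have inv: "inverse w \<in> ?G" if wG: "w \<in> ?G" "w \<noteq> 0" for w
  proof -
    obtain a b where w: "w = i a + i b * Y" using wG by blast
    have im: "i (- b) = - i b" using i_hom(1)[of b "- b"] i0 by (simp add: add_eq_0_iff)
    \<comment> \<open>This is the norm of w, nonzero since f is not a square; the inverse of w is
      its conjugate divided by n.\<close>
    define n where "n = a\<^sup>2 - b\<^sup>2 * Fract f 1"
    have n0: "n \<noteq> 0" using f_norm_nonzero[of a b] w wG i0 by (auto simp: n_def)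
    have "i n * i (inverse n) = 1" using n0 i_hom(2)[of n "inverse n"] i_hom(3) by simp
    have "i n + i (b\<^sup>2 * Fract f 1) = i (a\<^sup>2)" unfolding i_hom(1)[symmetric] n_def by simp
    then have "i n = i a * i a - i b * i b * i (Fract f 1)"
      unfolding power2_eq_square i_hom(2) by (simp add: algebra_simps)
    then have "i n = i a * i a - i b * i b * Y\<^sup>2" unfolding Y_square .
    then have "w * (i a + i (- b) * Y) = i n"
      by (simp add: w im algebra_simps power2_eq_square)
    then have "w * ((i a + i (- b) * Y) * i (inverse n)) = 1" using \<open>i n * i (inverse n) = 1\<close>
      by (subst mult.assoc[symmetric]) simp
    then have e: "inverse w = (i a + i (- b) * Y) * i (inverse n)" by (rule inverse_unique)
    have "i a + i (- b) * Y \<in> ?G" by blast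
    then show ?thesis unfolding e by (rule mult[OF _ iG])
  qed
  have add: "w + z \<in> ?G" if wz: "w \<in> ?G" "z \<in> ?G" for w z
  proof -
    obtain a b where w: "w = i a + i b * Y" using wz(1) by blast
    moreover obtain c d where z: "z = i c + i d * Y" using wz(2) by blast
    ultimately have "w + z = i (a + c) + i (b + d) * Y" by (simp add: i_hom algebra_simps)
    then show ?thesis by blast
  qed
  have phi: "\<phi> p \<in> ?G" for p
  proof (induction p)
    case 0
    then show ?case using iG[of 0] i0 phi_zero by simp
  next
    case (pCons c p)
    have "pCons c p = [:c:] + [:0, 1:] * p" by simp
    then have "\<phi> (pCons c p) = i (Fract c 1) + Y * \<phi> p" by (metis phi_add phi_mult i_poly)
    then show ?case using add[OF iG mult[OF YG pCons(2)]] by simp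
  qed
  obtain p q where "\<phi> q \<noteq> 0" "z = \<phi> p / \<phi> q" using phi_surj by blast
  then have "z \<in> ?G" using mult[OF phi inv[OF phi]] by (simp add: divide_inverse)
  then show ?thesis by blast
qed

sublocale quadratic_extension "embed_L \<phi>" "\<phi> [:0, 1:]" "Fract f 1"
  by unfold_locales (use i_hom Y_square Y_generates f_nonsquare in auto)

lemma const_K_eq: "const_K \<phi> a = i (const_L a)"
  by (simp add: const_K_def const_L_def i_poly)

text \<open>Multiplication by a + b y sends 1 to a + b y and y to b f + a y, with determinant a^2 -
  b^2 f.\<close>

lemma n_field_eq: "n_field \<phi> z = nrm z"
proof -
  obtain a b where z: "z = el a b" by (rule el_cases)
  have zY: "z * Y = el (b * Fract f 1) a"
    using el_mult[of a b 0 1] by (simp add: z el_0_1)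
  show ?thesis unfolding n_field_def zY
  proof (rule the_equality)
    show "\<exists>a' b' a'' b''. z = i a' + i b' * Y \<and> el (b * Fract f 1) a = i a'' + i b'' * Y \<and>
        nrm z = a' * b'' - b' * a''"
      by (rule exI[of _ a], rule exI[of _ b], rule exI[of _ "b * Fract f 1"], rule exI[of _ a])
        (simp add: z nrm_el power2_eq_square el_def[symmetric])
  next
    fix d assume "\<exists>a' b' a'' b''. z = i a' + i b' * Y \<and> el (b * Fract f 1) a = i a'' + i b'' * Y \<and>
        d = a' * b'' - b' * a''"
    then show "d = nrm z"
      by (auto simp: z nrm_el power2_eq_square el_eq_iff simp flip: el_def)
  qed
qed

lemma covering_eq: "covering \<phi> V = i -` V"
  by (simp add: covering_def)

lemma lies_over_covering: "V \<in> places (const_K \<phi>) \<Longrightarrow> lies_over V (covering \<phi> V)"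
  by (simp add: lies_over_def places_iff covering_eq)

lemma lies_over_place:
  assumes "lies_over V Q" "Q \<in> places const_L"
  shows "V \<in> places (const_K \<phi>)" "covering \<phi> V = Q"
  using assms by (auto simp: lies_over_def places_iff covering_eq const_K_eq)

lemma covering_place: "V \<in> places (const_K \<phi>) \<Longrightarrow> covering \<phi> V \<in> places const_L"
  using valuation_ring_restrict[of V] by (auto simp: places_iff covering_eq const_K_eq)

lemma inertia_degree_eq: "lies_over V Q \<Longrightarrow> inertia_degree \<phi> V = residue_dim (i ` Q) V"
  by (simp add: inertia_degree_def lies_over_def covering_eq)

lemma two_nonzero: "(2 :: 'k) \<noteq> 0"
proof
  assume "(2 :: 'k) = 0"
  then have "of_nat 2 = (0 :: 'k)" by simp
  then have "CHAR('k) dvd 2" by (simp only: of_nat_eq_0_iff_char_dvd)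
  then have "CHAR('k) = 1 \<or> CHAR('k) = 2" using two_is_prime_nat prime_nat_iff by blast
  then show False using char CHAR_not_1' by auto
qed

text \<open>A double factor p of f divides f and its derivative; the Jacobian identity at the points
  with y = 0 would then make p divide 1.\<close>

lemma f_squarefree:
  assumes p: "monic_irreducible p" and f: "f = p * g" shows "\<not> p dvd g"
proof
  assume "p dvd g"
  then have pf: "p dvd f" "p dvd pderiv f" using f by (auto simp: pderiv_mult)
  obtain A B C where "A * hyperelliptic_poly f + B * map_poly pderiv (hyperelliptic_poly f) +
      C * pderiv (hyperelliptic_poly f) = 1"
    using smooth unfolding smooth_affine_curve_def by blast
  then have "coeff (A * hyperelliptic_poly f + B * map_poly pderiv (hyperelliptic_poly f) +
      C * pderiv (hyperelliptic_poly f)) 0 = 1" by simp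
  \<comment> \<open>Setting y = 0 removes the third term, since the derivative with respect to y is
    2 y.\<close>
  then have "coeff A 0 * (- f) + coeff B 0 * (- pderiv f) = 1"
    by (simp add: hyperelliptic_poly_def coeff_mult_0 coeff_map_poly power2_eq_square pderiv_minus coeff_pderiv
        mult.commute)
  moreover have "p dvd coeff A 0 * (- f) + coeff B 0 * (- pderiv f)"
    using pf by (intro dvd_add dvd_mult) auto
  ultimately have "is_unit p" by simp
  then show False using p by (simp add: comm_semiring_1_class.irreducible_def)
qed

lemma dvr_extension_at:
  assumes p: "monic_irreducible p"
  shows "quadratic_extension_dvr (embed_L \<phi>) (\<phi> [:0, 1:]) (Fract f 1) (place_at p) (Fract p 1)"
  by unfold_locales (use dvr_place_at[OF p] Fract_mem_place_at[OF p] in auto)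

text \<open>The cases are p dividing f, f a nonzero square modulo p, and f not a square modulo p.
  The residue statements are carried along because inertia and place degrees are computed from
  them.\<close>

lemma places_over_cases:
  assumes p: "monic_irreducible p"
  obtains
    (ramified) W where "\<And>U. lies_over U (place_at p) \<longleftrightarrow> U = W" "\<exists>T. dvr W T"
      "\<And>z. z \<noteq> 0 \<Longrightarrow> valuation (place_at p) (nrm z) = valuation W z"
      "\<And>z. z \<in> W \<Longrightarrow> \<exists>q\<in>place_at p. z - i q \<in> max_ideal W"
  | (inert) W where "\<And>U. lies_over U (place_at p) \<longleftrightarrow> U = W" "\<exists>T. dvr W T"
      "\<And>z. z \<noteq> 0 \<Longrightarrow> valuation (place_at p) (nrm z) = 2 * valuation W z"
      "residue_dim (i ` place_at p) W = 2"
  | (split) W W' where "W \<noteq> W'" "\<And>U. lies_over U (place_at p) \<longleftrightarrow> U = W \<or> U = W'"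
      "\<exists>T. dvr W T" "\<exists>T. dvr W' T"
      "\<And>z. z \<noteq> 0 \<Longrightarrow> valuation (place_at p) (nrm z) = valuation W z + valuation W' z"
      "\<And>a. a \<noteq> 0 \<Longrightarrow> valuation W (i a) = valuation (place_at p) a"
      "\<And>a. a \<noteq> 0 \<Longrightarrow> valuation W' (i a) = valuation (place_at p) a"
      "\<And>z. z \<in> W \<Longrightarrow> \<exists>q\<in>place_at p. z - i q \<in> max_ideal W"
      "\<And>z. z \<in> W' \<Longrightarrow> \<exists>q\<in>place_at p. z - i q \<in> max_ideal W'"
proof -
  let ?Q = "place_at p" and ?F = "Fract f 1"
  interpret local: quadratic_extension_dvr "embed_L \<phi>" "\<phi> [:0, 1:]" "Fract f 1" "place_at p" "Fract p 1"
    by (rule dvr_extension_at[OF p])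
  note R = local.Q_ring
  consider "p dvd f" | s where "\<not> p dvd f" "s \<in> ?Q" "?F - s\<^sup>2 \<in> max_ideal ?Q"
    | "\<And>s. s \<in> ?Q \<Longrightarrow> ?F - s\<^sup>2 \<notin> max_ideal ?Q" by blast
  then show thesis
  proof cases
    case 1
    then obtain g where g: "f = p * g" by blast
    have g0: "Fract g 1 \<noteq> 0" "Fract p 1 \<noteq> 0" using g f_nonzero by (auto simp: Fract_zero_iff)
    have "Fract g 1 \<in> ?Q" "Fract g 1 \<notin> max_ideal ?Q"
      using Fract_mem_place_at[OF p] Fract_mem_max_ideal_place_at[OF p] f_squarefree[OF p g] by auto
    then have "valuation ?Q (Fract g 1) = 0"
      using mem_iff_valuation[OF local.Q g0(1)] max_ideal_iff_valuation[OF local.Q g0(1)] by simp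
    then have v: "valuation ?Q ?F = 1"
      using valuation_mult[OF local.Q g0(2,1)] valuation_uniformizer[OF local.Q] unfolding g Fract_mult_1 by simp
    have F0: "?F \<noteq> 0" using f_nonzero by (simp add: Fract_zero_iff)
    show ?thesis
      using ramified[OF local.ramified(2)[OF v F0] _ local.ramified(3)[OF v F0] local.ramified(4)[OF v F0]]
        local.ramified(1)[OF v F0] by blast
  next
    case (2 s)
    \<comment> \<open>If s vanished modulo p, so would f, which is congruent to s^2.\<close>
    have s: "s \<notin> max_ideal ?Q"
    proof
      assume s: "s \<in> max_ideal ?Q"
      then have "s\<^sup>2 \<in> max_ideal ?Q"
        using max_ideal_mult2[OF R s 2(2)] by (simp add: power2_eq_square)
      from max_ideal_add[OF R 2(3) this] show False using Fract_mem_max_ideal_place_at[OF p] 2(1) by simp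
    qed
    have e: "(2 :: 'k poly fract) = const_L 2"
    proof -
      have "(2 :: 'k poly fract) = 1 + 1" by simp
      also have "\<dots> = const_L 2" by (simp only: const_L_def One_fract_def) (simp add: one_pCons)
      finally show ?thesis .
    qed
    have "const_L 2 \<noteq> (0 :: 'k poly fract)" using two_nonzero by (simp add: const_L_def Fract_zero_iff)
    from mem_iff_valuation[OF local.Q this] max_ideal_iff_valuation[OF local.Q this]
    have two: "2 \<in> ?Q" "2 \<notin> max_ideal ?Q"
      using valuation_place_at_const[OF p two_nonzero] unfolding e by simp_all
    obtain W W' where W: "W \<noteq> W'" "\<And>U. lies_over U ?Q \<longleftrightarrow> U = W \<or> U = W'" "dvr W (i (Fract p 1))" "dvr W' (i (Fract p 1))"
    "\<And>z. z \<noteq> 0 \<Longrightarrow> valuation ?Q (nrm z) = valuation W z + valuation W' z"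
    "\<And>a. a \<noteq> 0 \<Longrightarrow> valuation W (i a) = valuation ?Q a" "\<And>a. a \<noteq> 0 \<Longrightarrow> valuation W' (i a) = valuation ?Q a"
    "\<And>z. z \<in> W \<Longrightarrow> \<exists>q\<in>?Q. z - i q \<in> max_ideal W" "\<And>z. z \<in> W' \<Longrightarrow> \<exists>q\<in>?Q. z - i q \<in> max_ideal W'"
      by (rule local.split[OF 2(2,3) s two]) blast
    show ?thesis using split[OF W(1,2) _ _ W(5-9)] W(3,4) by blast
  next
    case 3
    show ?thesis
      using inert[OF local.inert(2)[OF 3] _ local.inert(3)[OF 3] local.inert(4)[OF 3]]
        local.inert(1)[OF 3] by blast
  qed
qed

end

text \<open>Replacing y by c y replaces F by c^2 F and b by b / c, which leaves a^2 - b^2 F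
  unchanged. Results for a rescaled generator thus concern the same norm.\<close>

lemma (in quadratic_extension) rescale:
  assumes c: "c \<noteq> 0"
  shows "quadratic_extension i (i c * y) (c\<^sup>2 * F)"
    and "quadratic_extension.nrm i (i c * y) (c\<^sup>2 * F) z = nrm z"
proof -
  have "(i c * y)\<^sup>2 = i (c\<^sup>2 * F)"
    by (simp add: power_mult_distrib y_square i_mult i_power)
  moreover have e: "el a b = i a + i (b / c) * (i c * y)" for a b
    using c by (simp add: el_def i_divide i_eq_0_iff)
  moreover have "a\<^sup>2 \<noteq> c\<^sup>2 * F" for a
  proof
    assume "a\<^sup>2 = c\<^sup>2 * F"
    then have "(a / c)\<^sup>2 = F" using c by (simp add: power_divide)
    then show False using nonsquare by blast
  qed
  ultimately show q: "quadratic_extension i (i c * y) (c\<^sup>2 * F)"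
    by unfold_locales (use i_add i_mult i_one el_cases in \<open>metis\<close>)+
  interpret r: quadratic_extension i "i c * y" "c\<^sup>2 * F" by (rule q)
  obtain a b where z: "z = el a b" by (rule el_cases)
  then have "z = r.el a (b / c)" using e by (simp add: r.el_def)
  then have "r.nrm z = a\<^sup>2 - b\<^sup>2 * F" using c by (simp add: r.nrm_el power_divide)
  then show "r.nrm z = nrm z" using z nrm_el by simp
qed

lemma max_ideal_place_at_infinity:
  fixes r b :: "'k::field poly"
  assumes "b \<noteq> 0" and r: "r = 0 \<or> degree r < degree b"
  shows "Fract r b \<in> max_ideal place_at_infinity"
proof (cases "r = 0")
  case True
  then show ?thesis using max_ideal_zero[OF dvr_valuation_ring[OF dvr_place_at_infinity]]
    by (simp add: fract_collapse)
next
  case False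
  note Q = dvr_place_at_infinity[where 'k = 'k]
  have nz: "Fract r 1 \<noteq> 0" "Fract b 1 \<noteq> 0" using False assms by (simp_all add: Fract_zero_iff)
  have "valuation place_at_infinity (Fract r 1 / Fract b 1) > 0"
    unfolding valuation_divide[OF Q nz] valuation_place_at_infinity[OF False]
      valuation_place_at_infinity[OF assms(1)]
    using r False by simp
  moreover have "Fract r b = Fract r 1 / Fract b 1" using assms(1) by simp
  moreover have "Fract r 1 / Fract b 1 \<noteq> 0" using nz by (simp del: divide_fract)
  ultimately show ?thesis using max_ideal_iff_valuation[OF Q] by metis
qed

lemma residue_place_at_infinity:
  fixes q :: "'k::field poly fract"
  assumes "q \<in> place_at_infinity"
  obtains c where "q - const_L c \<in> max_ideal place_at_infinity"
proof -
  obtain a b where ab: "q = Fract a b" "b \<noteq> 0" "degree a \<le> degree b"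
    using assms by (auto simp: place_at_infinity_def)
  \<comment> \<open>The value of a / b at infinity; the coefficient is 0 when deg a < deg b.\<close>
  define c where "c = coeff a (degree b) / lead_coeff b"
  define r where "r = a - smult c b"
  have "coeff r (degree b) = 0" using ab(2) by (simp add: r_def c_def)
  moreover have "degree r \<le> degree b" using ab(3) unfolding r_def by (intro degree_diff_le) auto
  ultimately have r: "r = 0 \<or> degree r < degree b"
    by (metis eq_zero_or_degree_less)
  have "q - const_L c = Fract r b"
    using ab(2) by (simp add: ab(1) const_L_def r_def)
  then show thesis using that[of c] max_ideal_place_at_infinity[OF ab(2) r] by simp
qed

context hyperelliptic_function_field
begin

text \<open>Rescaling \<open>y\<close> by the power \<open>m + 1\<close> of \<open>1/x\<close>, where \<open>deg f = 2 m + 1\<close>, turns \<open>f\<close> into a uniformizer at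
  infinity, so that infinity is treated like a ramified finite place.\<close>

lemma place_at_infinity_extension:
  assumes W: "lies_over W place_at_infinity"
  shows "\<exists>T. dvr W T" "z \<noteq> 0 \<Longrightarrow> valuation W z = valuation place_at_infinity (nrm z)"
    "z \<in> W \<Longrightarrow> \<exists>q\<in>place_at_infinity. z - i q \<in> max_ideal W"
    "lies_over W' place_at_infinity \<Longrightarrow> W' = W"
proof -
  let ?X = "Fract [:0, 1 :: 'k:] 1"
  have Q: "dvr place_at_infinity (inverse ?X)" by (rule dvr_place_at_infinity)
  obtain m where m: "degree f = 2 * m + 1" using odd_degree by (elim oddE)
  define c where "c = inverse ?X ^ (m + 1)"
  have X: "?X \<noteq> 0" by (simp add: Fract_zero_iff)
  then have iX: "inverse ?X \<noteq> 0" by (rule nonzero_imp_inverse_nonzero)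
  then have c0: "c \<noteq> 0" unfolding c_def by (rule power_not_zero)
  have "valuation place_at_infinity (inverse ?X) = 1" by (rule valuation_uniformizer[OF Q])
  then have "valuation place_at_infinity c = int (m + 1)"
    unfolding c_def valuation_power[OF Q iX] by simp
  moreover have F0: "Fract f 1 \<noteq> 0" using f_nonzero by (simp add: Fract_zero_iff)
  moreover have "valuation place_at_infinity (Fract f 1) = - int (2 * m + 1)"
    using valuation_place_at_infinity[OF f_nonzero] m by simp
  \<comment> \<open>The valuation is 2 (m + 1) - (2 m + 1) = 1.\<close>
  ultimately have v: "valuation place_at_infinity (c\<^sup>2 * Fract f 1) = 1"
    using c0 by (simp add: valuation_mult[OF Q] valuation_power[OF Q])
  have F': "c\<^sup>2 * Fract f 1 \<noteq> 0" using c0 F0 by simp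
  have mem: "c\<^sup>2 * Fract f 1 \<in> place_at_infinity"
    using mem_iff_valuation[OF Q F'] v by simp
  interpret r: quadratic_extension "embed_L \<phi>" "embed_L \<phi> c * \<phi> [:0, 1:]" "c\<^sup>2 * Fract f 1"
    by (rule rescale(1)[OF c0])
  interpret r: quadratic_extension_dvr "embed_L \<phi>" "embed_L \<phi> c * \<phi> [:0, 1:]" "c\<^sup>2 * Fract f 1"
      place_at_infinity "inverse ?X"
    by unfold_locales (use Q mem in auto)
  note lies = r.ramified(2)[OF v F']
  have eq: "W = r.norm_ring" using W lies by blast
  show "\<exists>T. dvr W T" unfolding eq using r.ramified(1)[OF v F'] by blast
  show "z \<noteq> 0 \<Longrightarrow> valuation W z = valuation place_at_infinity (nrm z)"
    unfolding eq using r.ramified(3)[OF v F'] rescale(2)[OF c0] by simp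
  show "z \<in> W \<Longrightarrow> \<exists>q\<in>place_at_infinity. z - i q \<in> max_ideal W"
    unfolding eq using r.ramified(4)[OF v F'] by blast
  show "lies_over W' place_at_infinity \<Longrightarrow> W' = W" using lies eq by blast
qed

lemma places_cases:
  assumes V: "V \<in> places (const_K \<phi>)"
  obtains (affine) p where "monic_irreducible p" "lies_over V (place_at p)"
  | (infinity) "lies_over V place_at_infinity"
proof (cases "Fract [:0, 1:] 1 \<in> covering \<phi> V")
  case True
  then show ?thesis
    using affine place_of_rational_function_field_affine[OF covering_place[OF V]] lies_over_covering[OF V]
    by metis
next
  case False
  then show ?thesis
    using infinity place_of_rational_function_field_infinity(1)[OF covering_place[OF V]]
      lies_over_covering[OF V] by metis
qed

lemma lies_over_place_at:
  assumes "monic_irreducible p" "lies_over V (place_at p)"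
  shows "V \<in> places (const_K \<phi>)" "covering \<phi> V = place_at p"
  using lies_over_place[OF assms(2) place_at_places[OF assms(1)]] by auto

lemma places_dvr:
  assumes V: "V \<in> places (const_K \<phi>)" shows "\<exists>T. dvr V T"
  using V
proof (cases rule: places_cases)
  case (affine p)
  from affine(1) show ?thesis
  proof (cases rule: places_over_cases)
    case (ramified W)
    then show ?thesis using affine(2) ramified(1)[of V] by simp
  next
    case (inert W)
    then show ?thesis using affine(2) inert(1)[of V] by simp
  next
    case (split W W')
    then show ?thesis using affine(2) split(2)[of V] by auto
  qed
next
  case infinity
  then show ?thesis by (rule place_at_infinity_extension)
qed

section \<open>Degrees of places over the field of constants\<close>

lemma range_const_K:
  "1 \<in> range (const_K \<phi>)" "a \<in> range (const_K \<phi>) \<Longrightarrow> b \<in> range (const_K \<phi>) \<Longrightarrow> a - b \<in> range (const_K \<phi>)"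
  "a \<in> range (const_K \<phi>) \<Longrightarrow> b \<in> range (const_K \<phi>) \<Longrightarrow> a * b \<in> range (const_K \<phi>)"
  "a \<in> range (const_K \<phi>) \<Longrightarrow> inverse a \<in> range (const_K \<phi>)"
proof -
  have L: "const_L 1 = (1 :: 'k poly fract)" "const_L u - const_L v = const_L (u - v)"
    "const_L u * const_L v = const_L (u * v)" for u v :: 'k
    by (simp_all add: const_L_def One_fract_def one_pCons mult.commute)
  have inv: "inverse (const_L u) = const_L (inverse u)" for u :: 'k
  proof (cases "u = 0")
    case True
    then have "const_L u = 0" by (simp add: const_L_def Zero_fract_def)
    then show ?thesis using True by simp
  next
    case False
    then have "const_L u * const_L (inverse u) = 1" using L by simp
    then show ?thesis by (rule inverse_unique)
  qed
  show "1 \<in> range (const_K \<phi>)" using L(1) i_one by (metis const_K_eq rangeI)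
  assume "a \<in> range (const_K \<phi>)"
  then obtain u where u: "a = i (const_L u)" by (auto simp: const_K_eq)
  then show "inverse a \<in> range (const_K \<phi>)" using inv by (metis i_inverse const_K_eq rangeI)
  assume "b \<in> range (const_K \<phi>)"
  then obtain v where v: "b = i (const_L v)" by (auto simp: const_K_eq)
  have "a - b = const_K \<phi> (u - v)" "a * b = const_K \<phi> (u * v)"
    by (simp_all add: u v const_K_eq L(2,3)[symmetric] i_diff i_mult)
  then show "a - b \<in> range (const_K \<phi>)" "a * b \<in> range (const_K \<phi>)" by auto
qed

text \<open>Infinity is ramified, so the residue field is that of the point at infinity of the line,
  namely k. A point of even degree is therefore finite.\<close>

lemma place_degree_infinity:
  assumes W: "lies_over W place_at_infinity" shows "place_degree (const_K \<phi>) W = 1"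
proof -
  have V: "valuation_ring W" using W by (simp add: lies_over_def)
  have const: "const_L a \<in> place_at_infinity" for a :: 'k
    unfolding place_at_infinity_def const_L_def by force
  show ?thesis unfolding place_degree_def
  proof (rule residue_dim_eq_1[OF V])
    show "range (const_K \<phi>) \<subseteq> W" using lies_overD[OF W] const by (auto simp: const_K_eq)
    fix z assume "z \<in> W"
    then obtain q where q: "q \<in> place_at_infinity" "z - i q \<in> max_ideal W"
      using place_at_infinity_extension(3)[OF W] by blast
    obtain c where "q - const_L c \<in> max_ideal place_at_infinity"
      using residue_place_at_infinity[OF q(1)] .
    then have "i q - i (const_L c) \<in> max_ideal W" using lies_over_max_ideal[OF W] by (simp flip: i_diff)
    from max_ideal_add[OF V q(2) this] have "z - const_K \<phi> c \<in> max_ideal W" by (simp add: const_K_eq)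
    then show "\<exists>s\<in>range (const_K \<phi>). z - s \<in> max_ideal W" by blast
  qed (use range_const_K in auto)
qed

text \<open>Translates linear combinations of powers of x into polynomials. The shift m serves the
  induction over the coefficients, and \<open>take n\<close> accounts for surplus ones.\<close>

lemma sum_list_powers:
  "sum_list (map2 (*) (map (const_K \<phi>) cs) (map (\<lambda>j. i (Fract ([:0, 1:] ^ (j + m)) 1)) [0..<n])) =
     i (Fract ([:0, 1:] ^ m * Poly (take n cs)) 1)"
proof (induction cs arbitrary: n m)
  case Nil
  then show ?case using i_zero by (simp add: Zero_fract_def)
next
  case (Cons c cs)
  show ?case
  proof (cases n)
    case 0
    then show ?thesis using i_zero by (simp add: Zero_fract_def)
  next
    case (Suc k)
    have "map (\<lambda>j. i (Fract ([:0, 1:] ^ (j + m)) 1)) [0..<n] = i (Fract ([:0, 1:] ^ m) 1) #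
       map (\<lambda>j. i (Fract ([:0, 1:] ^ (j + Suc m)) 1)) [0..<k]"
      unfolding Suc map_upt_Suc by simp
    then have "sum_list (map2 (*) (map (const_K \<phi>) (c # cs)) (map (\<lambda>j. i (Fract ([:0, 1:] ^ (j + m)) 1)) [0..<n])) =
       i (const_L c * Fract ([:0, 1:] ^ m) 1) + i (Fract ([:0, 1:] ^ Suc m * Poly (take k cs)) 1)"
      using Cons.IH[of "Suc m" k] const_K_eq[of c] by (simp add: i_mult)
    also have "\<dots> = i (Fract ([:c:] * [:0, 1:] ^ m + [:0, 1:] ^ Suc m * Poly (take k cs)) 1)"
      unfolding const_L_def i_add[symmetric] Fract_mult_1[symmetric] Fract_add_1[symmetric] ..
    also have "[:c:] * [:0, 1:] ^ m + [:0, 1:] ^ Suc m * Poly (take k cs) =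
        [:0, 1:] ^ m * ([:c:] + [:0, 1:] * Poly (take k cs))"
      by (simp only: algebra_simps power_Suc)
    also have "[:c:] + [:0, 1:] * Poly (take k cs) = Poly (take n (c # cs))"
      by (simp add: Suc)
    finally show ?thesis .
  qed
qed

lemma degree_Poly_less: "Poly cs \<noteq> 0 \<Longrightarrow> degree (Poly cs) < length cs"
proof -
  assume "Poly cs \<noteq> 0"
  then have "coeff (Poly cs) (degree (Poly cs)) \<noteq> 0" by (simp only: leading_coeff_0_iff not_False_eq_True)
  then have "nth_default 0 cs (degree (Poly cs)) \<noteq> 0" unfolding coeff_Poly_eq .
  then show ?thesis by (auto simp: nth_default_def split: if_splits)
qed

text \<open>If the residue field of \<open>W\<close> is that of p, then 1, x, ..., x^(deg p - 1) is
  a basis over k. For an inert prime n(P) = p^2 has even degree in any case.\<close>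

lemma place_degree_affine:
  assumes p: "monic_irreducible p" and W: "lies_over W (place_at p)"
    and residue: "\<And>z. z \<in> W \<Longrightarrow> \<exists>q\<in>place_at p. z - i q \<in> max_ideal W"
  shows "place_degree (const_K \<phi>) W = degree p"
proof -
  let ?bs = "map (\<lambda>j. i (Fract ([:0, 1:] ^ (j + 0)) 1)) [0..<degree p]"
  have V: "valuation_ring W" using W by (simp add: lies_over_def)
  have R: "valuation_ring (place_at p)" by (rule dvr_valuation_ring[OF dvr_place_at[OF p]])
  have poly: "i (Fract a 1) \<in> W" for a using lies_overD[OF W] Fract_mem_place_at[OF p] by blast
  have poly_max: "i (Fract a 1) \<in> max_ideal W \<longleftrightarrow> p dvd a" for a
    using lies_over_max_ideal[OF W] Fract_mem_max_ideal_place_at[OF p] by blast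
  have "residue_dim (range (const_K \<phi>)) W = length ?bs"
  proof (rule residue_dim_eq_length[OF V])
    show "range (const_K \<phi>) \<subseteq> W" using poly by (auto simp: const_K_eq const_L_def)
    show "set ?bs \<subseteq> W" using poly by auto
    fix z assume "z \<in> W"
    then obtain q where q: "q \<in> place_at p" "z - i q \<in> max_ideal W" using residue by blast
    obtain a b where ab: "q = Fract a b" "\<not> p dvd b" using q(1) by (auto simp: place_at_def)
    have b0: "b \<noteq> 0" using ab by auto
    obtain u v where uv: "u * p + v * b = 1" using poly_bezout[OF p ab(2)] .
    \<comment> \<open>Modulo p, v is an inverse of b, so a / b is congruent to a v; the remainder
      has few enough coefficients for the given basis.\<close>
    define r where "r = (a * v) mod p"
    have "Fract a b - Fract r 1 = Fract a b * Fract (u * p) 1 + Fract (a * v - r) 1"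
    proof -
      have "a - r * b = a * (u * p + v * b) - r * b" by (simp add: uv)
      also have "\<dots> = a * (u * p) + (a * v - r) * b" by (simp add: algebra_simps)
      finally show ?thesis using b0 by (simp add: eq_fract algebra_simps)
    qed
    moreover have "p dvd a * v - r" by (simp add: r_def)
    ultimately have "q - Fract r 1 \<in> max_ideal (place_at p)"
      using Fract_mem_max_ideal_place_at[OF p, of "u * p"] Fract_mem_max_ideal_place_at[OF p, of "a * v - r"] q(1)
      by (auto simp: ab(1) simp del: mult_fract intro!: max_ideal_add[OF R] max_ideal_mult[OF R])
    then have "i q - i (Fract r 1) \<in> max_ideal W" using lies_over_max_ideal[OF W] by (simp flip: i_diff)
    from max_ideal_add[OF V q(2) this] have zr: "z - i (Fract r 1) \<in> max_ideal W" by simp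
    have "degree p > 0"
      using p is_unit_iff_degree[of p] by (auto simp: comm_semiring_1_class.irreducible_def)
    moreover then have "p \<noteq> 0" by auto
    ultimately have "r = 0 \<or> degree r < degree p"
      using degree_mod_less[of p "a * v"] unfolding r_def by auto
    then have "length (coeffs r) \<le> degree p" by (cases "r = 0") (auto simp: length_coeffs_degree)
    then have "sum_list (map2 (*) (map (const_K \<phi>) (coeffs r)) ?bs) = i (Fract r 1)"
      unfolding sum_list_powers by simp
    then show "\<exists>ss. set ss \<subseteq> range (const_K \<phi>) \<and> z - sum_list (map2 (*) ss ?bs) \<in> max_ideal W"
      using zr by (intro exI[of _ "map (const_K \<phi>) (coeffs r)"]) auto
  next
    fix ss assume ss: "set ss \<subseteq> range (const_K \<phi>)" "sum_list (map2 (*) ss ?bs) \<in> max_ideal W"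
    have "\<forall>s\<in>set ss. \<exists>c. s = const_K \<phi> c" using ss(1) by auto
    then have "\<exists>cs. ss = map (const_K \<phi>) cs" by (simp only: ex_map_conv)
    then obtain cs where cs: "ss = map (const_K \<phi>) cs" by blast
    have d: "p dvd Poly (take (degree p) cs)"
      using ss(2) unfolding cs sum_list_powers by (simp add: poly_max)
    have "degree (Poly (take (degree p) cs)) < degree p" if "Poly (take (degree p) cs) \<noteq> 0"
      using degree_Poly_less[OF that] by simp
    \<comment> \<open>A multiple of p of degree less than deg p vanishes, so all coefficients used
      are 0.\<close>
    then have "Poly (take (degree p) cs) = 0" using dvd_imp_degree_le[OF d] by linarith
    then obtain n where "take (degree p) cs = replicate n 0" by (auto simp: Poly_eq_0)
    then have "set (take (length ?bs) ss) \<subseteq> {const_K \<phi> 0}" by (auto simp: cs take_map)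
    moreover have "const_K \<phi> 0 = 0" by (simp add: const_K_def phi_zero)
    ultimately show "set (take (length ?bs) ss) \<subseteq> max_ideal W" using max_ideal_zero[OF V] by auto
  qed (use range_const_K in auto)
  then show ?thesis by (simp add: place_degree_def)
qed

section \<open>Finiteness of the support of a principal divisor\<close>

lemma finite_lies_over: "monic_irreducible p \<Longrightarrow> finite {V. lies_over V (place_at p)}"
proof -
  assume "monic_irreducible p"
  then show ?thesis
  proof (cases rule: places_over_cases)
    case (split W W')
    then have "{V. lies_over V (place_at p)} = {W, W'}" by auto
    then show ?thesis by simp
  qed simp_all
qed

text \<open>At a prime dividing neither the denominators of the coordinates of z nor the numerator
  or denominator of its norm, z and its inverse, the conjugate divided by the norm, are both
  regular. Finitely many primes and infinity remain, each with finitely many places above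
  it.\<close>

lemma finite_support:
  assumes z: "z \<noteq> 0" shows "finite {V \<in> places (const_K \<phi>). valuation V z \<noteq> 0}"
proof -
  obtain a b where ab: "z = el a b" by (rule el_cases)
  obtain a1 a2 where a: "a = Fract a1 a2" "a2 \<noteq> 0" by (cases a)
  obtain b1 b2 where b: "b = Fract b1 b2" "b2 \<noteq> 0" by (cases b)
  have n0: "nrm z \<noteq> 0" using z by (simp add: nrm_eq_0_iff)
  then obtain n1 n2 where n: "nrm z = Fract n1 n2" "n1 \<noteq> 0" "n2 \<noteq> 0" by (rule fract_cases_nonzero)
  define B where "B = {p. monic_irreducible p \<and> p dvd a2 * b2 * n1 * n2}"
  have "{V \<in> places (const_K \<phi>). valuation V z \<noteq> 0} \<subseteq>
    {V. lies_over V place_at_infinity} \<union> (\<Union>p\<in>B. {V. lies_over V (place_at p)})"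
  proof
    fix V assume "V \<in> {V \<in> places (const_K \<phi>). valuation V z \<noteq> 0}"
    then have V: "V \<in> places (const_K \<phi>)" "valuation V z \<noteq> 0" by auto
    from V(1) show "V \<in> {V. lies_over V place_at_infinity} \<union> (\<Union>p\<in>B. {V. lies_over V (place_at p)})"
    proof (cases rule: places_cases)
      case (affine p)
      have "p \<in> B"
      proof (rule ccontr)
        assume "p \<notin> B"
        then have "\<not> p dvd a2 * b2 * n1 * n2" using affine by (auto simp: B_def)
        then have np: "\<not> p dvd a2" "\<not> p dvd b2" "\<not> p dvd n1" "\<not> p dvd n2" by (auto intro: dvd_mult dvd_mult2)
        have v: "valuation_ring V" using affine(2) by (simp add: lies_over_def)
        have F: "Fract f 1 \<in> place_at p" by (rule Fract_mem_place_at[OF affine(1)])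
        have "a \<in> place_at p" "b \<in> place_at p" "inverse (nrm z) \<in> place_at p"
          using np a b n by (auto intro: place_atI)
        moreover from this have "- b \<in> place_at p"
          using valuation_ring_uminus[OF dvr_valuation_ring[OF dvr_place_at[OF affine(1)]]] by blast
        ultimately have m: "z \<in> V" "conj z \<in> V" "i (inverse (nrm z)) \<in> V"
          using el_mem[OF affine(2) F] lies_overD[OF affine(2)] by (auto simp: ab conj_el)
        have "i (nrm z) \<noteq> 0" using n0 by (simp add: i_eq_0_iff)
        then have "z * (conj z * i (inverse (nrm z))) = 1"
          using mult_conj[of z] by (simp add: i_inverse flip: mult.assoc)
        then have "inverse z = conj z * i (inverse (nrm z))" by (rule inverse_unique)
        then have "inverse z \<in> V" using m valuation_ring_mult[OF v] by simp
        moreover obtain T where "dvr V T" using places_dvr[OF V(1)] by blast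
        ultimately show False using V(2) m(1) unit_iff_valuation[of V T z] z by blast
      qed
      then show ?thesis using affine by blast
    qed blast
  qed
  moreover have "finite {V. lies_over V place_at_infinity}"
  proof (cases "\<exists>W. lies_over W place_at_infinity")
    case True
    then obtain W where "lies_over W place_at_infinity" by blast
    then have "{V. lies_over V place_at_infinity} \<subseteq> {W}" using place_at_infinity_extension(4) by blast
    then show ?thesis by (rule finite_subset) simp
  qed simp
  moreover have "finite (\<Union>p\<in>B. {V. lies_over V (place_at p)})"
    using finite_monic_irreducible_factors[of "a2 * b2 * n1 * n2"] a b n finite_lies_over
    by (auto simp: B_def)
  ultimately show ?thesis using finite_subset by blast
qed

section \<open>Divisibility by 2 in the Picard group\<close>

lemma lookup_principal_divisor:
  assumes "z \<noteq> 0"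
  shows "Poly_Mapping.lookup (principal_divisor (const_K \<phi>) z) V =
    (if V \<in> places (const_K \<phi>) then valuation V z else 0)"
proof -
  have "{V. (if V \<in> places (const_K \<phi>) then valuation V z else 0) \<noteq> 0} =
      {V \<in> places (const_K \<phi>). valuation V z \<noteq> 0}" by auto
  then show ?thesis using finite_support[OF assms] by (simp add: principal_divisor_def)
qed

lemma keys_principal_divisor:
  "z \<noteq> 0 \<Longrightarrow> Poly_Mapping.keys (principal_divisor (const_K \<phi>) z) \<subseteq> places (const_K \<phi>)"
  by (auto simp: in_keys_iff lookup_principal_divisor split: if_splits)

lemma principal_divisor_mult:
  assumes "z \<noteq> 0" "w \<noteq> 0"
  shows "principal_divisor (const_K \<phi>) (z * w) = principal_divisor (const_K \<phi>) z + principal_divisor (const_K \<phi>) w"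
proof (rule poly_mapping_eqI)
  fix V
  show "Poly_Mapping.lookup (principal_divisor (const_K \<phi>) (z * w)) V =
    Poly_Mapping.lookup (principal_divisor (const_K \<phi>) z + principal_divisor (const_K \<phi>) w) V"
  proof (cases "V \<in> places (const_K \<phi>)")
    case True
    then obtain T where "dvr V T" using places_dvr by blast
    then show ?thesis using True assms valuation_mult[of V T z w]
      by (simp add: lookup_principal_divisor lookup_add)
  qed (use assms in \<open>simp add: lookup_principal_divisor lookup_add\<close>)
qed

lemma subgroup_principal_divisors:
  "subgroup (principal_divisors (const_K \<phi>)) (Div (const_K \<phi>))"
proof -
  interpret group "Div (const_K \<phi>)" unfolding Div_def by (rule group_free_Abelian_group)
  have one: "principal_divisor (const_K \<phi>) 1 = 0"
    using principal_divisor_mult[of 1 1] by simp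
  show ?thesis
  proof (rule subgroupI)
    show "principal_divisors (const_K \<phi>) \<subseteq> carrier (Div (const_K \<phi>))"
      using keys_principal_divisor by (auto simp: principal_divisors_def Div_def)
    show "principal_divisors (const_K \<phi>) \<noteq> {}"
      using one_neq_zero[where 'a = 'K] unfolding principal_divisors_def by blast
  next
    fix a assume "a \<in> principal_divisors (const_K \<phi>)"
    then obtain z where z: "z \<noteq> 0" "a = principal_divisor (const_K \<phi>) z" by (auto simp: principal_divisors_def)
    then have "- a = principal_divisor (const_K \<phi>) (inverse z)"
      using principal_divisor_mult[of z "inverse z"] one by (simp add: eq_neg_iff_add_eq_0 add.commute minus_unique)
    moreover have "inv\<^bsub>Div (const_K \<phi>)\<^esub> a = - a"
      using z keys_principal_divisor by (simp add: Div_def)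
    ultimately show "inv\<^bsub>Div (const_K \<phi>)\<^esub> a \<in> principal_divisors (const_K \<phi>)"
      using z by (auto simp: principal_divisors_def)
  next
    fix a b assume "a \<in> principal_divisors (const_K \<phi>)" "b \<in> principal_divisors (const_K \<phi>)"
    then obtain z w where zw: "z \<noteq> 0" "a = principal_divisor (const_K \<phi>) z" "w \<noteq> 0"
      "b = principal_divisor (const_K \<phi>) w" by (auto simp: principal_divisors_def)
    then have "a \<otimes>\<^bsub>Div (const_K \<phi>)\<^esub> b = principal_divisor (const_K \<phi>) (z * w)"
      by (simp add: Div_def principal_divisor_mult)
    then show "a \<otimes>\<^bsub>Div (const_K \<phi>)\<^esub> b \<in> principal_divisors (const_K \<phi>)"
      using zw by (auto simp: principal_divisors_def)
  qed
qed

text \<open>The class of P is twice that of E iff P = div z + 2 E for some z. Such an E exists iff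
  all coefficients of P - div z are even, which turns the claim into one about parities of
  valuations.\<close>

lemma divisor_class_in_two_Pic_iff:
  assumes P: "P \<in> places (const_K \<phi>)"
  shows "divisor_class (const_K \<phi>) (frag_of P) \<in> two_Pic (const_K \<phi>) \<longleftrightarrow>
    (\<exists>z. z \<noteq> 0 \<and> (\<forall>V\<in>places (const_K \<phi>). even (valuation V z - (if V = P then 1 else 0))))"
proof -
  let ?D = "Div (const_K \<phi>)" and ?H = "principal_divisors (const_K \<phi>)"
  interpret D: comm_group ?D unfolding Div_def by (rule abelian_free_Abelian_group)
  note H = subgroup_principal_divisors
  interpret H: normal ?H ?D by (rule D.subgroup_imp_normal[OF H])
  interpret Pic: group "Pic (const_K \<phi>)" unfolding Pic_def by (rule H.factorgroup_is_group)
  have FP: "frag_of P \<in> carrier ?D" using P by (simp add: Div_def)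
  have square: "(?H #>\<^bsub>?D\<^esub> E) [^]\<^bsub>Pic (const_K \<phi>)\<^esub> (2::nat) = ?H #>\<^bsub>?D\<^esub> (E + E)" if "E \<in> carrier ?D" for E
  proof -
    have C: "?H #>\<^bsub>?D\<^esub> E \<in> carrier (Pic (const_K \<phi>))"
      using that by (auto simp: Pic_def FactGroup_def RCOSETS_def)
    then have "(?H #>\<^bsub>?D\<^esub> E) [^]\<^bsub>Pic (const_K \<phi>)\<^esub> (2::nat) =
        (?H #>\<^bsub>?D\<^esub> E) \<otimes>\<^bsub>Pic (const_K \<phi>)\<^esub> (?H #>\<^bsub>?D\<^esub> E)"
      by (simp add: numeral_2_eq_2)
    also have "\<dots> = ?H #>\<^bsub>?D\<^esub> (E \<otimes>\<^bsub>?D\<^esub> E)" using H.rcos_sum[OF that that] by (simp add: Pic_def FactGroup_def)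
    finally show ?thesis by (simp add: Div_def)
  qed
  have "divisor_class (const_K \<phi>) (frag_of P) \<in> two_Pic (const_K \<phi>) \<longleftrightarrow>
      (\<exists>E\<in>carrier ?D. ?H #>\<^bsub>?D\<^esub> frag_of P = ?H #>\<^bsub>?D\<^esub> (E + E))"
  proof
    assume "divisor_class (const_K \<phi>) (frag_of P) \<in> two_Pic (const_K \<phi>)"
    then obtain C where C: "C \<in> carrier (Pic (const_K \<phi>))"
      "?H #>\<^bsub>?D\<^esub> frag_of P = C [^]\<^bsub>Pic (const_K \<phi>)\<^esub> (2::nat)"
      by (auto simp: two_Pic_def divisor_class_def)
    then obtain E where "E \<in> carrier ?D" "C = ?H #>\<^bsub>?D\<^esub> E"
      by (auto simp: Pic_def FactGroup_def RCOSETS_def)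
    then show "\<exists>E\<in>carrier ?D. ?H #>\<^bsub>?D\<^esub> frag_of P = ?H #>\<^bsub>?D\<^esub> (E + E)" using C square by auto
  next
    assume "\<exists>E\<in>carrier ?D. ?H #>\<^bsub>?D\<^esub> frag_of P = ?H #>\<^bsub>?D\<^esub> (E + E)"
    then obtain E where E: "E \<in> carrier ?D" "?H #>\<^bsub>?D\<^esub> frag_of P = ?H #>\<^bsub>?D\<^esub> (E + E)" by blast
    moreover have "?H #>\<^bsub>?D\<^esub> E \<in> carrier (Pic (const_K \<phi>))"
      using E by (auto simp: Pic_def FactGroup_def RCOSETS_def)
    ultimately show "divisor_class (const_K \<phi>) (frag_of P) \<in> two_Pic (const_K \<phi>)"
      using square[OF E(1)] unfolding two_Pic_def divisor_class_def by blast
  qed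
  also have "\<dots> \<longleftrightarrow> (\<exists>E\<in>carrier ?D. \<exists>z. z \<noteq> 0 \<and> frag_of P = principal_divisor (const_K \<phi>) z + (E + E))"
  proof (intro bex_cong refl)
    fix E assume E: "E \<in> carrier ?D"
    then have EE: "E + E \<in> carrier ?D" using D.m_closed[OF E E] by (simp add: Div_def)
    \<comment> \<open>Two cosets of a subgroup agree iff a representative of one lies in the
      other.\<close>
    have "?H #>\<^bsub>?D\<^esub> frag_of P = ?H #>\<^bsub>?D\<^esub> (E + E) \<longleftrightarrow> frag_of P \<in> ?H #>\<^bsub>?D\<^esub> (E + E)"
      using D.repr_independence[OF _ EE H] D.rcos_self[OF FP H] by metis
    also have "\<dots> \<longleftrightarrow> (\<exists>z. z \<noteq> 0 \<and> frag_of P = principal_divisor (const_K \<phi>) z + (E + E))"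
      by (auto simp: r_coset_def principal_divisors_def Div_def)
    finally show "?H #>\<^bsub>?D\<^esub> frag_of P = ?H #>\<^bsub>?D\<^esub> (E + E) \<longleftrightarrow>
      (\<exists>z. z \<noteq> 0 \<and> frag_of P = principal_divisor (const_K \<phi>) z + (E + E))" .
  qed
  also have "\<dots> \<longleftrightarrow> (\<exists>z. z \<noteq> 0 \<and> (\<forall>V\<in>places (const_K \<phi>). even (valuation V z - (if V = P then 1 else 0))))"
  proof
    assume "\<exists>E\<in>carrier ?D. \<exists>z. z \<noteq> 0 \<and> frag_of P = principal_divisor (const_K \<phi>) z + (E + E)"
    then obtain E z where z: "z \<noteq> 0" "frag_of P = principal_divisor (const_K \<phi>) z + (E + E)" by blast
    have "even (valuation V z - (if V = P then 1 else 0))" if "V \<in> places (const_K \<phi>)" for V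
    proof -
      have "(if V = P then 1 else 0) = valuation V z + 2 * Poly_Mapping.lookup E V"
        using arg_cong[OF z(2), of "\<lambda>E. Poly_Mapping.lookup E V"] that z(1)
        by (simp add: lookup_add lookup_principal_divisor)
      then have "valuation V z - (if V = P then 1 else 0) = 2 * - Poly_Mapping.lookup E V" by simp
      then show ?thesis by (metis dvd_triv_left)
    qed
    then show "\<exists>z. z \<noteq> 0 \<and> (\<forall>V\<in>places (const_K \<phi>). even (valuation V z - (if V = P then 1 else 0)))"
      using z(1) by blast
  next
    assume "\<exists>z. z \<noteq> 0 \<and> (\<forall>V\<in>places (const_K \<phi>). even (valuation V z - (if V = P then 1 else 0)))"
    then obtain z where z: "z \<noteq> 0"
      "\<And>V. V \<in> places (const_K \<phi>) \<Longrightarrow> even (valuation V z - (if V = P then 1 else 0))" by blast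
    \<comment> \<open>E is half of P - div z, coefficient by coefficient; the integer division is
      exact at all places by evenness.\<close>
    let ?h = "\<lambda>V. Poly_Mapping.lookup (frag_of P - principal_divisor (const_K \<phi>) z) V div 2"
    define E where "E = Abs_poly_mapping ?h"
    have "{V. ?h V \<noteq> 0} \<subseteq> Poly_Mapping.keys (frag_of P - principal_divisor (const_K \<phi>) z)"
      by (auto simp: in_keys_iff simp del: lookup_frag_of)
    then have "finite {V. ?h V \<noteq> 0}" using finite_keys finite_subset by blast
    then have E: "Poly_Mapping.lookup E = ?h" unfolding E_def by (rule lookup_Abs_poly_mapping)
    have "E \<in> carrier ?D"
      using P z(1) by (auto simp: Div_def in_keys_iff E lookup_minus lookup_principal_divisor split: if_splits)
    moreover have "frag_of P = principal_divisor (const_K \<phi>) z + (E + E)"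
    proof (rule poly_mapping_eqI)
      fix V
      show "Poly_Mapping.lookup (frag_of P) V = Poly_Mapping.lookup (principal_divisor (const_K \<phi>) z + (E + E)) V"
        using z(2)[of V] P z(1)
        by (auto simp: lookup_add E lookup_minus lookup_principal_divisor elim!: evenE)
    qed
    ultimately show "\<exists>E\<in>carrier ?D. \<exists>z. z \<noteq> 0 \<and> frag_of P = principal_divisor (const_K \<phi>) z + (E + E)"
      using z(1) by blast
  qed
  finally show ?thesis .
qed

end

section \<open>Norms\<close>

text \<open>An irreducible factor p cannot occur exactly once, so p^2 splits off and the degree
  drops.\<close>

lemma poly_const_times_square:
  fixes a :: "'k::field poly"
  assumes "a \<noteq> 0" and "\<And>p. monic_irreducible p \<Longrightarrow> even (valuation (place_at p) (Fract a 1))"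
  shows "\<exists>c q. a = smult c (q\<^sup>2)"
  using assms
proof (induction "degree a" arbitrary: a rule: less_induct)
  case less
  show ?case
  proof (cases "degree a = 0")
    case True
    then obtain c where "a = [:c:]" using degree_eq_zeroE by blast
    then show ?thesis by (intro exI[of _ c] exI[of _ 1]) simp
  next
    case False
    then obtain p where p: "monic_irreducible p" "p dvd a" using monic_irreducible_factor by blast
    then obtain b where b: "a = p * b" by blast
    have p0: "p \<noteq> 0" "Fract p 1 \<noteq> 0" and b0: "b \<noteq> 0" "Fract b 1 \<noteq> 0"
      using p less.prems(1) b by (auto simp: Fract_zero_iff)
    note Q = dvr_place_at[OF p(1)]
    have "p dvd b"
    proof (rule ccontr)
      assume "\<not> p dvd b"
      then have "Fract b 1 \<in> place_at p" "Fract b 1 \<notin> max_ideal (place_at p)"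
        using Fract_mem_place_at[OF p(1)] Fract_mem_max_ideal_place_at[OF p(1)] by auto
      then have "valuation (place_at p) (Fract b 1) = 0"
        using mem_iff_valuation[OF Q b0(2)] max_ideal_iff_valuation[OF Q b0(2)] by simp
      then have "valuation (place_at p) (Fract a 1) = 1"
        unfolding b Fract_mult_1 valuation_mult[OF Q p0(2) b0(2)] valuation_uniformizer[OF Q] by simp
      then show False using less.prems(2)[OF p(1)] by simp
    qed
    then obtain a' where a': "b = p * a'" by blast
    have a'0: "a' \<noteq> 0" "Fract a' 1 \<noteq> 0" using a' b0 by (auto simp: Fract_zero_iff)
    have "degree p > 0"
      using p is_unit_iff_degree[OF p0(1)] by (auto simp: comm_semiring_1_class.irreducible_def)
    then have "degree a' < degree a" using p0 a'0 by (simp add: b a' degree_mult_eq)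
    moreover have "even (valuation (place_at q) (Fract a' 1))" if q: "monic_irreducible q" for q
    proof -
      have "valuation (place_at q) (Fract a 1) = 2 * valuation (place_at q) (Fract p 1) + valuation (place_at q) (Fract a' 1)"
        unfolding b a' Fract_mult_1
        using p0 a'0 by (subst valuation_mult[OF dvr_place_at[OF q]], simp, simp del: mult_fract,
            subst valuation_mult[OF dvr_place_at[OF q]]) simp_all
      then show ?thesis using less.prems(2)[OF q] by simp
    qed
    ultimately obtain c q where "a' = smult c (q\<^sup>2)" using less.hyps[of a'] a'0(1) by blast
    then have "a = smult c ((p * q)\<^sup>2)" by (simp add: a' b power2_eq_square mult.assoc mult.left_commute)
    then show ?thesis by blast
  qed
qed

text \<open>Up to the square b^2, the fraction a / b is the polynomial a b.\<close>

lemma const_times_square: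
  fixes g :: "'k::field poly fract"
  assumes "g \<noteq> 0" and even: "\<And>p. monic_irreducible p \<Longrightarrow> even (valuation (place_at p) g)"
  obtains c h where "c \<noteq> 0" "h \<noteq> 0" "g = const_L c * h\<^sup>2"
proof -
  obtain a b where g: "g = Fract a b" "a \<noteq> 0" "b \<noteq> 0" using assms(1) by (rule fract_cases_nonzero)
  have nz: "Fract a 1 \<noteq> 0" "Fract b 1 \<noteq> 0" using g by (simp_all add: Fract_zero_iff)
  have e: "g = Fract a 1 / Fract b 1" using g by simp
  have "even (valuation (place_at p) (Fract (a * b) 1))" if p: "monic_irreducible p" for p
  proof -
    note Q = dvr_place_at[OF p]
    have "valuation (place_at p) (Fract (a * b) 1) = valuation (place_at p) g + 2 * valuation (place_at p) (Fract b 1)"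
      unfolding e Fract_mult_1 valuation_mult[OF Q nz] valuation_divide[OF Q nz] by simp
    then show ?thesis using even[OF p] by simp
  qed
  then obtain c q where cq: "a * b = smult c (q\<^sup>2)" using poly_const_times_square[of "a * b"] g by auto
  have c: "c \<noteq> 0" "q \<noteq> 0" using cq g by auto
  have "g = Fract (a * b) 1 / (Fract b 1)\<^sup>2"
    unfolding e Fract_mult_1 using nz by (simp add: power2_eq_square del: divide_fract mult_fract)
  also have "Fract (a * b) 1 = const_L c * (Fract q 1)\<^sup>2"
    unfolding cq const_L_def Fract_power[symmetric] by simp
  finally have "g = const_L c * (Fract q 1 / Fract b 1)\<^sup>2" by (simp only: power_divide times_divide_eq_right)
  moreover have "Fract q 1 / Fract b 1 \<noteq> 0" using nz c by (simp add: Fract_zero_iff del: divide_fract)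
  ultimately show thesis using that c by blast
qed

text \<open>Leading coefficients of rational functions are compared in the residue field at infinity:
  \<open>one_units\<close> are the functions of degree 0 with leading coefficient 1.\<close>

definition one_units :: "'k::field poly fract set" where
  "one_units = {u. u - 1 \<in> max_ideal place_at_infinity}"

lemma one_units_mult: "u \<in> one_units \<Longrightarrow> w \<in> one_units \<Longrightarrow> u * w \<in> one_units"
proof -
  note R = dvr_valuation_ring[OF dvr_place_at_infinity]
  assume u: "u \<in> one_units" and w: "w \<in> one_units"
  have "u - 1 + 1 \<in> place_at_infinity"
    using u max_ideal_mem[OF R] valuation_ring_one[OF R] unfolding one_units_def
    by (intro valuation_ring_add[OF R]) auto
  then have "u * (w - 1) + (u - 1) \<in> max_ideal place_at_infinity"
    using u w by (intro max_ideal_add[OF R] max_ideal_mult[OF R]) (auto simp: one_units_def)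
  then show ?thesis by (simp add: one_units_def algebra_simps)
qed

lemma one_units_monic:
  assumes "lead_coeff (p :: 'k::field poly) = 1"
  shows "Fract p 1 / Fract [:0, 1:] 1 ^ degree p \<in> one_units"
proof -
  let ?x = "[:0, 1 :: 'k:] ^ degree p"
  have x: "?x \<noteq> 0" "degree ?x = degree p" by (auto simp: degree_power_eq)
  have "lead_coeff ?x = 1" by (simp only: lead_coeff_power) simp
  then have "coeff (p - ?x) (degree p) = 0" using assms x by simp
  moreover have "degree (p - ?x) \<le> degree p" using x by (intro degree_diff_le) auto
  ultimately have "p - ?x = 0 \<or> degree (p - ?x) < degree ?x" using x by (metis eq_zero_or_degree_less)
  then have "Fract (p - ?x) ?x \<in> max_ideal place_at_infinity" by (rule max_ideal_place_at_infinity[OF x(1)])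
  moreover have "Fract (p - ?x) ?x = Fract p 1 / Fract [:0, 1:] 1 ^ degree p - 1"
    using x(1) unfolding Fract_power[symmetric] Fract_divide[OF x(1)] Fract_diff_1
    by (simp add: diff_divide_distrib Fract_zero_iff del: divide_fract diff_fract)
  ultimately show ?thesis by (simp add: one_units_def)
qed

text \<open>The function w is regular at infinity because its square is. If e is its value there,
  reduction gives c e^2 = 1 in k, as a constant vanishing at infinity is 0.\<close>

lemma const_square_of_one_unit:
  assumes "const_L c * w\<^sup>2 \<in> one_units" "c \<noteq> 0"
  obtains e where "c * e\<^sup>2 = 1"
proof -
  note Q = dvr_place_at_infinity[where 'k = 'a]
  note R = dvr_valuation_ring[OF Q]
  have const: "const_L a \<in> place_at_infinity" for a :: 'a
    unfolding place_at_infinity_def const_L_def by force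
  have L: "const_L a * const_L b = const_L (a * b)" "const_L a - const_L b = const_L (a - b)" "const_L 1 = (1 :: 'a poly fract)"
    for a b :: 'a by (simp_all add: const_L_def One_fract_def one_pCons mult.commute)
  have "const_L c * w\<^sup>2 - 1 + 1 \<in> place_at_infinity"
    using assms(1) max_ideal_mem[OF R] valuation_ring_one[OF R] unfolding one_units_def
    by (intro valuation_ring_add[OF R]) auto
  then have "const_L (inverse c) * (const_L c * w\<^sup>2) \<in> place_at_infinity"
    using valuation_ring_mult[OF R const] by simp
  moreover have "const_L (inverse c) * (const_L c * w\<^sup>2) = w\<^sup>2"
    using assms(2) by (simp add: L mult.assoc[symmetric])
  ultimately have w: "w \<in> place_at_infinity" using valuation_ring_square[OF R] by simp
  obtain e where e: "w - const_L e \<in> max_ideal place_at_infinity" using residue_place_at_infinity[OF w] .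
  have "const_L c * (w + const_L e) * (w - const_L e) \<in> max_ideal place_at_infinity"
    using e w const by (intro max_ideal_mult[OF R] valuation_ring_mult[OF R] valuation_ring_add[OF R])
  from max_ideal_diff[OF R _ this] assms(1)
  have "(const_L c * w\<^sup>2 - 1) - const_L c * (w + const_L e) * (w - const_L e) \<in> max_ideal place_at_infinity"
    by (simp add: one_units_def)
  moreover have "(const_L c * w\<^sup>2 - 1) - const_L c * (w + const_L e) * (w - const_L e) =
      const_L c * (const_L e * const_L e) - const_L 1"
    by (simp add: L(3) algebra_simps power2_eq_square)
  ultimately have m: "const_L (c * (e * e) - 1) \<in> max_ideal place_at_infinity" by (simp only: L(1,2))
  have "c * (e * e) - 1 = 0"
  proof (rule ccontr)
    assume n: "c * (e * e) - 1 \<noteq> 0"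
    have "const_L (inverse (c * (e * e) - 1)) * const_L (c * (e * e) - 1) \<in> max_ideal place_at_infinity"
      by (rule max_ideal_mult[OF R const m])
    moreover have "const_L (inverse (c * (e * e) - 1)) * const_L (c * (e * e) - 1) = 1"
      unfolding L(1) left_inverse[OF n] L(3) ..
    ultimately show False using max_ideal_one[OF R] by (simp only: not_True_eq_False)
  qed
  then show thesis using that[of e] by (simp add: power2_eq_square)
qed

context hyperelliptic_function_field
begin

text \<open>In a^2 - b^2 f the first term has even and the second odd valuation at infinity. If the
  norm has even valuation, a^2 dominates, so dividing by a^2 leaves leading coefficient 1.\<close>

lemma nrm_one_unit:
  assumes z: "z \<noteq> 0" and even: "even (valuation place_at_infinity (nrm z))"
  obtains w where "w \<noteq> 0" "nrm z / w\<^sup>2 \<in> one_units"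
proof -
  note Q = dvr_place_at_infinity[where 'k = 'k]
  obtain a b where ab: "z = el a b" by (rule el_cases)
  have F: "Fract f 1 \<noteq> 0" using f_nonzero by (simp add: Fract_zero_iff)
  have vb: "valuation place_at_infinity (- (b\<^sup>2 * Fract f 1)) = 2 * valuation place_at_infinity b - int (degree f)"
    if "b \<noteq> 0"
    using that F valuation_place_at_infinity[OF f_nonzero]
    by (simp add: valuation_uminus[OF Q] valuation_mult[OF Q] valuation_power[OF Q])
  have a0: "a \<noteq> 0"
  proof
    assume "a = 0"
    moreover from this have "b \<noteq> 0" using z ab by (auto simp: el_eq_0_iff)
    ultimately show False using even vb odd_degree by (simp add: ab nrm_el)
  qed
  have va: "valuation place_at_infinity (a\<^sup>2) = 2 * valuation place_at_infinity a"
    using a0 by (simp add: valuation_power[OF Q])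
  have "nrm z / a\<^sup>2 - 1 \<in> max_ideal place_at_infinity"
  proof (cases "b = 0")
    case True
    then show ?thesis using a0 max_ideal_zero[OF dvr_valuation_ring[OF Q]] by (simp add: ab nrm_el)
  next
    case False
    let ?A = "a\<^sup>2" and ?B = "- (b\<^sup>2 * Fract f 1)"
    have nz: "?A \<noteq> 0" "?B \<noteq> 0" using a0 False F by auto
    have n: "nrm z = ?B + ?A" by (simp add: ab nrm_el)
    have "valuation place_at_infinity ?A < valuation place_at_infinity ?B"
    proof (rule ccontr)
      assume "\<not> ?thesis"
      moreover have "valuation place_at_infinity ?A \<noteq> valuation place_at_infinity ?B"
        unfolding va vb[OF False] using odd_degree by presburger
      ultimately have "valuation place_at_infinity (nrm z) = valuation place_at_infinity ?B"
        unfolding n using valuation_add_eq(2)[OF Q nz(2,1)] by linarith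
      then show False using even vb[OF False] odd_degree by simp
    qed
    then have "valuation place_at_infinity (?B / ?A) > 0" unfolding valuation_divide[OF Q nz(2,1)] by simp
    moreover have "?B / ?A \<noteq> 0" using nz by simp
    ultimately have "?B / ?A \<in> max_ideal place_at_infinity" using max_ideal_iff_valuation[OF Q] by blast
    moreover have "nrm z / ?A - 1 = ?B / ?A" unfolding n using nz by (simp add: field_simps)
    ultimately show ?thesis by simp
  qed
  then show thesis using that[of a] a0 by (simp add: one_units_def)
qed

section \<open>A finite point P and the prime p below it\<close>

context
  fixes P p
  assumes p: "monic_irreducible p" and P: "lies_over P (place_at p)"
begin

text \<open>The facts about P are attached as implications from q = p, so that parity arguments can
  run over all primes q without treating p separately.\<close>

lemma inertia_degree_cases:
  assumes q: "monic_irreducible q"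
  obtains
    (ramified) W where "\<And>U. lies_over U (place_at q) \<longleftrightarrow> U = W"
      "\<And>z. z \<noteq> 0 \<Longrightarrow> valuation (place_at q) (nrm z) = valuation W z"
      "q = p \<longleftrightarrow> W = P" "q = p \<Longrightarrow> inertia_degree \<phi> P = 1"
      "q = p \<Longrightarrow> place_degree (const_K \<phi>) P = degree p"
  | (inert) W where "\<And>U. lies_over U (place_at q) \<longleftrightarrow> U = W"
      "\<And>z. z \<noteq> 0 \<Longrightarrow> valuation (place_at q) (nrm z) = 2 * valuation W z"
      "q = p \<longleftrightarrow> W = P" "q = p \<Longrightarrow> inertia_degree \<phi> P = 2"
  | (split) W W' where "W \<noteq> W'" "\<And>U. lies_over U (place_at q) \<longleftrightarrow> U = W \<or> U = W'"
      "\<And>z. z \<noteq> 0 \<Longrightarrow> valuation (place_at q) (nrm z) = valuation W z + valuation W' z"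
      "\<And>a. a \<noteq> 0 \<Longrightarrow> valuation W (i a) = valuation (place_at q) a"
      "\<And>a. a \<noteq> 0 \<Longrightarrow> valuation W' (i a) = valuation (place_at q) a"
      "q = p \<longleftrightarrow> W = P \<or> W' = P" "q = p \<Longrightarrow> inertia_degree \<phi> P = 1"
      "q = p \<Longrightarrow> place_degree (const_K \<phi>) P = degree p"
proof -
  have qp: "q = p \<longleftrightarrow> lies_over P (place_at q)"
    using P p q place_at_inj[OF p q] by (auto simp: lies_over_def)
  have one: "inertia_degree \<phi> P = 1" "place_degree (const_K \<phi>) P = degree p"
    if "\<And>z. z \<in> P \<Longrightarrow> \<exists>r\<in>place_at p. z - i r \<in> max_ideal P"
    using inertia_eq_1[OF P that] place_degree_affine[OF p P that] inertia_degree_eq[OF P] by auto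
  show thesis
    using q
  proof (cases rule: places_over_cases)
    case (ramified W)
    show ?thesis
      by (rule that(1)[OF ramified(1,3)]) (use qp ramified(1,4) one in auto)
  next
    case (inert W)
    show ?thesis
      by (rule that(2)[OF inert(1,3)]) (use qp inert(1,4) inertia_degree_eq[OF P] in auto)
  next
    case (split W W')
    show ?thesis
      by (rule that(3)[OF split(1,2,5,6,7)]) (use qp split(2,8,9) one in auto)
  qed
qed

text \<open>The inertia degree is nonzero in each case, so the norm of P is supported exactly at
  p.\<close>

lemma n_divisor_eq: "n_divisor \<phi> (frag_of P) = Fract p 1 ^ inertia_degree \<phi> P"
proof -
  have e: "inertia_degree \<phi> P \<noteq> 0"
    using p by (cases rule: inertia_degree_cases) auto
  have cov: "covering \<phi> P = place_at p" by (rule lies_over_place_at[OF p P])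
  have "Poly_Mapping.keys (divisor_norm \<phi> (frag_of P)) = {place_at p}"
    using e by (auto simp: divisor_norm_def cov in_keys_iff split: if_splits)
  then show ?thesis
    by (simp add: n_divisor_def divisor_function_def divisor_norm_def cov point_function_place_at[OF p])
qed

lemma valuation_n_divisor:
  assumes q: "monic_irreducible q"
  shows "valuation (place_at q) (n_divisor \<phi> (frag_of P)) = (if q = p then int (inertia_degree \<phi> P) else 0)"
proof -
  have "Fract p 1 \<noteq> 0" using p by (auto simp: Fract_zero_iff)
  then show ?thesis
    using valuation_place_at_other[OF q p] by (simp add: n_divisor_eq valuation_power[OF dvr_place_at[OF q]])
qed

context
  assumes even_degree: "even (place_degree (const_K \<phi>) P)"
begin

text \<open>In the inert case the exponent is 2; otherwise deg p is the degree of P, which is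
  even.\<close>

lemma even_norm_degree: "even (inertia_degree \<phi> P * degree p)"
  using p by (cases rule: inertia_degree_cases) (use even_degree in auto)

lemma n_divisor_nonzero: "n_divisor \<phi> (frag_of P) \<noteq> 0"
  using p by (auto simp: n_divisor_eq Fract_zero_iff)

lemma valuation_infinity_n_divisor: "even (valuation place_at_infinity (n_divisor \<phi> (frag_of P)))"
proof -
  have nz: "p \<noteq> 0" "Fract p 1 \<noteq> 0" using p by (auto simp: Fract_zero_iff)
  have "valuation place_at_infinity (n_divisor \<phi> (frag_of P)) = - int (inertia_degree \<phi> P * degree p)"
    unfolding n_divisor_eq valuation_power[OF dvr_place_at_infinity nz(2)] valuation_place_at_infinity[OF nz(1)]
    by simp
  then show ?thesis using even_norm_degree by simp
qed

text \<open>n(P) is monic of even degree 2 j, so dividing by the square of x^j leaves leading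
  coefficient 1.\<close>

lemma n_divisor_one_unit:
  obtains w where "w \<noteq> 0" "n_divisor \<phi> (frag_of P) / w\<^sup>2 \<in> one_units"
proof -
  obtain j where j: "inertia_degree \<phi> P * degree p = 2 * j" using even_norm_degree by (elim evenE)
  let ?X = "Fract [:0, 1 :: 'k:] 1"
  let ?e = "inertia_degree \<phi> P"
  have "lead_coeff (p ^ ?e) = 1" using p by (simp add: lead_coeff_power)
  from one_units_monic[OF this] have "Fract (p ^ ?e) 1 / ?X ^ degree (p ^ ?e) \<in> one_units" .
  moreover have "degree (p ^ ?e) = 2 * j" using p j by (subst degree_power_eq) auto
  ultimately have "n_divisor \<phi> (frag_of P) / (?X ^ j)\<^sup>2 \<in> one_units"
    by (simp add: n_divisor_eq Fract_power mult.commute flip: power_mult)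
  moreover have "?X ^ j \<noteq> 0" by (simp add: Fract_zero_iff)
  ultimately show thesis using that by blast
qed

lemma norm_if_two_divisible:
  assumes z: "z \<noteq> 0" and even: "\<And>V. V \<in> places (const_K \<phi>) \<Longrightarrow> even (valuation V z - (if V = P then 1 else 0))"
  shows "\<exists>w. w \<noteq> 0 \<and> n_divisor \<phi> (frag_of P) = nrm w"
proof -
  let ?n = "n_divisor \<phi> (frag_of P)"
  note n0 = n_divisor_nonzero
  have N0: "nrm z \<noteq> 0" using z by (simp add: nrm_eq_0_iff)
  \<comment> \<open>Above a ramified or split q, the valuations of z add up to an odd number exactly
    when P is among the places, that is when q = p, and then n(P) contributes 1. At an inert q both
    contributions are even.\<close>
  have "even (valuation (place_at q) (?n * nrm z))" if q: "monic_irreducible q" for q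
  proof -
    note v = valuation_mult[OF dvr_place_at[OF q] n0 N0] valuation_n_divisor[OF q]
    note pl = lies_over_place_at(1)[OF q]
    from q show ?thesis
    proof (cases rule: inertia_degree_cases)
      case (ramified W)
      have "even (valuation W z - (if W = P then 1 else 0))" by (intro even pl) (simp add: ramified(1))
      then show ?thesis unfolding v ramified(2)[OF z] using ramified(3,4) by (auto split: if_splits)
    next
      case (inert W)
      then show ?thesis unfolding v inert(2)[OF z] by auto
    next
      case (split W W')
      have "even (valuation W z - (if W = P then 1 else 0))" "even (valuation W' z - (if W' = P then 1 else 0))"
        by (intro even pl; simp add: split(2))+
      then show ?thesis unfolding v split(3)[OF z] using split(1,6,7) by (auto split: if_splits)
    qed
  qed
  then obtain c h where ch: "c \<noteq> 0" "h \<noteq> 0" "?n * nrm z = const_L c * h\<^sup>2"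
    using const_times_square[of "?n * nrm z"] n0 N0 by auto
  have c0: "const_L c \<noteq> 0" using ch(1) by (simp add: const_L_def Fract_zero_iff)
  note Q = dvr_place_at_infinity[where 'k = 'k]
  have "valuation place_at_infinity (const_L c) = 0"
    using ch(1) valuation_place_at_infinity[of "[:c:]"] by (simp add: const_L_def)
  then have "valuation place_at_infinity ?n + valuation place_at_infinity (nrm z) = 2 * valuation place_at_infinity h"
    using arg_cong[OF ch(3), of "valuation place_at_infinity"] n0 N0 c0 ch(2)
    by (simp add: valuation_mult[OF Q] valuation_power[OF Q])
  \<comment> \<open>The constant has valuation 0 and h^2 an even one, as has n(P), so n(z) is left
    with an even valuation.\<close>
  then have "even (valuation place_at_infinity (nrm z))" using valuation_infinity_n_divisor by presburger
  then obtain w1 where w1: "w1 \<noteq> 0" "nrm z / w1\<^sup>2 \<in> one_units" using nrm_one_unit[OF z] by blast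
  obtain w2 where w2: "w2 \<noteq> 0" "?n / w2\<^sup>2 \<in> one_units" using n_divisor_one_unit by blast
  have "(?n / w2\<^sup>2) * (nrm z / w1\<^sup>2) = const_L c * (h / (w2 * w1))\<^sup>2"
    using ch(3) w1 w2 by (simp add: power_divide power_mult_distrib)
  then have "const_L c * (h / (w2 * w1))\<^sup>2 \<in> one_units" using one_units_mult[OF w2(2) w1(2)] by simp
  \<comment> \<open>Both normalized factors have leading coefficient 1, hence so has c times a
    square; this forces c to be the square of 1 / e.\<close>
  then obtain e where e: "c * e\<^sup>2 = 1" using const_square_of_one_unit ch(1) by blast
  have e0: "const_L e \<noteq> 0" using e by (auto simp: const_L_def Fract_zero_iff)
  have "const_L c * (const_L e)\<^sup>2 = 1"
    using e by (simp add: const_L_def power2_eq_square One_fract_def one_pCons mult.commute)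
  then have sq: "const_L c * h\<^sup>2 = (h / const_L e)\<^sup>2" using e0 by (simp add: power_divide field_simps)
  have "?n = (?n * nrm z) / nrm z" using N0 by simp
  also have "\<dots> = (h / const_L e)\<^sup>2 / nrm z" by (simp only: ch(3) sq)
  \<comment> \<open>An element of L has its square as norm, so n(P) = (h / e)^2 / n(z) is a
    norm.\<close>
  also have "\<dots> = nrm (i (h / const_L e) * inverse z)"
    by (simp only: nrm_mult nrm_inverse nrm_i divide_inverse)
  finally show ?thesis using z ch(2) e0 by (intro exI[of _ "i (h / const_L e) * inverse z"]) (simp add: i_eq_0_iff)
qed

lemma two_divisible_if_norm:
  assumes l: "l \<noteq> 0" and norm: "n_divisor \<phi> (frag_of P) = nrm l"
  shows "\<exists>z. z \<noteq> 0 \<and> (\<forall>V\<in>places (const_K \<phi>). even (valuation V z - (if V = P then 1 else 0)))"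
proof -
  let ?d = "\<lambda>V. valuation V l - (if V = P then 1 else 0)"
  define S where "S = {V \<in> places (const_K \<phi>). odd (?d V)}"
  \<comment> \<open>Only split primes lie in \<open>T\<close>, and then the parity is wrong at both places above the prime.\<close>
  define T where "T = {q. monic_irreducible q \<and> (\<exists>V\<in>S. lies_over V (place_at q))}"
  have "S \<subseteq> insert P {V \<in> places (const_K \<phi>). valuation V l \<noteq> 0}" by (auto simp: S_def)
  then have "finite S" using finite_support[OF l] by (meson finite_insert finite_subset)
  \<comment> \<open>A place determines the prime below it, so each of these sets has at most one
    element.\<close>
  moreover have "finite {q. monic_irreducible q \<and> lies_over V (place_at q)}" for V
  proof -
    have "{q. monic_irreducible q \<and> lies_over V (place_at q)} \<subseteq> {THE q. monic_irreducible q \<and> lies_over V (place_at q)}"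
    proof
      fix q assume q: "q \<in> {q. monic_irreducible q \<and> lies_over V (place_at q)}"
      have "(THE q. monic_irreducible q \<and> lies_over V (place_at q)) = q"
        by (rule the_equality) (use q place_at_inj in \<open>auto simp: lies_over_def\<close>)
      then show "q \<in> {THE q. monic_irreducible q \<and> lies_over V (place_at q)}" by simp
    qed
    then show ?thesis by (rule finite_subset) simp
  qed
  moreover have "T = (\<Union>V\<in>S. {q. monic_irreducible q \<and> lies_over V (place_at q)})" by (auto simp: T_def)
  ultimately have T: "finite T" by simp
  define g where "g = (\<Prod>q\<in>T. Fract q 1)"
  have nzT: "Fract q 1 \<noteq> 0" if "q \<in> T" for q using that by (auto simp: T_def Fract_zero_iff)
  have g0: "g \<noteq> 0" unfolding g_def using T nzT by (simp add: prod_zero_iff)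
  have vg: "valuation (place_at q) g = (if q \<in> T then 1 else 0)" if q: "monic_irreducible q" for q
  proof -
    have "valuation (place_at q) g = (\<Sum>r\<in>T. if q = r then 1 else 0)"
    proof -
      have "valuation (place_at q) g = (\<Sum>r\<in>T. valuation (place_at q) (Fract r 1))"
        unfolding g_def by (rule valuation_prod[OF dvr_place_at[OF q] T nzT])
      also have "\<dots> = (\<Sum>r\<in>T. if q = r then 1 else 0)"
        by (intro sum.cong refl valuation_place_at_other[OF q]) (simp add: T_def)
      finally show ?thesis .
    qed
    then show ?thesis using T by simp
  qed
  have ig0: "i g \<noteq> 0" using g0 by (simp add: i_eq_0_iff)
  have nig: "nrm (i g) = g\<^sup>2" by (rule nrm_i)
  have "even (valuation V (l * i g) - (if V = P then 1 else 0))" if V: "V \<in> places (const_K \<phi>)" for V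
  proof -
    obtain t where t: "dvr V t" using places_dvr[OF V] by blast
    have v: "valuation V (l * i g) = valuation V l + valuation V (i g)" by (rule valuation_mult[OF t l ig0])
    from V show ?thesis
    proof (cases rule: places_cases)
      case (affine q)
      note vn = valuation_n_divisor[OF affine(1), unfolded norm]
      have vg2: "valuation (place_at q) (nrm (i g)) = 2 * valuation (place_at q) g"
        unfolding nig using g0 by (simp add: valuation_power[OF dvr_place_at[OF affine(1)]])
      have inS: "odd (?d U) \<longleftrightarrow> U \<in> S" if "lies_over U (place_at q)" for U
        using lies_over_place_at(1)[OF affine(1) that] by (simp add: S_def)
      have qT: "q \<in> T \<longleftrightarrow> (\<exists>U. lies_over U (place_at q) \<and> odd (?d U))"
        unfolding T_def mem_Collect_eq using affine(1) inS by blast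
      from affine(1) show ?thesis
      proof (cases rule: inertia_degree_cases)
        case (ramified W)
        have W: "V = W" using affine(2) ramified(1) by blast
        \<comment> \<open>At a ramified prime l has exactly the required valuation, and g
          contributes an even one.\<close>
        have "?d V = 0" using vn ramified(2)[OF l] ramified(3,4) W by (auto split: if_splits)
        moreover have "valuation V (i g) = 2 * valuation (place_at q) g" using ramified(2)[OF ig0] vg2 W by simp
        ultimately show ?thesis unfolding v by simp
      next
        case (inert W)
        have W: "V = W" using affine(2) inert(1) by blast
        \<comment> \<open>Both sides of the norm equation are doubled here, so l is again exact; q
          is not in \<open>T\<close>, and g is a unit at q.\<close>
        have d: "?d V = 0" using vn inert(2)[OF l] inert(3,4) W by (auto split: if_splits)
        then have "q \<notin> T" unfolding qT inert(1) using W by auto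
        then have "valuation V (i g) = 0" using inert(2)[OF ig0] vg2 W vg[OF affine(1)] by simp
        then show ?thesis unfolding v using d by simp
      next
        case (split W W')
        \<comment> \<open>The norm equation at q says that the deviations at the two places cancel.
          Their parities agree, so the factor q, of valuation 1 at both, corrects both or is
          absent.\<close>
        have "?d W + ?d W' = 0" using vn split(3)[OF l] split(1,6,7) by (auto split: if_splits)
        then have "?d W = - ?d W'" by linarith
        then have d: "odd (?d W) \<longleftrightarrow> odd (?d W')" by (simp only: even_minus)
        have VW: "V = W \<or> V = W'" using affine(2) split(2) by blast
        have "q \<in> T \<longleftrightarrow> odd (?d W) \<or> odd (?d W')" unfolding qT split(2) by blast
        then have "q \<in> T \<longleftrightarrow> odd (?d V)" using VW d by (elim disjE) (simp_all only: disj_absorb)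
        moreover have "valuation V (i g) = (if q \<in> T then 1 else 0)"
          using VW split(4,5)[OF g0] vg[OF affine(1)] by auto
        ultimately show ?thesis unfolding v by (auto split: if_splits)
      qed
    next
      case infinity
      have "V \<noteq> P"
      proof
        assume "V = P"
        then have "place_degree (const_K \<phi>) P = 1" using place_degree_infinity[OF infinity] by simp
        then show False using even_degree by simp
      qed
      \<comment> \<open>At the ramified place infinity the valuation of l is that of n(l) =
        n(P).\<close>
      moreover have "even (valuation V l)"
        using place_at_infinity_extension(2)[OF infinity l] valuation_infinity_n_divisor norm by simp
      moreover have "valuation V (i g) = 2 * valuation place_at_infinity g"
        using place_at_infinity_extension(2)[OF infinity ig0] g0
        by (simp add: nig valuation_power[OF dvr_place_at_infinity])
      ultimately show ?thesis unfolding v by simp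
    qed
  qed
  then show ?thesis using l ig0 by (intro exI[of _ "l * i g"]) simp
qed

end

end

end

theorem mainTheorem3:
  fixes f :: "'k::{field,finite} poly"
    and \<phi> :: "'k poly poly \<Rightarrow> 'K::field"
    and P :: "'K set"
  assumes "CHAR('k) \<noteq> 2"
    and "odd (degree f)" and "degree f \<ge> 3"
    and "smooth_affine_curve (hyperelliptic_poly f)"
    and "is_function_field_of \<phi> (hyperelliptic_poly f)"
    and "P \<in> places (const_K \<phi>)"
    and "even (place_degree (const_K \<phi>) P)"
  shows "divisor_class (const_K \<phi>) (frag_of P) \<in> two_Pic (const_K \<phi>) \<longleftrightarrow>
    (\<exists>z. z \<noteq> 0 \<and> n_divisor \<phi> (frag_of P) = n_field \<phi> z)"
proof -
  interpret hyperelliptic_function_field f \<phi>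
    by unfold_locales (use assms in auto)
  from assms(6) show ?thesis
  proof (cases rule: places_cases)
    case (affine p)
    show ?thesis
      unfolding divisor_class_in_two_Pic_iff[OF assms(6)] n_field_eq
      using norm_if_two_divisible[OF affine assms(7)] two_divisible_if_norm[OF affine assms(7)] by blast
  next
    \<comment> \<open>This contradicts the even degree, since infinity has degree 1.\<close>
    case infinity
    then show ?thesis using place_degree_infinity assms(7) by simp
  qed
qed

end
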